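(* Every square-free graph with at most $16$ vertices is 101-colourable. Moreover, up to isomorphism there is exactly one square-free graph with $17$ vertices that is not 101-colourable.
   Context: A graph is square-free if it contains no 4-cycle as a (not necessarily induced) subgraph. A finite simple undirected graph is 101-colourable if there is an assignment of a value in $\{0,1\}$ to each vertex such that (i) no two adjacent vertices are both assigned $0$, and (ii) no triangle (3-clique) has all three vertices assigned $1$. *)

theory Defs
  imports Main
begin

definition simple_graph :: "'a set \<Rightarrow> ('a \<Rightarrow> 'a \<Rightarrow> bool) \<Rightarrow> bool" where
  "simple_graph V E \<longleftrightarrow> finite V \<and> (\<forall>x y. E x y \<longrightarrow> x \<in> V \<and> y \<in> V)
     \<and> (\<forall>x y. E x y \<longrightarrow> E y x) \<and> (\<forall>x. \<not> E x x)"

definition square_free :: "'a set \<Rightarrow> ('a \<Rightarrow> 'a \<Rightarrow> bool) \<Rightarrow> bool" where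
  "square_free V E \<longleftrightarrow> \<not> (\<exists>a b c d. a \<in> V \<and> b \<in> V \<and> c \<in> V \<and> d \<in> V \<and>
      distinct [a, b, c, d] \<and> E a b \<and> E b c \<and> E c d \<and> E d a)"

definition colourable_101 :: "'a set \<Rightarrow> ('a \<Rightarrow> 'a \<Rightarrow> bool) \<Rightarrow> bool" where
  "colourable_101 V E \<longleftrightarrow> (\<exists>f :: 'a \<Rightarrow> nat. (\<forall>x\<in>V. f x \<in> {0, 1}) \<and>
      (\<forall>x\<in>V. \<forall>y\<in>V. E x y \<longrightarrow> \<not> (f x = 0 \<and> f y = 0)) \<and>
      (\<forall>x\<in>V. \<forall>y\<in>V. \<forall>z\<in>V. E x y \<and> E y z \<and> E x z \<longrightarrow> \<not> (f x = 1 \<and> f y = 1 \<and> f z = 1)))"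

definition graph_iso :: "'a set \<Rightarrow> ('a \<Rightarrow> 'a \<Rightarrow> bool) \<Rightarrow> 'b set \<Rightarrow> ('b \<Rightarrow> 'b \<Rightarrow> bool) \<Rightarrow> bool" where
  "graph_iso V E V' E' \<longleftrightarrow> (\<exists>h. bij_betw h V V' \<and> (\<forall>x\<in>V. \<forall>y\<in>V. E x y \<longleftrightarrow> E' (h x) (h y)))"

end

(* Zeros of a 101-colouring form an independent set that meets every triangle, so only the system of
   triangles and the remaining edges matter. In a square-free graph two triangles share at most one vertex,
   and three triangles that meet pairwise in distinct vertices, or a 4-cycle of such triangles, cannot occur.
   Up to isomorphism there are only about 600 such triangle systems on at most 17 vertices, the largest with
   11 triangles; they are found by adding one triangle at a time. For a fixed triangle system, every set that
   meets all triangles and is independent so far must contain a further edge of an uncolourable graph, while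
   an edge that closes a square or a new triangle is impossible; branching over the few remaining edges
   refutes every system but one, where the branching forces the graph completely.

   Both searches are carried out by rewriting with verified functions, guided by certificates. *)
theory Submission
  imports Defs "HOL-Combinatorics.Transposition"
begin

section \<open>Certificates\<close>

text \<open>All graphs with at most 17 vertices are treated together: an injection into a type of 17
  elements pads a smaller graph with isolated vertices. The one graph that survives has no isolated
  vertex, so the same search that shows uniqueness at 17 excludes every smaller order. The obstacle
  is symmetry. No canonical form is computed inside the logic; a certificate supplies a permutation
  and only its effect is checked. Checking that triangles go to triangles is enough, because the two
  systems compared have equally many triangles, so an inclusion between them is an equality. The
  triangle regarded as the last one added is chosen by a weight that is invariant under relabelling,
  and what remains after removing it is again a triangle system, since square-freeness is
  hereditary. For a fixed triangle system, an automorphism carries one uncolourable graph with these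
  triangles to another. Hence a set of extra edges is impossible as soon as it contains the image of
  a set already known to be impossible, and this keeps the branching small.\<close>

text \<open>All graphs are moved to a type with 17 elements. A vector holds one entry per vertex, so that a table
  lookup is a single rewrite step.

  An extension of a triangle system is either new (\<open>Y\<close>), or \<open>S i p\<close>: the permutation \<open>p\<close> maps the \<open>i\<close>-th
  most recently recorded system onto it. A set of extra edges is refuted in one of three ways. \<open>X\<close>: some set
  meets all triangles, and no edge inside it is present or can be added. \<open>Z z cs\<close>: the set \<open>z\<close> meets all
  triangles, and \<open>cs\<close> refutes each way of adding an edge inside \<open>z\<close>. \<open>R i p\<close>: the automorphism \<open>p\<close> of the
  triangle system maps the \<open>i\<close>-th most recently refuted set of extra edges into the present one.
  One-letter constructors keep the certificates small.\<close>

datatype vertex = A | B | C | D | E | F | G | H | I | J | K | L | M | N | U | P | Q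
datatype 'a vec = V 'a 'a 'a 'a 'a 'a 'a 'a 'a 'a 'a 'a 'a 'a 'a 'a 'a
datatype act = Y | S nat "vertex list"
datatype cert = X | Z "vertex list" "cert list" | R nat "vertex list"
definition vertices :: "vertex list" where "vertices = [A,B,C,D,E,F,G,H,I,J,K,L,M,N,U,P,Q]"

text \<open>The number in the name counts the triangles already present. There is one inner list per
  system, in the order in which the previous level lists its systems, and one action for each
  candidate triangle that passes the maximality test; other candidates consume no action.\<close>

definition ext_cert0 :: "act list list" where "ext_cert0 =
  [[Y]]"

text \<open>One refutation per system of the level, in list order. At level 11 the list starts with
  the second system, since the first one belongs to the exceptional graph.\<close>

definition kill_cert0 :: "cert list" where "kill_cert0 =
  [X]"

definition ext_cert1 :: "act list list" where "ext_cert1 =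
  [[Y,Y]]"

definition kill_cert1 :: "cert list" where "kill_cert1 =
  [X]"

definition ext_cert2 :: "act list list" where "ext_cert2 =
  [[Y,Y,Y,S 0[A,D,E,B,C]], [Y]]"

definition kill_cert2 :: "cert list" where "kill_cert2 =
  [X, Z[A,D][X]]"

definition ext_cert3 :: "act list list" where "ext_cert3 =
  [[Y], [Y,Y,S 0[B,A,C,F,G,D,E],Y,Y,S 0[B,A,C,F,G,D,E]], [Y,Y], [Y,Y]]"

definition kill_cert3 :: "cert list" where "kill_cert3 =
  [Z[A,D,G][Z[B,D,G][X,X],Z[B,D,G][X,X],Z[A,E,G][X,X]], X, X, Z[A,F][X]]"

definition ext_cert4 :: "act list list" where "ext_cert4 =
  [[Y,Y,Y,S 0[A,D,E,B,C],S 1[F,G,H,I,J,A,B,C,D,E],S 0[F,G,H,I,J,A,B,C,D,E],S 0[F,I,J,G,H,A,B,C,D,E]], [Y], [Y,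
  Y], [Y], [Y,Y,Y,Y,S 1[A,D,E,B,C,H,I,F,G],S 0[A,D,E,B,C,H,I,F,G],Y,S 0[A,D,E,B,C,H,I,F,G],Y], [Y,Y,S 0[B,A,C,
  F,G,D,E],S 0[C,A,B,H,I,D,E,F,G],S 4[A,B,C,D,E,F,G,J,K,H,I],S 4[B,A,C,F,G,D,E,J,K,H,I],S 4[C,A,B,H,I,D,E,J,K,
  F,G]], [Y,Y,Y], [Y,S 16[A,B,C,D,E,H,I,J,K,L,F,G]], [Y]]"

definition kill_cert4 :: "cert list" where "kill_cert4 =
  [Z[A,F][X], Z[A,F,I][Z[A,G,I][X,X],Z[A,F,J][X,X],Z[A,G,I][X,X]], X, Z[A,H][X], X, X, X, Z[B,D,H][X,X], Z[A,
  D,G,J][Z[B,E,G,J][Z[C,D,G,J][Z[A,E,G,J][Z[B,D,H,J][X],Z[C,D,G,K][X]],Z[A,E,G,J][X,X],Z[B,D,H,J][X,X]],R 0[A,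
  B,C,D,E,F,J,K,L,G,H,I],R 0[D,E,F,A,B,C],R 0[D,E,F,A,B,C,J,K,L,G,H,I],Z[B,D,H,J][Z[C,D,H,J][Z[C,D,H,K][X],X],
  R 2[A,B,C,D,E,F,J,K,L,G,H,I],Z[A,E,H,J][X,X],X]],R 0[A,B,C,G,H,I,D,E,F],R 0[A,B,C,J,K,L,D,E,F,G,H,I],R 0[D,
  E,F,G,H,I,A,B,C],R 0[D,E,F,J,K,L,A,B,C,G,H,I],R 0[G,H,I,J,K,L,A,B,C,D,E,F]]]"

definition ext_cert5 :: "act list list" where "ext_cert5 =
  [[], [Y], [Y,Y,S 0[B,A,C,F,G,D,E,J,K,H,I]], [Y,Y], [Y], [Y,Y,Y,S 0[A,C,B,D,E,H,I,F,G]], [Y,Y], [Y,Y,S 0[B,A,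
  C,F,G,D,E,H,J,I],Y,S 1[D,A,E,H,I,B,C,F,J,G],S 0[A,D,E,B,C,H,I,F,G],S 1[F,B,G,H,J,A,C,D,I,E],S 0[B,F,G,A,C,H,
  J,D,E,I],S 1[H,D,I,F,J,A,E,B,G,C],S 0[D,H,I,A,E,F,J,B,C,G],S 0[F,H,J,B,G,D,I,A,C,E]], [Y,Y,S 0[B,A,C,F,G,D,
  E,J,K,H,I],Y,Y,Y,S 1[B,A,C,F,G,D,E,J,K,H,I],S 0[B,A,C,F,G,D,E,J,K,H,I],Y,S 0[B,A,C,F,G,D,E,J,K,H,I],Y], [Y,
  Y,Y,S 0[A,C,B,D,E,J,K,H,I,F,G],Y,Y,S 9[A,B,C,D,E,F,G,H,I,L,M,J,K],S 7[A,D,E,B,C,H,I,F,G,L,M,J,K],S 9[A,C,B,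
  D,E,J,K,H,I,L,M,F,G]], [Y,Y,Y,Y], [Y,Y,S 4[A,B,C,D,E,F,G,H,I,L,M,J,K],S 4[A,D,E,B,C,H,I,F,G,L,M,J,K],Y], [Y,
  Y], [Y], [Y,Y], [Y], [Y], [Y,Y,S 0[B,A,C,K,L,F,G,H,I,J,D,E],S 31[A,B,C,D,E,K,L,M,N,F,G,H,I,J],S 7[A,B,C,D,E,
  K,L,M,N,F,G,H,I,J],Y,Y,S 0[A,B,C,D,E,F,I,J,G,H],S 9[B,A,C,K,L,D,E,M,N,F,G,H,I,J]], [Y,Y,Y], [Y,Y]]"

definition kill_cert5 :: "cert list" where "kill_cert5 =
  [Z[A,D,G,J,M][Z[B,E,G,J,M][Z[C,D,G,J,M][Z[A,E,H,K,M][Z[B,D,H,J,M][Z[B,E,H,J,M][X,Z[C,D,G,K,M][X]],Z[B,D,I,J,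
  M][Z[B,E,I,J,M][X],Z[B,D,I,J,N][X]],R 3[A,B,C,M,N,U,G,H,I,J,K,L,D,E,F]],Z[A,F,I,J,M][R 0[],Z[A,E,G,J,
  M][R 0[],Z[B,D,H,J,M][Z[A,E,G,J,N][X]],Z[B,D,H,J,M][Z[A,E,G,J,N][X],X],Z[C,D,G,K,M][X,X]],Z[B,D,I,J,M][Z[A,
  F,G,J,N][X,X],Z[A,E,G,J,M][X,X],Z[A,E,G,J,M][X,X],Z[A,E,G,K,M][X,Z[B,D,H,K,M][X],X]],R 6[B,A,C,G,H,I,D,E,F],
  R 0[B,A,C,G,H,I,D,E,F],Z[A,E,G,J,N][Z[B,D,H,J,N][X,X],X,Z[B,D,H,K,M][X,X],Z[A,E,I,J,N][X,Z[B,D,H,J,N][X]]]],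
  R 0[A,C,B,D,E,F,J,K,L,G,H,I],Z[A,F,H,K,M][R 0[A,B,C,D,F,E],R 0[A,C,B,D,F,E,J,K,L,G,H,I],R 0[B,C,A,G,H,I,J,K,
  L,D,E,F],Z[A,E,G,J,N][Z[B,D,H,J,N][X],Z[C,D,G,K,M][X],Z[A,E,G,J,U][X]],R 0[A,C,B,D,E,F,J,K,L,G,H,I]],R 5[B,
  C,A,G,H,I,J,K,L,D,E,F],R 0[B,A,C,G,H,I,D,E,F],R 0[C,A,B,J,K,L,D,E,F,G,H,I]],R 0[A,B,C,D,E,F,G,H,I,M,N,U,J,K,
  L],Z[C,D,G,K,M][R 0[A,B,C,D,E,F,G,H,I,K,J],R 0[A,B,C,D,E,F,G,H,I,M,N,U,J,K,L],Z[A,E,G,J,M][X,X,X],Z[C,D,G,L,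
  M][R 1[A,B,C,D,E,F,G,H,I,L,J,K],R 1[A,B,C,D,E,F,G,H,I,M,N,U,J,K,L],Z[A,E,G,J,M][X,X],Z[A,E,H,J,M][X,X],
  R 3[J,K,L,D,E,F,G,H,I,M,N,U,A,B,C]],Z[C,D,H,K,M][R 4[A,B,C,D,E,F,G,H,I,K,J],Z[A,E,H,J,M][X,X],X,Z[B,D,I,K,
  M][Z[A,E,I,K,M][X],X],Z[B,D,H,K,N][Z[A,E,H,J,M][X],Z[A,E,G,J,N][X]]],Z[C,D,G,L,M][R 11[A,B,C,D,E,F,G,H,I,L,
  J,K],R 7[A,C,B,D,E,F,M,N,U,J,K,L,G,H,I],R 7[A,B,C,D,E,F,G,H,I,J,L,K],R 0[]]],R 0[A,B,C,D,E,F,G,H,I,M,N,U,J,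
  K,L],R 0[B,A,C,G,H,I,D,E,F],R 0[B,A,C,G,H,I,D,E,F,M,N,U,J,K,L],Z[C,D,G,K,M][R 13[A,B,C,D,E,F,G,H,I,K,J],
  R 0[C,A,B,M,N,U,D,E,F,J,K,L,G,H,I],R 0[A,B,C,D,E,F,G,H,I,K,J],R 0[A,B,C,D,E,F,G,H,I,M,N,U,J,K,L],R 0[B,A,C,
  G,H,I,D,E,F,K,J],R 0[B,A,C,G,H,I,D,E,F,M,N,U,J,K,L]]],R 0[A,B,C,D,E,F,J,K,L,G,H,I],R 0[A,B,C,D,E,F,M,N,U,G,
  H,I,J,K,L],R 0[D,E,F,A,B,C],R 0[D,E,F,A,B,C,J,K,L,G,H,I],R 0[D,E,F,A,B,C,M,N,U,G,H,I,J,K,L],Z[B,E,H,K,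
  M][R 0[A,B,C,D,E,F,H,G],R 0[A,B,C,D,E,F,K,J,L,G,H,I],R 0[A,B,C,D,E,F,M,N,U,G,H,I,J,K,L],R 0[D,E,F,A,B,C,H,
  G],R 0[D,E,F,A,B,C,K,J,L,G,H,I],R 0[D,E,F,A,B,C,M,N,U,G,H,I,J,K,L],R 0[G,H,I,J,K,L,M,N,U,A,B,C,D,E,F],R 0[J,
  K,L,G,H,I,M,N,U,A,B,C,D,E,F]],R 0[A,B,C,D,E,F,G,H,I,M,N,U,J,K,L],R 0[A,B,C,D,E,F,J,K,L,M,N,U,G,H,I]],R 0[A,
  B,C,G,H,I,D,E,F],R 0[A,B,C,J,K,L,D,E,F,G,H,I],R 0[A,B,C,M,N,U,D,E,F,G,H,I,J,K,L],R 0[D,E,F,G,H,I,A,B,C],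
  R 0[D,E,F,J,K,L,A,B,C,G,H,I],R 0[D,E,F,M,N,U,A,B,C,G,H,I,J,K,L],R 0[G,H,I,J,K,L,A,B,C,D,E,F],R 0[G,H,I,M,N,
  U,A,B,C,D,E,F,J,K,L],R 0[J,K,L,M,N,U,A,B,C,D,E,F,G,H,I]], Z[B,D,H,K][Z[A,F,H,K][X,X,X],Z[A,F,H,K][X,X,X],
  Z[B,D,I,K][Z[A,F,H,K][X,X,X],Z[A,F,H,K][X,X],X,Z[B,D,J,K][Z[A,F,H,K][X,X],X]],R 0[A,B,C,D,E,F,G,K,L,M,H,I,
  J],Z[B,D,I,K][Z[A,F,I,K][X,X],X,Z[B,E,I,K][X,Z[B,E,I,L][X]],R 3[A,B,C,D,E,F,G,K,L,M,H,I,J]]], X, X, Z[A,F,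
  J][X,X], X, Z[C,D,F,J][X,Z[C,E,F,J][X],Z[C,D,G,J][X]], X, X, X, X, X, Z[B,D,J][X,X], Z[A,H,K][Z[A,I,K][X,X],
  Z[A,H,L][X,X],Z[A,I,K][X,X]], X, Z[A,J][X], Z[A,F,I,L][Z[A,G,I,L][Z[B,D,F,I,L][X,X,X,X],Z[B,D,F,I,L][X,X,X,
  X],Z[A,G,J,L][Z[B,D,F,I,L][X,X,X,X],R 1[],X,Z[A,G,K,L][Z[A,H,I,M][X,X],X]],R 0[A,B,C,D,E,F,G,H,L,M,N,I,J,K],
  Z[A,G,J,L][R 5[A,B,C,D,E,F,G,H,J,I],X,Z[A,H,J,L][X,Z[A,H,J,M][X]],R 2[A,B,C,D,E,F,G,H,L,M,N,I,J,K]]],R 0[A,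
  B,C,D,E,I,J,K,F,G,H],R 0[A,B,C,D,E,L,M,N,F,G,H,I,J,K],Z[A,G,J,L][R 0[A,B,C,D,E,G,F],R 0[A,B,C,D,E,J,I,K,F,G,
  H],R 0[A,B,C,D,E,L,M,N,F,G,H,I,J,K],Z[A,H,I,L][R 0[A,B,C,D,E,H,F,G],Z[A,F,J,L][X,X],Z[A,G,I,M][X,X]],R 0[A,
  B,C,D,E,I,J,K,F,G,H]],R 0[A,B,C,D,E,F,G,H,L,M,N,I,J,K],R 0[A,B,C,D,E,I,J,K,L,M,N,F,G,H]], Z[B,D,F][X,X],
   Z[A,F][X], Z[A,F,K][Z[B,D,F,K][X,X,X],Z[A,F,L][X,X],Z[A,F,L][X,X]]]"

definition ext_cert6 :: "act list list" where "ext_cert6 =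
  [[Y,Y,S 0[A,D,E,B,C],S 1[F,G,H,I,J,A,B,C,D,E],S 0[F,G,H,I,J,A,B,C,D,E],S 0[F,I,J,G,H,A,B,C,D,E],S 1[K,L,M,N,
  U,A,B,C,D,E,F,G,H,I,J],S 0[K,L,M,N,U,A,B,C,D,E,F,G,H,I,J],S 0[K,N,U,L,M,A,B,C,D,E,F,G,H,I,J]], [], [Y,Y,
  S 0[F,G,H,I,J,A,B,C,D,E,M,N,K,L]], [Y,Y], [], [Y,Y,S 0[B,A,C,K,L,F,G,H,I,J,D,E],Y,Y,S 2[F,G,H,I,J,A,B,C,D,E,
  M,N,K,L],S 2[G,F,H,M,N,A,B,C,D,E,I,J,K,L],S 1[F,G,H,I,J,A,B,C,D,E,M,N,K,L],S 0[F,G,H,I,J,A,B,C,D,E,M,N,K,L],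
  S 0[B,A,C,K,L,F,G,H,I,J,D,E],S 0[G,F,H,M,N,A,B,C,D,E,I,J,K,L]], [Y,Y,S 0[B,A,C,K,L,F,G,H,I,J,D,E],Y], [Y,Y,
  Y,S 4[A,B,C,D,E,F,G,H,I,J,K,L,U,P,M,N]], [S 14[A,B,C,D,E,F,G,H,I,J,M,N,U,P,Q,K,L]], [], [], [Y,Y], [Y], [],
   [Y,Y,Y,Y,S 1[A,D,E,B,C,H,I,F,G],S 0[A,D,E,B,C,H,I,F,G],Y,S 0[A,D,E,B,C,H,I,F,G],Y,S 15[A,B,C,D,E,J,K,L,M,N,
  F,G,U,P,H,I],S 15[A,B,C,D,E,J,M,N,K,L,F,G,U,P,H,I]], [], [Y,Y,Y,Y,S 1[A,D,E,B,C,H,I,F,G],S 0[A,D,E,B,C,H,I,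
  F,G],Y,S 0[A,D,E,B,C,H,I,F,G],S 2[A,J,K,B,C,L,M,F,G,D,E,H,I],S 1[A,J,K,B,C,L,M,F,G,D,E,H,I],S 0[A,J,K,B,C,L,
  M,F,G,D,E,H,I]], [Y,Y], [Y], [Y,Y,Y,S 0[A,D,E,B,C,H,I,F,G,L,M,J,K]], [Y,Y], [Y,Y,Y,S 6[A,B,C,D,E,F,G,H,I,J,
  K,N,U,L,M]], [Y], [Y,Y,Y,S 0[A,C,B,D,E,J,K,H,I,F,G],S 0[A,D,E,B,C,H,I,F,G,L,M,J,K],S 0[A,E,D,B,C,L,M,F,G,H,
  I,J,K],Y,S 0[A,D,E,B,C,H,I,F,G,L,M,J,K],S 0[A,C,B,D,E,J,K,H,I,F,G],S 0[A,E,D,B,C,L,M,F,G,H,I,J,K]], [Y,Y,Y,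
  S 0[A,C,B,D,E,J,K,H,I,F,G],Y], [Y,Y,Y,Y,S 5[A,B,C,D,E,F,G,H,I,J,K,N,U,L,M]], [Y,Y,S 4[A,B,C,D,E,F,G,H,I,J,K,
  N,U,L,M],S 4[A,C,B,D,E,J,K,H,I,F,G,N,U,L,M],S 8[A,B,C,D,E,F,G,H,I,J,K,N,U,L,M],S 27[A,B,C,D,E,F,G,H,I,L,M,N,
  U,J,K]], [Y,S 34[A,B,C,D,E,F,G,H,I,L,M,N,U,P,J,K]], [Y,Y,S 0[B,A,C,F,G,D,E,J,K,H,I],Y,S 1[D,A,E,H,I,B,C,J,L,
  F,G,K],S 0[A,D,E,B,C,H,I,F,G,J,L,K],S 1[F,B,G,J,K,A,C,H,L,D,E,I],S 0[B,F,G,A,C,J,K,D,E,H,L,I],S 1[H,D,I,J,L,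
  A,E,F,K,B,C,G],S 0[D,H,I,A,E,J,L,B,C,F,K,G],S 1[J,F,K,H,L,B,G,D,I,A,C,E],S 0[F,J,K,B,G,H,L,A,C,D,I,E],S 0[H,
  J,L,D,I,F,K,A,E,B,G,C],Y,S 0[A,D,E,B,C,H,I,F,G,J,L,K],S 0[B,F,G,A,C,J,K,D,E,H,L,I]], [Y,Y,Y,Y,S 1[A,D,E,B,C,
  H,I,F,G,L,M,J,K],S 0[A,D,E,B,C,H,I,F,G,L,M,J,K],Y,Y,S 1[A,D,E,B,C,H,I,F,G,L,M,J,K],S 0[A,D,E,B,C,H,I,F,G,L,
  M,J,K],Y,S 0[A,D,E,B,C,H,I,F,G,L,M,J,K],Y], [Y,Y,Y,S 26[A,B,C,D,E,F,G,H,I,N,U,L,M,J,K],Y,S 0[A,B,C,E,D,F,G,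
  L,M,J,K,H,I],Y,Y,S 10[A,D,E,B,C,H,I,F,G,N,U,J,K,L,M],S 8[B,A,C,F,G,D,E,J,K,H,I,N,U,L,M],S 10[A,E,D,B,C,L,M,
  F,G,N,U,J,K,H,I]], [Y,Y,Y,Y,Y], [Y,Y,S 0[B,A,C,F,G,D,E,J,K,H,I],Y,Y,S 38[A,B,C,D,E,F,G,H,I,L,M,N,U,J,K],
  S 0[B,A,C,F,G,D,E,J,K,H,I],S 38[B,A,C,F,G,D,E,J,K,L,M,N,U,H,I],S 19[A,B,C,D,E,F,G,H,I,J,K,N,U,L,M],S 19[B,A,
  C,F,G,D,E,J,K,H,I,N,U,L,M],Y], [Y,Y,Y,S 11[A,B,C,D,E,F,G,H,I,J,K,N,U,L,M],S 10[B,A,C,F,G,D,E,J,K,H,I,N,U,L,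
  M],S 58[A,B,C,D,E,F,G,H,I,L,M,N,U,J,K]], [Y,S 65[A,B,C,D,E,F,G,H,I,L,M,N,U,P,J,K]], [Y,Y,S 0[B,A,C,F,G,D,E,
  H,J,I],Y,Y,Y,S 1[B,A,C,F,G,D,E,H,J,I],S 0[B,A,C,F,G,D,E,H,J,I],Y,Y,S 0[B,A,C,F,G,D,E,H,J,I],Y,Y,S 37[B,C,A,
  F,G,K,L,H,J,I,M,D,E],S 37[A,C,B,D,E,K,L,H,I,J,M,F,G]], [Y,Y,Y,S 0[A,D,E,B,C,H,I,F,G],Y,S 0[A,D,E,B,C,H,I,F,
  G],Y], [Y,Y], [Y,Y,S 0[B,A,C,F,G,D,E],S 0[C,A,B,H,I,D,E,F,G],S 84[A,B,C,D,E,F,G,U,P,J,K,L,M,N,H,I],S 84[B,A,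
  C,F,G,D,E,U,P,J,K,L,M,N,H,I],S 84[C,A,B,H,I,D,E,U,P,J,K,L,M,N,F,G],Y,S 99[A,B,C,D,E,J,K,L,M,N,F,G,U,P,H,I],
  S 99[A,B,C,D,E,J,M,N,K,L,F,G,U,P,H,I]], [], [Y,Y,S 0[B,A,C,F,G,D,E,H,I,L,M,J,K],Y], [Y,Y], [Y], [], [Y,Y],
   [Y], [Y,Y,Y], [Y], []]"

definition kill_cert6 :: "cert list" where "kill_cert6 =
  [Z[A,F,K][Z[B,D,F,K][X,X,X],Z[B,D,F,K][X,X,X],Z[A,G,I,K][X,X,X]], Z[A,F,K,N][Z[B,D,F,K,N][Z[C,D,F,K,N][Z[A,
  G,I,K,N][Z[A,H,I,K,N][Z[B,D,F,L,N][Z[B,E,F,L,N][X],Z[B,D,F,M,N][X]],X],R 0[A,C,B,D,E,F,G,H,I,J,N,U,P,K,L,M],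
  R 0[A,B,C,D,E,F,I,J,G,H],R 0[A,C,B,D,E,F,I,J,G,H,N,U,P,K,L,M]],Z[C,E,F,K,N][Z[B,E,F,L,N][Z[B,D,F,L,U][X],
  Z[B,D,F,M,U][X]]],Z[A,G,I,K,N][X,X,X],Z[C,D,F,K,U][Z[B,D,F,L,U][X,Z[B,D,F,M,U][X]],X,Z[A,G,I,L,N][X,X]]],
  R 0[A,B,C,D,E,F,G,H,I,J,N,U,P,K,L,M],R 0[A,D,E,B,C],R 0[A,D,E,B,C,F,G,H,I,J,N,U,P,K,L,M],Z[A,G,I,K,N][X,X,X,
  X],Z[A,G,I,K,N][X,X,X,X],Z[B,D,F,L,N][R 2[A,B,C,D,E,F,G,H,I,J,L,K],R 2[A,B,C,D,E,F,G,H,I,J,N,U,P,K,L,M],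
  R 2[A,D,E,B,C,F,G,H,I,J,L,K],R 2[A,D,E,B,C,F,G,H,I,J,N,U,P,K,L,M],Z[A,G,I,L,N][X,X,X],X]],Z[A,F,L,N][Z[B,D,
  F,K,N][X,X,X,X],Z[B,D,F,K,N][X,X,X,X],Z[A,F,M,N][R 0[],R 0[F,G,H,I,J,A,B,C,D,E,L,K],Z[A,F,M,U][Z[B,D,F,K,
  N][X,X],Z[A,G,I,L,N][X,X]]],Z[A,F,L,U][X,R 4[A,B,C,D,E,F,G,H,I,J,K,L,M,U,N],R 0[],Z[A,F,M,U][X,Z[A,G,I,M,
  U][X,X]]],Z[A,F,M,N][Z[B,D,F,K,N][X,X,X],R 4[A,B,C,D,E,F,G,H,I,J,K,M,L],Z[A,F,L,U][X,X]]],R 0[A,B,C,D,E,F,G,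
  H,I,J,N,U,P,K,L,M],R 0[F,G,H,I,J,A,B,C,D,E],R 0[F,G,H,I,J,A,B,C,D,E,N,U,P,K,L,M],Z[A,F,L,N][R 13[],R 0[A,B,
  C,D,E,F,G,H,I,J,L,K],Z[A,F,K,U][X,X,X],R 1[F,G,H,I,J,A,B,C,D,E,L,K],Z[A,F,K,U][X,X,X]]], Z[A,F][X], Z[A,
  F][X], Z[A,F,M][Z[A,G,I,M][X,X,X],Z[A,F,N][X,X],Z[A,F,N][X,X]], Z[B,D,G,I][X,Z[A,G,I,K][X,X],R 0[F,G,H,I,J,
  A,B,C,D,E,M,N,K,L],Z[B,E,G,I][X,Z[A,G,I,K][X,X]]], Z[B,D,F][X,X], Z[A,F,K][X,X], Z[B,D,F,M][Z[A,F,K,M][X,X,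
  X],Z[A,F,K,M][X,X,X],Z[B,E,F,M][Z[A,F,K,M][X,X],Z[B,E,F,N][Z[A,F,K,M][X],Z[A,F,K,M][X,X]],Z[B,D,G,I,M][X,X,
  X]],Z[B,E,F,M][Z[A,F,K,M][X,X],R 1[A,B,C,E,D],Z[B,D,F,N][X,X]],Z[B,D,F,N][X,Z[A,F,K,N][X,X],R 4[],Z[B,E,F,
  N][X,Z[A,F,K,N][X,X]]]], Z[A,F,I,L,U][Z[A,G,I,L,U][Z[B,D,F,I,L,U][Z[C,D,F,I,L,U][Z[B,D,F,I,M,U][Z[B,E,F,I,M,
  U][Z[B,D,F,I,N,U][Z[B,D,G,I,N,U][X],Z[B,D,F,J,N,U][X]]],Z[B,D,G,I,M,U][X,Z[B,D,F,I,N,U][X,Z[B,D,F,J,N,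
  U][X]]],R 0[A,B,C,D,E,I,J,K,F,G,H],Z[B,D,F,I,N,U][X,Z[B,D,G,I,N,U][X],Z[B,D,F,J,N,U][X]]],Z[C,E,F,I,L,
  U][Z[B,E,F,I,M,U][R 0[A,E,D,B,C,F,G,H,I,J,K,M,L],Z[B,E,G,I,M,U][X],Z[B,E,F,J,M,U][X]]],Z[C,D,G,I,L,U][X,Z[C,
  D,F,I,L,P][Z[B,D,F,I,M,P][X,Z[B,D,F,J,M,P][X]],X,Z[C,D,F,J,L,P][X]]],R 0[A,B,C,D,E,I,J,K,F,G,H],Z[C,D,F,I,L,
  P][R 9[A,B,C,D,E,F,G,H,I,J,K,L,M,N,P,U],X,Z[C,D,G,I,L,P][X],Z[C,D,F,J,L,P][X]]],R 0[A,B,C,D,E,F,G,H,I,J,K,U,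
  P,Q,L,M,N],R 0[A,D,E,B,C],R 0[A,D,E,B,C,F,G,H,I,J,K,U,P,Q,L,M,N],Z[B,D,G,I,L,U][R 0[A,B,C,D,E,F,G,H,I,J,K,U,
  P,Q,L,M,N],R 0[A,D,E,B,C,F,G,H,I,J,K,U,P,Q,L,M,N],Z[B,D,H,I,L,U][X,X,Z[A,H,J,L,U][Z[A,G,J,L,P][X],Z[A,H,J,M,
  U][X]]],Z[A,G,J,L,U][Z[A,H,J,L,U][Z[A,H,J,L,P][X],Z[A,H,J,M,U][X]],R 3[],R 3[A,B,C,D,E,I,J,K,F,G,H,U,P,Q,L,
  M,N],Z[A,G,J,M,U][Z[A,H,J,M,U][X],Z[A,G,K,M,U][X]]],Z[B,D,G,I,L,P][Z[C,D,G,I,L,P][X],Z[B,E,G,I,L,P][X],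
  R 9[A,B,C,D,E,F,G,H,I,J,K,L,M,N,P,U],R 2[A,B,C,D,E,F,G,H,I,J,K,L,M,N,P,U]]],R 0[A,B,C,D,E,F,G,H,I,J,K,U,P,Q,
  L,M,N],R 0[A,B,C,D,E,I,J,K,F,G,H],R 0[A,B,C,D,E,I,J,K,F,G,H,U,P,Q,L,M,N],Z[B,D,F,I,M,U][R 15[A,B,C,D,E,F,G,
  H,I,J,K,M,L],R 15[A,B,C,D,E,F,G,H,I,J,K,U,P,Q,L,M,N],R 15[A,D,E,B,C,F,G,H,I,J,K,M,L],R 15[A,D,E,B,C,F,G,H,I,
  J,K,U,P,Q,L,M,N],R 0[A,B,C,D,E,F,G,H,I,J,K,M,L],R 0[A,B,C,D,E,F,G,H,I,J,K,U,P,Q,L,M,N],R 0[A,B,C,D,E,I,J,K,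
  F,G,H,M,L],R 0[A,B,C,D,E,I,J,K,F,G,H,U,P,Q,L,M,N]]],R 0[A,B,C,D,E,F,G,H,L,M,N,I,J,K],R 0[A,B,C,D,E,F,G,H,U,
  P,Q,I,J,K,L,M,N],Z[A,G,J,L,U][R 0[A,B,C,D,E,F,G,H,J,I],R 0[A,B,C,D,E,F,G,H,L,M,N,I,J,K],R 0[A,B,C,D,E,F,G,H,
  U,P,Q,I,J,K,L,M,N],Z[A,H,I,L,U][R 0[A,B,C,D,E,F,G,H,U,P,Q,I,J,K,L,M,N],Z[A,H,I,L,P][R 0[A,B,C,D,E,F,G,H,P,U,
  Q,I,J,K,L,M,N],Z[A,H,J,L,P][X,Z[A,H,I,M,Q][X,X]],R 0[A,B,C,D,E,F,G,H,L,M,N,I,J,K]],Z[A,H,J,L,U][X,R 3[A,B,C,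
  D,E,F,G,H,U,P,Q,I,J,K,L,M,N]],R 0[A,B,C,D,E,F,G,H,L,M,N,I,J,K]],R 0[A,B,C,D,E,F,G,H,I,J,K,U,P,Q,L,M,N],Z[A,
  G,K,L,U][R 5[A,B,C,D,E,F,G,H,K,I,J],R 5[A,B,C,D,E,F,G,H,L,M,N,I,J,K],R 5[A,B,C,D,E,F,G,H,U,P,Q,I,J,K,L,M,N],
  R 0[A,B,C,D,E,F,G,H,I,J,K,U,P,Q,L,M,N],Z[A,H,I,L,U][R 5[A,B,C,D,E,F,G,H,L,M,N,I,J,K],R 5[A,B,C,D,E,F,G,H,U,
  P,Q,I,J,K,L,M,N],Z[A,H,I,M,U][R 0[A,B,C,D,E,M,L,N,H,F,G,J,I,K],R 5[A,B,C,D,E,F,G,H,U,P,Q,I,J,K,L,M,N],Z[A,G,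
  J,M,U][Z[A,G,K,L,P][X],X],Z[A,H,I,N,U][Z[A,H,I,M,P][Z[A,G,K,L,Q][X],X],X]],R 0[A,B,C,D,E,F,G,H,I,K,J,U,P,Q,
  L,M,N]],Z[A,G,K,L,P][R 12[A,B,C,D,E,F,G,H,K,I,J],X,R 12[A,B,C,D,E,F,G,H,P,U,Q,I,J,K,L,M,N],Z[A,H,I,L,P][X,
  Z[A,H,I,M,P][X]],R 2[A,B,C,D,E,F,G,H,I,J,K,L,M,N,P,U]]],R 0[A,B,C,D,E,F,G,H,I,J,K,U,P,Q,L,M,N],Z[A,G,J,M,
  U][R 16[A,B,C,D,E,F,G,H,J,I],R 16[A,B,C,D,E,F,G,H,M,L,N,I,J,K],R 16[A,B,C,D,E,F,G,H,U,P,Q,I,J,K,L,M,N],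
  R 11[A,B,C,D,E,F,G,H,I,J,K,M,L],R 11[A,B,C,D,E,F,G,H,I,J,K,U,P,Q,L,M,N],R 0[A,B,C,D,E,F,G,H,I,J,K,M,L],
  R 0[A,B,C,D,E,F,G,H,I,J,K,U,P,Q,L,M,N]]],R 0[A,B,C,D,E,F,G,H,L,M,N,I,J,K],R 0[A,B,C,D,E,F,G,H,U,P,Q,I,J,K,L,
  M,N],Z[A,G,J,M,U][R 18[A,B,C,D,E,F,G,H,J,I],R 0[A,B,C,D,E,M,L,N,I,J,K,F,G,H],R 18[A,B,C,D,E,F,G,H,U,P,Q,I,J,
  K,L,M,N],R 0[A,B,C,D,E,F,G,H,J,I],R 0[A,B,C,D,E,F,G,H,M,L,N,I,J,K],R 0[A,B,C,D,E,F,G,H,U,P,Q,I,J,K,L,M,N],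
  Z[A,G,K,L,U][R 18[A,B,C,D,E,F,G,H,K,I,J],R 18[A,B,C,D,E,F,G,H,L,M,N,I,J,K],R 18[A,B,C,D,E,F,G,H,U,P,Q,I,J,K,
  L,M,N],R 0[A,B,C,D,E,F,G,H,K,I,J],R 0[A,B,C,D,E,F,G,H,L,M,N,I,J,K],R 0[A,B,C,D,E,F,G,H,U,P,Q,I,J,K,L,M,N]],
  R 0[A,B,C,D,E,F,G,H,L,M,N,I,J,K]],R 0[A,B,C,D,E,F,G,H,I,J,K,U,P,Q,L,M,N],R 0[A,B,C,D,E,F,G,H,L,M,N,U,P,Q,I,
  J,K]],R 0[A,B,C,D,E,I,J,K,F,G,H],R 0[A,B,C,D,E,L,M,N,F,G,H,I,J,K],R 0[A,B,C,D,E,U,P,Q,F,G,H,I,J,K,L,M,N],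
  Z[A,G,J,L,U][R 0[A,B,C,D,E,G,F],R 0[A,B,C,D,E,J,I,K,F,G,H],R 0[A,B,C,D,E,L,M,N,F,G,H,I,J,K],R 0[A,B,C,D,E,U,
  P,Q,F,G,H,I,J,K,L,M,N],Z[A,H,I,L,U][R 0[A,B,C,D,E,H,F,G],R 0[A,B,C,D,E,I,J,K,F,G,H],R 0[A,B,C,D,E,L,M,N,F,G,
  H,I,J,K],R 0[A,B,C,D,E,U,P,Q,F,G,H,I,J,K,L,M,N],Z[A,F,J,L,U][R 0[],R 0[A,B,C,D,E,J,I,K,F,G,H],R 0[A,B,C,D,E,
  L,M,N,F,G,H,I,J,K],R 0[A,B,C,D,E,U,P,Q,F,G,H,I,J,K,L,M,N],Z[A,G,I,M,U][R 0[A,B,C,D,E,G,F],R 0[A,B,C,D,E,I,J,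
  K,F,G,H],R 0[A,B,C,D,E,M,L,N,F,G,H,I,J,K],R 0[A,B,C,D,E,U,P,Q,F,G,H,I,J,K,L,M,N],Z[A,G,I,N,U][X,R 0[A,B,C,D,
  E,I,J,K,F,G,H],R 0[A,B,C,D,E,N,L,M,F,G,H,I,J,K],Z[A,H,I,L,P][X,X]]],R 0[A,B,C,D,E,F,H,G,I,J,K,U,P,Q,L,M,N]],
  Z[A,H,I,L,P][R 4[A,B,C,D,E,H,F,G],Z[A,F,J,L,U][X,X,X],R 5[A,B,C,D,E,L,M,N,F,G,H,I,J,K],R 5[A,B,C,D,E,P,U,Q,
  F,G,H,I,J,K,L,M,N],R 1[A,B,C,D,E,F,G,H,I,J,K,L,M,N,P,U],Z[A,H,I,L,Q][R 5[A,B,C,D,E,H,F,G],Z[A,F,J,L,U][X,X],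
  Z[A,F,J,M,U][X,X],R 7[A,B,C,D,E,Q,U,P,F,G,H,I,J,K,L,M,N],R 3[A,B,C,D,E,F,G,H,I,J,K,L,M,N,Q,U,P]]],R 0[A,B,C,
  D,E,G,F,H,L,M,N,I,J,K]],R 0[A,B,C,D,E,F,G,H,I,J,K,U,P,Q,L,M,N],R 0[A,B,C,D,E,I,J,K,F,G,H],R 0[A,B,C,D,E,I,J,
  K,F,G,H,U,P,Q,L,M,N],Z[A,G,J,M,U][R 10[A,B,C,D,E,G,F],R 10[A,B,C,D,E,J,I,K,F,G,H],R 10[A,B,C,D,E,M,L,N,F,G,
  H,I,J,K],R 10[A,B,C,D,E,U,P,Q,F,G,H,I,J,K,L,M,N],R 0[A,B,C,D,E,F,G,H,I,J,K,M,L],R 0[A,B,C,D,E,F,G,H,I,J,K,U,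
  P,Q,L,M,N],R 0[A,B,C,D,E,I,J,K,F,G,H,M,L],R 0[A,B,C,D,E,I,J,K,F,G,H,U,P,Q,L,M,N]]],R 0[A,B,C,D,E,F,G,H,L,M,
  N,I,J,K],R 0[A,B,C,D,E,F,G,H,U,P,Q,I,J,K,L,M,N],R 0[A,B,C,D,E,I,J,K,L,M,N,F,G,H],R 0[A,B,C,D,E,I,J,K,U,P,Q,
  F,G,H,L,M,N],R 0[A,B,C,D,E,L,M,N,U,P,Q,F,G,H,I,J,K]], Z[A,J,M][Z[A,K,M][X,X],Z[A,J,N][X,X],Z[A,K,M][X,X]],
   X, Z[A,L][X], Z[A,H,K,N][Z[A,I,K,N][Z[B,D,F,H,K,N][X,X,X,X,X],R 0[A,B,C,D,E,F,G,H,I,J,N,U,P,K,L,M],Z[A,I,L,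
  N][Z[A,J,K,N][X,Z[A,J,K,U][X,X],X],R 2[A,B,C,D,E,F,G,H,I,J,N,U,P,K,L,M],X,Z[A,I,M,N][Z[A,J,K,U][X,X],X]],
  R 0[A,B,C,D,E,F,G,H,I,J,N,U,P,K,L,M],Z[A,I,L,N][R 5[A,B,C,D,E,F,G,H,I,J,L,K],X,Z[A,J,L,N][X,Z[A,J,L,U][X]],
  R 2[A,B,C,D,E,F,G,H,I,J,N,U,P,K,L,M]]],R 0[A,B,C,D,E,F,G,K,L,M,H,I,J],R 0[A,B,C,D,E,F,G,N,U,P,H,I,J,K,L,M],
  Z[A,I,L,N][R 0[A,B,C,D,E,F,G,I,H],R 0[A,B,C,D,E,F,G,L,K,M,H,I,J],R 0[A,B,C,D,E,F,G,N,U,P,H,I,J,K,L,M],Z[A,J,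
  K,N][R 0[A,B,C,D,E,F,G,J,H,I],Z[A,H,L,N][X,X],Z[A,I,K,U][X,X]],R 0[A,B,C,D,E,F,G,K,L,M,H,I,J]],R 0[A,B,C,D,
  E,F,G,H,I,J,N,U,P,K,L,M],R 0[A,B,C,D,E,F,G,K,L,M,N,U,P,H,I,J]], Z[B,D,J][X,X], Z[B,D,J,M][Z[B,D,K,M][X,Z[B,
  D,L,M][X,X,Z[B,D,L,N][X,X]],Z[B,D,K,N][X,X,Z[B,D,L,N][X]],Z[B,D,K,N][X,X,Z[B,D,L,M][X]]],R 0[A,B,C,D,E,F,G,
  H,I,M,N,U,J,K,L],R 0[A,D,E,B,C,H,I,F,G],R 0[A,D,E,B,C,H,I,F,G,M,N,U,J,K,L],Z[B,D,K,M][R 0[A,B,C,D,E,F,G,H,I,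
  K,J],Z[B,D,J,N][X,X],R 1[A,D,E,B,C,H,I,F,G,K,J],Z[B,D,J,N][X,X]]], X, X, Z[B,D,J,L][X,X,X], X, X, X, Z[B,D,
  L][X,X], Z[C,E,F,H][X], X, X, X, Z[C,D,F,L][X,Z[C,D,F,M][X,X],Z[C,D,F,M][X,X]], X, Z[A,F,H][X], Z[C,E,F,
  H][X], X, X, X, Z[C,D,F,L][Z[C,D,F,M][Z[A,F,H,L][X],Z[B,D,J,L][X]],Z[A,F,H,L][X,X],Z[B,D,J,L][X,X]], X, X,
   Z[C,D,F,K][Z[B,E,H,K][X],X,X], Z[C,D,F,J][X,Z[C,E,F,J][X],Z[C,D,G,J][X]], Z[C,D,F,J,M][Z[B,D,H,J,M][X,Z[B,
  E,H,J,M][X,Z[B,E,H,K,M][X]],Z[B,D,I,J,M][X],Z[B,D,H,K,M][X,Z[B,E,H,K,M][X]]],R 0[A,B,C,D,E,F,G,H,I,M,N,U,J,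
  K,L],Z[A,F,H,J,M][Z[C,E,F,J,M][X],Z[C,D,F,K,M][R 1[A,B,C,D,E,F,G,H,I,K,J],Z[B,E,H,J,M][X,X],Z[C,E,F,K,M][X],
  Z[C,D,G,K,M][X],Z[C,D,F,L,M][R 4[A,B,C,D,E,F,G,H,I,L,J,K],Z[B,E,H,J,M][X]]],Z[C,E,G,J,M][R 0[A,B,C,E,D,F,G,
  H,I,M,N,U,J,K,L],R 0[A,B,C,D,E,G,F],Z[C,D,F,K,N][Z[B,D,H,K,M][X],Z[B,E,H,J,N][X]]],R 4[A,C,B,D,E,H,I,F,G],
  R 0[A,C,B,D,E,H,I,F,G],Z[C,D,F,K,M][Z[B,D,H,K,M][X,X],Z[B,E,H,J,N][X],Z[B,D,H,K,M][X,X,Z[C,D,G,K,M][X]],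
  R 4[]]],R 0[A,B,C,D,E,F,G,H,I,M,N,U,J,K,L],R 0[B,A,C,F,G,D,E],R 0[B,A,C,F,G,D,E,H,I,M,N,U,J,K,L],Z[C,D,F,K,
  M][R 17[A,B,C,D,E,F,G,H,I,K,J],Z[B,D,H,J,N][Z[B,E,H,J,N][X],X],R 2[A,B,C,D,E,F,G,H,I,K,J],R 2[A,B,C,D,E,F,G,
  H,I,M,N,U,J,K,L],R 2[B,A,C,F,G,D,E,H,I,K,J],R 2[B,A,C,F,G,D,E,H,I,M,N,U,J,K,L]]], X, X, Z[A,F,H,L][X,Z[A,G,
  H,L][X],Z[A,F,I,L][X]], Z[A,F,J,M][Z[B,D,H,J,M][X,X,X,X],Z[B,D,H,J,M][X,X,X,X],Z[A,F,K,M][Z[B,D,H,J,M][X,X,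
  X,X],R 1[],X,Z[A,F,L,M][Z[A,G,J,N][X,X],X]],R 0[A,B,C,D,E,F,G,H,I,M,N,U,J,K,L],Z[A,F,K,M][R 5[A,B,C,D,E,F,G,
  H,I,K,J],X,Z[A,G,K,M][X,Z[A,G,K,N][X]],R 2[A,B,C,D,E,F,G,H,I,M,N,U,J,K,L]]], X, Z[A,F,L][X,X], X, Z[B,D,H,
  L][X,X,X], Z[B,D,H,K,N][Z[A,F,H,K,N][Z[C,D,F,H,K,N][Z[B,D,I,K,N][Z[B,E,I,K,N][Z[B,D,J,L,N][X,X]],Z[A,F,H,L,
  N][Z[A,G,H,L,N][X],X],Z[B,D,J,K,N][X,Z[B,D,J,L,N][X]]],Z[C,E,F,H,K,N][X,Z[B,E,I,K,N][Z[B,D,I,K,U][X],Z[B,E,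
  I,L,N][X]]],R 0[B,A,C,F,G,D,E,K,L,M,H,I,J],Z[A,F,I,L,N][Z[A,G,I,L,N][X,Z[A,F,I,M,N][X]],Z[A,F,J,L,N][X],Z[A,
  F,I,M,N][Z[A,G,I,M,N][X],Z[A,F,J,M,N][X]]],R 0[B,A,C,F,G,D,E,K,L,M,H,I,J]],R 0[A,B,C,D,E,F,G,H,I,J,N,U,P,K,
  L,M],Z[A,G,H,K,N][R 0[A,B,C,D,E,F,G,H,I,J,N,U,P,K,L,M],Z[A,F,H,L,N][R 0[A,B,C,D,E,F,G,H,I,J,L,K],Z[A,F,I,L,
  N][X,Z[A,G,H,K,U][X]],Z[A,F,H,M,N][Z[C,D,F,H,M,N][X],Z[A,F,I,M,N][X]]],Z[A,G,I,K,N][X,Z[A,G,H,K,U][Z[A,F,H,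
  L,P][X],Z[A,F,H,L,U][X]]],Z[A,G,H,K,U][Z[C,D,G,H,K,U][X],R 5[A,B,C,D,E,F,G,H,I,J,K,L,M,U,N],Z[A,G,I,K,
  U][X]]],R 0[A,B,C,D,E,F,G,H,I,J,N,U,P,K,L,M],Z[A,F,I,K,N][R 14[A,B,C,D,E,F,G,H,I,J,N,U,P,K,L,M],R 0[A,B,C,D,
  E,F,G,H,I,J,N,U,P,K,L,M],Z[A,F,J,K,N][R 14[A,B,C,D,E,F,G,H,I,J,N,U,P,K,L,M],X],Z[A,F,I,K,U][R 15[A,B,C,D,E,
  F,G,H,I,J,U,N,P,K,L,M],Z[A,G,I,K,U][X],Z[A,F,J,K,U][Z[B,D,I,L,N][X],X]]],R 0[A,B,C,D,E,F,G,H,I,J,N,U,P,K,L,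
  M],Z[A,F,H,L,N][R 20[A,B,C,D,E,F,G,H,I,J,L,K],R 0[B,A,C,F,G,D,E,N,U,P,K,L,M,H,I,J],R 6[A,B,C,D,E,F,G,H,I,J,
  L,K],R 6[A,B,C,D,E,F,G,H,I,J,N,U,P,K,L,M],R 0[A,B,C,D,E,F,G,H,I,J,L,K],R 0[A,B,C,D,E,F,G,H,I,J,N,U,P,K,L,
  M]]],R 0[A,B,C,D,E,F,G,K,L,M,H,I,J],R 0[A,B,C,D,E,F,G,N,U,P,H,I,J,K,L,M],Z[B,D,I,K,N][R 0[A,B,C,D,E,F,G,I,
  H],R 0[A,B,C,D,E,F,G,K,L,M,H,I,J],R 0[A,B,C,D,E,F,G,N,U,P,H,I,J,K,L,M],Z[B,E,H,K,N][R 0[A,B,C,D,E,F,G,N,U,P,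
  H,I,J,K,L,M],Z[B,E,H,K,U][R 0[A,B,C,D,E,F,G,U,N,P,H,I,J,K,L,M],Z[B,E,I,K,U][X,Z[A,F,H,K,N][X]],Z[B,E,H,L,
  U][X,Z[A,F,H,K,N][X]]],Z[B,E,I,K,N][X,R 5[A,B,C,D,E,F,G,N,U,P,H,I,J,K,L,M]],R 0[A,B,C,D,E,F,G,K,L,M,H,I,J]],
  R 0[A,B,C,D,E,F,G,H,I,J,N,U,P,K,L,M],Z[B,D,J,K,N][R 7[A,B,C,D,E,F,G,J,H,I],R 7[A,B,C,D,E,F,G,K,L,M,H,I,J],
  R 7[A,B,C,D,E,F,G,N,U,P,H,I,J,K,L,M],R 0[A,B,C,D,E,F,G,H,I,J,N,U,P,K,L,M],Z[B,E,H,K,N][R 7[A,B,C,D,E,F,G,K,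
  L,M,H,I,J],R 7[A,B,C,D,E,F,G,N,U,P,H,I,J,K,L,M],Z[B,E,H,L,N][R 7[A,B,C,D,E,F,G,L,K,M,H,I,J],R 7[A,B,C,D,E,F,
  G,N,U,P,H,I,J,K,L,M],Z[B,D,I,L,N][Z[A,F,H,K,N][X],X],Z[B,E,H,M,N][Z[B,E,H,L,U][Z[A,F,H,K,N][X],X],X]],R 0[A,
  B,C,D,E,F,G,H,J,I,N,U,P,K,L,M]],Z[B,D,J,K,U][R 14[A,B,C,D,E,F,G,J,H,I],X,R 14[A,B,C,D,E,F,G,U,N,P,H,I,J,K,L,
  M],Z[B,E,H,K,U][X,Z[B,E,H,L,U][X]],R 2[A,B,C,D,E,F,G,H,I,J,K,L,M,U,N]]],R 0[A,B,C,D,E,F,G,H,I,J,N,U,P,K,L,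
  M],Z[B,D,I,L,N][R 18[A,B,C,D,E,F,G,I,H],R 18[A,B,C,D,E,F,G,L,K,M,H,I,J],R 18[A,B,C,D,E,F,G,N,U,P,H,I,J,K,L,
  M],R 11[A,B,C,D,E,F,G,H,I,J,L,K],R 11[A,B,C,D,E,F,G,H,I,J,N,U,P,K,L,M],R 0[A,B,C,D,E,F,G,H,I,J,L,K],R 0[A,B,
  C,D,E,F,G,H,I,J,N,U,P,K,L,M]]],R 0[A,B,C,D,E,F,G,K,L,M,H,I,J],R 0[A,B,C,D,E,F,G,N,U,P,H,I,J,K,L,M],Z[B,D,I,
  L,N][R 20[A,B,C,D,E,F,G,I,H],R 20[A,B,C,D,E,F,G,L,K,M,H,I,J],R 20[A,B,C,D,E,F,G,N,U,P,H,I,J,K,L,M],R 0[A,B,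
  C,D,E,F,G,I,H],R 0[A,B,C,D,E,F,G,L,K,M,H,I,J],R 0[A,B,C,D,E,F,G,N,U,P,H,I,J,K,L,M],Z[B,D,J,K,N][R 20[A,B,C,
  D,E,F,G,J,H,I],R 20[A,B,C,D,E,F,G,K,L,M,H,I,J],R 20[A,B,C,D,E,F,G,N,U,P,H,I,J,K,L,M],R 0[A,B,C,D,E,F,G,J,H,
  I],R 0[A,B,C,D,E,F,G,K,L,M,H,I,J],R 0[A,B,C,D,E,F,G,N,U,P,H,I,J,K,L,M]],R 0[A,B,C,D,E,F,G,K,L,M,H,I,J]],
  R 0[A,B,C,D,E,F,G,H,I,J,N,U,P,K,L,M],R 0[A,B,C,D,E,F,G,K,L,M,N,U,P,H,I,J]]]"

definition ext_cert7 :: "act list list" where "ext_cert7 =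
  [[], [Y,S 0[B,A,C,F,G,D,E,J,K,H,I,N,U,L,M]], [Y], [], [], [Y], [], [], [Y], [], [Y,S 0[B,A,C,F,G,D,E,H,I,L,
  M,J,K],S 0[C,A,B,H,I,D,E,F,G,N,U,J,K,L,M]], [Y,Y], [], [], [], [], [Y,S 0[B,A,C,F,G,D,E,H,J,I],Y,S 1[D,A,E,
  H,I,B,C,F,J,G],S 0[A,D,E,B,C,H,I,F,G],S 1[F,B,G,H,J,A,C,D,I,E],S 0[B,F,G,A,C,H,J,D,E,I],S 1[H,D,I,F,J,A,E,B,
  G,C],S 0[D,H,I,A,E,F,J,B,C,G],S 0[F,H,J,B,G,D,I,A,C,E],Y,Y,S 0[A,B,C,D,E,F,G,H,I,J,K,N,U,L,M]], [], [Y,Y,Y,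
  Y,S 1[A,D,E,B,C,H,I,F,G],S 0[A,D,E,B,C,H,I,F,G],Y,Y,S 1[A,D,E,B,C,H,I,F,G],S 0[A,D,E,B,C,H,I,F,G],Y,Y,Y,Y,Y,
  S 0[A,D,E,B,C,H,I,F,G]], [Y,Y,Y,Y,S 2[F,B,G,H,J,A,C,D,I,E,M,N,K,L],S 0[F,B,G,H,J,A,C,D,I,E,M,N,K,L]], [Y,Y,
  S 0[B,A,C,F,G,D,E,H,J,I,M,N,K,L],S 3[B,A,C,F,G,D,E,H,J,I,M,N,U,P,K,L],S 3[A,B,C,D,E,F,G,H,I,J,K,L,U,P,M,N],
  S 2[A,D,E,B,C,H,I,F,G,J,K,L,U,P,M,N]], [Y,Y], [], [Y,Y,S 0[B,A,C,F,G,D,E,H,J,I],S 0[C,A,B,K,L,D,E,H,M,I,F,G,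
  J],Y,Y,S 1[B,A,C,F,G,D,E,H,J,I],S 0[B,A,C,F,G,D,E,H,J,I],Y,Y,S 0[B,A,C,F,G,D,E,H,J,I],S 3[C,A,B,K,L,D,E,H,M,
  I,F,G,J],S 2[C,A,B,K,L,D,E,H,M,I,F,G,J],S 0[C,A,B,K,L,D,E,H,M,I,F,G,J]], [Y,Y,S 0[B,A,C,F,G,D,E,H,J,I],Y,Y,
  Y,S 1[B,A,C,F,G,D,E,H,J,I],S 0[B,A,C,F,G,D,E,H,J,I],Y,Y,S 0[B,A,C,F,G,D,E,H,J,I],Y,Y,Y,Y,Y,S 1[B,A,C,F,G,D,
  E,H,J,I],S 0[B,A,C,F,G,D,E,H,J,I],Y,Y,S 0[B,A,C,F,G,D,E,H,J,I]], [Y,Y,Y,Y,S 2[D,H,I,A,E,F,J,B,C,G,M,N,K,L],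
  Y,Y,Y,S 4[D,H,I,A,E,F,J,B,C,G,M,N,K,L],S 3[D,H,I,A,E,F,J,B,C,G,M,N,K,L],S 0[D,H,I,A,E,F,J,B,C,G,M,N,K,L],
  S 14[A,B,C,D,E,F,G,H,I,J,K,L,U,P,M,N],S 14[D,H,I,A,E,F,J,B,C,G,M,N,U,P,K,L],S 7[A,B,C,D,E,F,G,H,I,J,K,L,M,U,
  N]], [Y,Y,S 0[B,A,C,F,G,D,E,H,J,I],Y,Y,S 0[B,A,C,F,G,D,E,H,J,I],Y,S 44[H,D,I,F,J,A,E,B,G,C,M,N,U,P,K,L]],
   [Y,Y,Y,Y,S 1[A,D,E,B,C,H,I,F,G,J,M,N,K,L],S 0[A,D,E,B,C,H,I,F,G,J,M,N,K,L],Y,S 12[A,D,E,B,C,H,I,F,G,J,M,N,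
  U,P,K,L],S 0[A,D,E,B,C,H,I,F,G,J,M,N,K,L],S 12[A,B,C,D,E,F,G,H,I,J,K,L,U,P,M,N],S 10[B,A,C,F,G,D,E,H,J,I,K,
  L,U,P,M,N],S 26[A,B,C,D,E,F,G,H,I,J,K,L,U,P,M,N],S 26[A,D,E,B,C,H,I,F,G,J,M,N,U,P,K,L],S 19[A,B,C,D,E,F,G,H,
  I,J,K,L,M,U,N]], [Y,Y,Y,Y,Y,Y,S 12[A,B,C,D,E,F,G,H,I,J,K,L,U,P,M,N],S 56[D,A,E,H,I,B,C,F,J,G,M,N,U,P,K,L]],
   [Y,Y,S 0[B,A,C,F,G,D,E,H,J,I],Y,S 5[A,B,C,D,E,F,G,H,I,J,K,L,U,P,M,N],S 5[B,A,C,F,G,D,E,H,J,I,K,L,U,P,M,N],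
  S 16[A,B,C,D,E,F,G,H,I,J,K,L,U,P,M,N]], [Y,Y,Y,S 4[A,B,C,D,E,F,G,H,I,J,K,L,U,P,M,N],S 10[A,B,C,D,E,F,G,H,I,
  J,K,L,U,P,M,N],S 9[B,A,C,F,G,D,E,H,J,I,K,L,U,P,M,N],S 20[A,B,C,D,E,F,G,H,I,J,K,L,U,P,M,N],S 64[A,B,C,D,E,F,
  G,H,I,J,M,N,U,P,K,L]], [S 70[A,B,C,D,E,F,G,H,I,J,M,N,U,P,Q,K,L]], [], [Y,S 0[B,A,C,F,G,D,E,J,K,H,I,N,U,L,M],
  Y,S 0[B,A,C,F,G,D,E,J,K,H,I,N,U,L,M]], [Y], [], [Y,S 0[B,A,C,F,G,D,E,J,K,H,I],S 0[C,A,B,L,M,D,E,N,U,H,I,F,G,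
  J,K],Y,Y,S 1[B,A,C,F,G,D,E,J,K,H,I],S 0[B,A,C,F,G,D,E,J,K,H,I],Y,S 0[B,A,C,F,G,D,E,J,K,H,I],S 2[C,A,B,L,M,D,
  E,N,U,H,I,F,G,J,K],S 1[C,A,B,L,M,D,E,N,U,H,I,F,G,J,K],S 0[C,A,B,L,M,D,E,N,U,H,I,F,G,J,K]], [Y,Y,Y,Y,Y], [Y,
  S 0[B,A,C,F,G,D,E,J,K,H,I],Y,S 4[A,B,C,D,E,F,G,H,I,J,K,L,M,P,Q,N,U],S 4[B,A,C,F,G,D,E,J,K,H,I,L,M,P,Q,N,U]],
   [Y,Y,S 3[A,B,C,D,E,F,G,H,I,J,K,L,M,P,Q,N,U],S 8[A,B,C,D,E,F,G,H,I,J,K,L,M,P,Q,N,U],S 7[B,A,C,F,G,D,E,J,K,H,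
  I,L,M,P,Q,N,U],Y], [], [Y,S 0[B,A,C,F,G,D,E,J,K,H,I,N,U,L,M],Y,S 0[B,A,C,F,G,D,E,J,K,H,I,N,U,L,M]], [Y],
   [S 18[A,B,C,D,E,F,G,H,I,J,K,P,Q,N,U,L,M],Y,Y,S 4[B,A,C,F,G,D,E,J,K,H,I,P,Q,L,M,N,U]], [Y,S 21[A,B,C,D,E,F,
  G,H,I,J,K,N,U,P,Q,L,M],Y,S 6[A,B,C,D,E,F,G,H,I,J,K,L,M,P,Q,N,U]], [], [Y,S 0[B,A,C,F,G,D,E,J,K,H,I,N,U,L,M],
  Y,Y,S 0[A,B,C,E,D,F,G,L,M,J,K,H,I],S 0[B,A,C,F,G,D,E,J,K,H,I,N,U,L,M],S 0[B,A,C,G,F,D,E,N,U,H,I,J,K,L,M],Y,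
  S 0[B,A,C,F,G,D,E,J,K,H,I,N,U,L,M],S 0[A,B,C,E,D,F,G,L,M,J,K,H,I],S 0[B,A,C,G,F,D,E,N,U,H,I,J,K,L,M]], [Y,Y,
  Y,S 0[A,B,C,E,D,F,G,L,M,J,K,H,I],Y], [Y,Y,Y,Y,S 5[A,B,C,D,E,F,G,H,I,J,K,L,M,P,Q,N,U]], [Y,Y,S 4[A,B,C,D,E,F,
  G,H,I,J,K,L,M,P,Q,N,U],S 4[A,B,C,E,D,F,G,L,M,J,K,H,I,P,Q,N,U],S 8[A,B,C,D,E,F,G,H,I,J,K,L,M,P,Q,N,U],Y], [Y,
  S 3[A,B,C,D,E,F,G,H,I,J,K,L,M,P,Q,N,U],S 7[A,B,C,D,E,F,G,H,I,J,K,L,M,P,Q,N,U],S 7[A,B,C,E,D,F,G,L,M,J,K,H,I,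
  P,Q,N,U],S 11[A,B,C,D,E,F,G,H,I,J,K,L,M,P,Q,N,U],Y], [], [Y,Y,S 0[B,A,C,F,G,D,E,J,K,H,I,L,N,M],Y,S 1[D,A,E,
  H,I,B,C,L,M,F,G,J,N,K],S 0[A,D,E,B,C,H,I,F,G,L,M,J,K],S 1[F,B,G,J,K,A,C,L,N,D,E,H,M,I],S 0[B,F,G,A,C,J,K,D,
  E,L,N,H,I,M],S 1[H,D,I,L,M,A,E,J,N,B,C,F,K,G],S 0[D,H,I,A,E,L,M,B,C,J,N,F,G,K],S 1[J,F,K,L,N,B,G,H,M,A,C,D,
  I,E],S 0[F,J,K,B,G,L,N,A,C,H,M,D,E,I],S 1[L,H,M,J,N,D,I,F,K,A,E,B,G,C],S 0[H,L,M,D,I,J,N,A,E,F,K,B,C,G],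
  S 0[J,L,N,F,K,H,M,B,G,D,I,A,C,E],S 76[N,J,L,A,U,F,K,B,C,G,H,M,D,I,E],S 76[M,H,L,B,U,D,I,A,C,E,J,N,F,K,G],
  S 76[C,A,B,L,U,D,E,H,M,I,F,G,J,K,N],S 73[C,A,B,M,U,D,E,H,L,I,F,G,J,K,N],S 73[C,B,A,N,U,F,G,J,L,K,D,E,H,I,M],
  S 76[K,F,J,D,U,B,G,A,E,C,L,N,H,M,I],S 76[E,A,D,J,U,B,C,F,K,G,H,I,L,M,N],S 73[E,A,D,K,U,B,C,F,J,G,H,I,L,M,N],
  S 73[E,D,A,N,U,H,I,L,J,M,B,C,F,G,K],S 76[I,D,H,F,U,A,E,B,G,C,L,M,J,N,K],S 76[G,B,F,H,U,A,C,D,I,E,J,K,L,N,M],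
  S 73[G,B,F,I,U,A,C,D,H,E,J,K,L,N,M],S 73[G,F,B,M,U,J,K,L,H,N,A,C,D,E,I],S 73[I,H,D,K,U,L,M,J,F,N,A,E,B,C,
  G]], [Y,S 0[B,A,C,F,G,D,E,J,K,H,I,N,U,L,M],Y,Y,Y,S 1[B,A,C,F,G,D,E,J,K,H,I,N,U,L,M],S 0[B,A,C,F,G,D,E,J,K,H,
  I,N,U,L,M],Y,Y,S 1[B,A,C,F,G,D,E,J,K,H,I,N,U,L,M],S 0[B,A,C,F,G,D,E,J,K,H,I,N,U,L,M],Y,S 0[B,A,C,F,G,D,E,J,
  K,H,I,N,U,L,M],Y], [Y,Y,Y,Y,S 28[A,B,C,D,E,F,G,H,I,J,K,P,Q,N,U,L,M],Y,S 0[A,B,C,D,E,G,F,H,I,N,U,L,M,J,K],Y,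
  Y,S 11[B,A,C,F,G,D,E,J,K,H,I,P,Q,L,M,N,U],S 9[A,D,E,B,C,H,I,F,G,L,M,J,K,P,Q,N,U],S 11[B,A,C,G,F,D,E,N,U,H,I,
  P,Q,L,M,J,K]], [Y,Y,Y,Y,Y], [Y,Y,Y,Y,Y,Y,S 15[A,B,C,D,E,F,G,H,I,J,K,L,M,P,Q,N,U],Y,S 43[A,D,E,B,C,H,I,F,G,L,
  M,N,U,P,Q,J,K],S 25[A,B,C,D,E,F,G,H,I,J,K,L,M,P,Q,N,U],S 23[A,D,E,B,C,H,I,F,G,L,M,J,K,P,Q,N,U],S 64[A,B,C,D,
  E,F,G,H,I,J,K,N,U,P,Q,L,M]], [Y,Y,Y,S 13[A,B,C,D,E,F,G,H,I,J,K,L,M,P,Q,N,U],S 12[A,D,E,B,C,H,I,F,G,L,M,J,K,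
  P,Q,N,U],Y], [Y,S 4[A,B,C,D,E,F,G,H,I,J,K,L,M,P,Q,N,U],S 4[A,D,E,B,C,H,I,F,G,L,M,J,K,P,Q,N,U],S 16[A,B,C,D,
  E,F,G,H,I,J,K,L,M,P,Q,N,U],S 16[A,D,E,B,C,H,I,F,G,L,M,J,K,P,Q,N,U],Y], [], [Y,Y,S 0[B,A,C,F,G,D,E,J,K,H,I],
  Y,Y,Y,S 1[B,A,C,F,G,D,E,J,K,H,I],S 0[B,A,C,F,G,D,E,J,K,H,I],S 3[H,J,L,D,I,F,K,A,E,B,G,C],S 0[H,J,L,D,I,F,K,
  A,E,B,G,C],S 3[J,H,L,F,K,D,I,B,G,A,E,C],S 0[J,H,L,F,K,D,I,B,G,A,E,C],S 2[H,J,L,D,I,F,K,A,E,B,G,C],Y,Y,S 0[B,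
  A,C,F,G,D,E,J,K,H,I]], [Y,Y,S 0[B,A,C,F,G,D,E,J,K,H,I],Y,Y,Y,S 1[B,A,C,F,G,D,E,J,K,H,I],S 0[B,A,C,F,G,D,E,J,
  K,H,I],Y,Y,S 1[B,A,C,F,G,D,E,J,K,H,I],S 0[B,A,C,F,G,D,E,J,K,H,I],Y,Y,S 123[A,C,B,D,E,M,N,H,I,U,F,G,J,K,L],
  S 122[A,C,B,D,E,M,N,I,H,U,F,G,J,K,L],S 123[B,C,A,F,G,M,N,J,K,U,D,E,H,I,L],S 122[B,C,A,F,G,M,N,K,J,U,D,E,H,I,
  L],Y], [Y,Y,Y,S 0[A,D,E,B,C,H,I,F,G,J,L,K],Y,S 0[A,D,E,B,C,H,I,F,G,J,L,K],Y,Y,S 157[A,M,N,B,C,J,U,F,G,K,D,E,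
  H,I,L]], [Y], [], [Y], [], [Y,Y,S 0[A,C,B,D,E,J,K,H,I,F,G,N,U,L,M],Y], [Y], [Y,Y,S 5[A,B,C,D,E,F,G,H,I,J,K,
  L,M,P,Q,N,U],Y], [], [Y], [S 1[A,B,C,D,E,F,G,H,I,J,K,N,U,P,Q,L,M],Y,S 6[A,B,C,D,E,F,G,H,I,J,K,N,U,P,Q,L,M],
  Y], [Y,S 4[A,B,C,D,E,F,G,H,I,J,K,P,Q,N,U,L,M],S 4[A,C,B,D,E,J,K,H,I,F,G,P,Q,N,U,L,M],Y], [], [Y,Y,Y,Y,S 0[A,
  B,C,E,D,F,G,L,M,J,K,H,I],Y,S 93[A,B,C,D,E,F,G,H,I,N,U,L,M,P,Q,J,K],S 50[A,B,C,D,E,F,G,H,I,N,U,P,Q,J,K,L,M],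
  S 113[A,B,C,D,E,F,G,H,I,N,U,J,K,P,Q,L,M],S 50[A,B,C,E,D,F,G,L,M,N,U,P,Q,J,K,H,I],S 64[B,A,C,F,G,D,E,N,U,H,I,
  P,Q,L,M,J,K]], [Y,Y,Y,Y,S 0[A,B,C,E,D,F,G,L,M,J,K,H,I]], [Y,S 4[A,B,C,D,E,F,G,H,I,J,K,L,M,P,Q,N,U],S 4[A,C,
  B,D,E,J,K,H,I,F,G,L,M,P,Q,N,U],S 4[A,D,E,B,C,H,I,F,G,L,M,J,K,P,Q,N,U],S 4[A,E,D,B,C,L,M,F,G,H,I,J,K,P,Q,N,
  U],Y], [], [], [Y,Y], [Y,S 2[A,B,C,D,E,F,G,H,I,J,K,L,M,P,Q,N,U]], [], [Y], [], [Y,Y], [Y,Y,S 0[A,D,E,B,C,H,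
  I,F,G,L,M,J,K]], [], [], [Y], [], [Y,Y,S 119[A,B,C,D,E,F,G,H,I,N,U,P,Q,J,K,L,M],Y,S 96[A,B,C,D,E,F,G,H,I,N,
  U,P,Q,J,K,L,M],Y,S 99[B,A,C,F,G,D,E,N,U,H,I,P,Q,J,K,L,M],S 61[A,B,C,D,E,F,G,H,I,N,U,P,Q,J,K,L,M],S 1[A,B,C,
  J,K,F,G,L,M,D,E,H,I],S 97[A,B,C,J,K,F,G,L,M,N,U,P,Q,D,E,H,I],S 61[A,B,C,J,K,F,G,L,M,N,U,P,Q,D,E,H,I],S 63[B,
  A,C,F,G,D,E,N,U,H,I,P,Q,J,K,L,M]], [Y,Y,S 0[A,C,B,D,E,N,U,H,I,J,K,L,M,F,G],Y,S 16[A,B,C,D,E,F,G,H,I,N,U,P,Q,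
  J,K,L,M],S 124[A,B,C,D,E,F,G,H,I,P,Q,N,U,J,K,L,M],S 100[A,D,E,B,C,H,I,F,G,P,Q,N,U,J,K,L,M],S 0[A,B,C,J,K,F,
  G,L,M,D,E,H,I],S 16[A,B,C,J,K,F,G,L,M,N,U,P,Q,D,E,H,I],S 100[A,J,K,B,C,L,M,F,G,P,Q,N,U,D,E,H,I],S 124[A,C,B,
  D,E,N,U,H,I,P,Q,F,G,J,K,L,M]], [Y,Y,Y,S 0[A,B,C,J,K,F,G,L,M,D,E,H,I]], [Y,Y], [], [], [], [], [], [], [],
   [], [Y], [], [], [], [], [], [], [], [], [], [], [], [], [], [], [], [], []]"

definition kill_cert7 :: "cert list" where "kill_cert7 =
  [Z[B,D,H,L,U][Z[A,F,J,L,U][X,X,X,X],Z[A,F,J,L,U][X,X,X,X],Z[B,E,H,L,U][Z[A,F,J,L,U][X,X,X],Z[B,D,H,M,U][Z[A,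
  F,J,L,U][X,X],Z[B,D,H,N,U][Z[A,F,J,L,U][X,X],X],Z[B,D,H,N,U][Z[A,F,J,L,U][X,X],X]],Z[B,E,I,L,U][Z[B,D,I,M,
  U][Z[B,D,H,N,P][X],Z[B,D,H,M,P][X]]],Z[B,E,H,L,P][Z[A,F,J,M,U][X,X],Z[B,D,H,M,P][Z[B,D,H,N,P][X],X],X]],
  R 0[A,B,C,D,E,F,G,H,I,J,K,U,P,Q,L,M,N],R 0[A,B,C,H,I,F,G,D,E],R 0[A,B,C,H,I,F,G,D,E,J,K,U,P,Q,L,M,N],Z[B,D,
  H,M,U][Z[A,F,J,M,U][X,X,X],X,R 1[A,B,C,D,E,F,G,H,I,J,K,M,L],R 1[A,B,C,D,E,F,G,H,I,J,K,U,P,Q,L,M,N],R 1[A,B,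
  C,H,I,F,G,D,E,J,K,M,L],R 1[A,B,C,H,I,F,G,D,E,J,K,U,P,Q,L,M,N]]], X, X, Z[A,F,J,N][X,X,X], Z[A,F,L,U][Z[B,D,
  H,J,L,U][X,X,X,X,X],R 0[A,B,C,D,E,F,G,H,I,J,K,U,P,Q,L,M,N],Z[A,F,M,U][Z[A,G,L,U][X,Z[A,G,L,P][X,X],X],R 2[A,
  B,C,D,E,F,G,H,I,J,K,U,P,Q,L,M,N],X,Z[A,F,N,U][Z[A,G,L,P][X,X],X]],R 0[A,B,C,D,E,F,G,H,I,J,K,U,P,Q,L,M,N],
  Z[A,F,M,U][R 5[A,B,C,D,E,F,G,H,I,J,K,M,L],X,Z[A,G,M,U][X,Z[A,G,M,P][X]],R 2[A,B,C,D,E,F,G,H,I,J,K,U,P,Q,L,M,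
  N]]], X, Z[A,F,N][X,X], Z[A,F,H,L,U][Z[C,D,F,J,L,U][X,Z[C,E,F,J,L,U][X],Z[C,D,G,J,L,U][X,X,Z[C,D,G,J,M,
  U][X]],Z[C,D,F,K,L,U][X],Z[C,D,F,J,M,U][X,Z[C,D,G,J,M,U][X]]],R 0[A,B,C,D,E,F,G,H,I,J,K,U,P,Q,L,M,N],Z[A,F,
  H,M,U][R 0[A,B,C,D,E,F,G,H,I,J,K,M,L],Z[C,D,G,J,L,U][X,X,Z[C,D,G,J,L,P][X]],Z[A,G,H,L,U][Z[A,G,H,M,U][X],
  Z[A,G,H,L,P][X]],Z[A,F,H,N,U][R 5[A,B,C,D,E,F,G,H,I,J,K,N,L,M],Z[C,D,G,J,L,U][X,X,Z[A,F,I,M,P][X]],Z[A,G,H,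
  L,U][X],Z[A,G,I,L,U][X],Z[A,G,H,L,U][Z[C,D,F,J,N,P][X],Z[A,G,H,L,P][Z[A,F,I,M,U][X],X]]],Z[A,F,I,M,
  U][R 14[A,B,C,D,E,F,G,H,I,J,K,M,L],Z[A,G,H,L,P][X],R 1[A,B,C,D,E,F,G,I,H],Z[A,F,H,M,P][X,Z[A,G,H,L,Q][X],
  X]],Z[A,F,H,N,U][R 18[A,B,C,D,E,F,G,H,I,J,K,N,L,M],Z[C,D,F,J,M,P][X],R 5[A,B,C,D,E,F,G,H,I,J,K,L,N,M],
  R 1[]]],R 0[A,B,C,D,E,F,G,H,I,J,K,U,P,Q,L,M,N],R 0[A,C,B,D,E,H,I,F,G],R 0[A,C,B,D,E,H,I,F,G,J,K,U,P,Q,L,M,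
  N],Z[A,F,H,M,U][R 21[A,B,C,D,E,F,G,H,I,J,K,M,L],Z[C,D,F,J,L,P][Z[C,D,G,J,L,P][X],X],R 2[A,B,C,D,E,F,G,H,I,J,
  K,M,L],R 2[A,B,C,D,E,F,G,H,I,J,K,U,P,Q,L,M,N],R 2[A,C,B,D,E,H,I,F,G,J,K,M,L],R 2[A,C,B,D,E,H,I,F,G,J,K,U,P,
  Q,L,M,N]]], X, Z[A,F,H,N][X,Z[A,G,H,N][X],Z[A,F,I,N][X]], X, X, Z[B,D,H,J,N][X,Z[B,E,H,J,N][X],Z[B,D,I,J,
  N][X,X],Z[B,D,H,K,N][X]], Z[C,D,F,J][X,Z[C,E,F,J][X],Z[C,D,G,J][X]], Z[A,F,H,J][X,Z[A,G,H,J][X],Z[A,F,I,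
  J][X]], Z[C,D,F,J,U][Z[B,D,H,J,U][X,Z[B,D,H,J,P][X,X,Z[B,E,H,J,U][X]],Z[B,D,I,J,U][X],Z[B,D,H,K,M,U][X,X,
  Z[B,D,H,J,P][X,X]]],Z[B,D,H,J,U][X,Z[B,E,H,J,U][X,Z[B,E,H,J,P][X]],Z[B,D,I,J,U][X],Z[B,D,H,J,P][Z[B,E,H,J,
  P][X],X]],Z[A,F,H,J,U][Z[C,E,F,J,U][X],Z[C,E,G,J,U][Z[B,E,H,J,U][X,X],Z[C,E,G,J,P][R 0[A,B,C,D,E,F,G,H,I,J,
  K,L,M,N,P,U],Z[A,G,H,J,U][Z[A,G,I,J,U][X],Z[A,G,I,J,U][X]],Z[C,D,F,K,M,U][X,X]],R 0[B,A,C,F,G,D,E],Z[C,D,F,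
  K,M,U][X,X,X]],Z[C,E,G,J,U][Z[C,E,F,J,P][R 9[A,B,C,D,E,F,G,H,I,J,K,L,M,N,P,U],Z[C,E,G,J,P][X],Z[C,E,F,J,
  Q][Z[B,E,H,J,Q][X]]],R 4[A,B,C,D,E,G,F],Z[C,E,F,J,P][Z[B,E,H,J,P][X],Z[A,F,H,J,P][X,X]]],R 8[A,C,B,D,E,H,I,
  F,G],R 0[A,C,B,D,E,H,I,F,G],Z[A,F,H,J,P][Z[C,E,F,J,P][X],Z[C,D,F,K,M,U][X,X,X],R 2[A,B,C,D,E,F,G,H,I,J,K,L,
  M,N,P,U],Z[B,D,H,K,M,U][X,X,X],R 3[A,C,B,D,E,H,I,F,G,J,K,L,M,N,P,U]]],Z[C,E,F,J,U][Z[B,E,H,J,U][X,Z[B,D,H,J,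
  P][X,X]],R 2[A,B,C,E,D],R 2[B,A,C,F,G,D,E],Z[C,E,G,J,U][Z[B,E,H,J,U][X,X],R 3[A,B,C,E,D],R 3[B,A,C,G,F,D,E],
  Z[C,D,F,J,P][X,X]],Z[C,D,F,J,P][Z[B,D,H,J,P][X,X],Z[B,D,H,J,P][X,X],R 7[B,A,C,F,G,D,E],Z[B,D,H,J,P][X,Z[C,D,
  G,J,P][X],X]]],R 11[B,A,C,F,G,D,E],R 0[B,A,C,F,G,D,E],Z[C,D,F,J,P][Z[B,D,H,K,M,U][X,X,Z[B,D,H,J,P][X,X]],
  R 35[A,B,C,D,E,F,G,H,I,J,K,L,M,N,P,U],R 13[],R 2[A,B,C,D,E,F,G,H,I,J,K,L,M,N,P,U],R 13[B,A,C,F,G,D,E],R 2[B,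
  A,C,F,G,D,E,H,I,J,K,L,M,N,P,U]]], Z[C,D,F,K][Z[B,E,H,K][X],X,X], Z[C,D,F,K,N][Z[C,D,F,L,N][Z[B,E,H,K,N][Z[A,
  F,I,K,N][X],Z[A,F,I,K,N][X]],Z[B,E,H,L,N][X,Z[A,F,I,L,N][Z[A,G,H,K,N][X]],X,Z[B,E,H,K,N][X]],Z[B,E,H,K,N][X,
  Z[B,E,H,K,U][X]],R 2[B,A,C,F,G,D,E,H,J,I],Z[A,G,H,K,N][X,Z[B,E,H,K,U][X]],Z[C,D,F,M,N][Z[B,E,H,K,N][X,Z[A,G,
  H,K,N][X],X],Z[B,E,H,K,N][X],R 1[B,A,C,F,G,D,E,H,J,I],Z[A,G,H,K,N][X]]],R 0[A,B,C,D,E,F,G,H,I,J,N,U,P,K,L,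
  M],Z[A,G,H,K,N][X,R 0[B,F,G,A,C,H,J,D,E,I],Z[B,E,H,K,N][X,Z[B,E,H,L,N][X]],X,Z[A,G,H,L,N][X,Z[B,E,H,L,
  N][X]]],R 0[A,B,C,D,E,F,G,H,I,J,N,U,P,K,L,M],R 0[B,A,C,F,G,D,E,H,J,I],R 0[B,A,C,F,G,D,E,H,J,I,N,U,P,K,L,M],
  Z[C,D,F,L,N][R 5[A,B,C,D,E,F,G,H,I,J,L,K],R 5[A,B,C,D,E,F,G,H,I,J,N,U,P,K,L,M],R 0[A,B,C,D,E,F,G,H,I,J,L,K],
  Z[B,E,H,K,U][Z[A,G,H,L,N][X],X],R 2[B,A,C,F,G,D,E,H,J,I,L,K],Z[B,E,H,K,U][Z[A,G,H,K,U][X],X]]], X, X, X, X,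
   Z[A,G,H,M][X,Z[A,G,H,N][X,X],X], X, Z[B,E,H,K][X], X, X, X, X, X, X, Z[C,D,F,M][Z[C,D,F,N][X,X],X,X], Z[C,
  D,F,L,U][Z[C,D,F,M,U][Z[A,F,H,L,U][Z[A,F,I,L,U][Z[A,F,I,M,U][X],Z[A,F,I,L,P][X]],Z[A,F,H,M,U][Z[B,D,J,L,
  U][X],X],R 0[A,B,C,D,E,F,G,H,I,J,K,U,P,Q,L,M,N]],Z[A,F,H,L,U][Z[C,E,F,H,M,U][X,Z[B,D,J,L,U][X]],Z[A,F,I,M,
  U][X,Z[B,D,J,L,U][X,Z[B,D,J,N,U][X]],Z[A,F,I,L,P][X,Z[B,D,J,L,P][X,X],Z[C,D,F,N,U][X]],Z[A,F,I,L,U][Z[B,D,J,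
  L,U][X]]],Z[A,F,H,L,P][Z[C,E,F,H,M,P][X,X],Z[B,D,J,L,U][X,Z[B,D,J,N,U][X]],Z[A,F,I,M,P][Z[B,D,J,L,U][X,X],
  X],Z[C,D,F,N,P][Z[B,D,J,N,P][X]]],Z[A,F,I,L,U][R 8[A,B,C,D,E,F,G,I,H],R 0[],Z[A,F,I,M,U][Z[C,D,F,N,U][Z[B,D,
  J,N,U][X]],X,X]],Z[C,D,F,N,U][Z[A,F,H,M,U][Z[B,D,J,N,U][X],Z[A,F,I,M,U][Z[B,D,J,N,U][X]]],Z[C,D,F,N,P][X]]],
  Z[C,D,F,M,P][R 29[A,B,C,D,E,F,G,H,I,J,K,L,M,N,P,U],Z[A,F,H,L,U][X,X],R 1[B,A,C,F,G,D,E,J,K,H,I],Z[C,D,F,M,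
  Q][R 1[A,B,C,D,E,F,G,H,I,J,K,Q,U,P,L,M,N],Z[A,F,H,L,U][X],Z[B,D,J,L,P][X],Z[C,D,F,N,Q][Z[A,F,H,L,U][X],Z[B,
  D,J,L,P][X]]],Z[C,D,F,N,P][Z[A,F,H,L,U][X,X],R 8[B,A,C,F,G,D,E,J,K,H,I,L,N,M],Z[B,D,J,M,Q][X]]],R 11[B,A,C,
  F,G,D,E,J,K,H,I],R 0[B,A,C,F,G,D,E,J,K,H,I],Z[C,D,F,N,U][R 11[A,B,C,D,E,F,G,H,I,J,K,L,N,M],R 0[],R 11[B,A,C,
  F,G,D,E,J,K,H,I,L,N,M],R 0[B,A,C,F,G,D,E,J,K,H,I]]],R 0[A,B,C,D,E,F,G,H,I,J,K,U,P,Q,L,M,N],Z[C,D,F,M,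
  U][R 0[A,B,C,D,E,F,G,H,I,J,K,M,L],R 0[A,B,C,D,E,F,G,H,I,J,K,U,P,Q,L,M,N],Z[A,F,H,L,U][X,X,X],Z[C,D,F,N,
  U][R 1[A,B,C,D,E,F,G,H,I,J,K,N,L,M],R 1[A,B,C,D,E,F,G,H,I,J,K,U,P,Q,L,M,N],Z[A,F,H,L,U][X,X],Z[B,D,J,M,U][X,
  X],Z[C,D,F,N,P][R 3[A,B,C,D,E,F,G,H,I,J,K,N,L,M],R 3[A,B,C,D,E,F,G,H,I,J,K,P,U,Q,L,M,N],Z[A,F,H,L,U][X],Z[B,
  D,J,M,U][X]]],Z[C,D,F,M,P][R 7[A,B,C,D,E,F,G,H,I,J,K,M,L],R 7[A,B,C,D,E,F,G,H,I,J,K,P,U,Q,L,M,N],Z[A,F,H,L,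
  P][X,X],Z[B,D,J,M,U][X,X],Z[C,D,F,N,P][R 9[A,B,C,D,E,F,G,H,I,J,K,N,L,M],Z[C,D,F,M,Q][Z[A,F,H,M,Q][X]],Z[B,D,
  J,N,P][X]]],Z[C,D,F,N,U][R 14[A,B,C,D,E,F,G,H,I,J,K,N,L,M],R 14[A,B,C,D,E,F,G,H,I,J,K,U,P,Q,L,M,N],R 7[A,B,
  C,D,E,F,G,H,I,J,K,L,N,M],R 0[]]],R 0[A,B,C,D,E,F,G,H,I,J,K,U,P,Q,L,M,N],R 0[B,A,C,F,G,D,E,J,K,H,I],R 0[B,A,
  C,F,G,D,E,J,K,H,I,U,P,Q,L,M,N],Z[C,D,F,M,U][R 16[A,B,C,D,E,F,G,H,I,J,K,M,L],R 16[A,B,C,D,E,F,G,H,I,J,K,U,P,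
  Q,L,M,N],R 0[A,B,C,D,E,F,G,H,I,J,K,M,L],R 0[A,B,C,D,E,F,G,H,I,J,K,U,P,Q,L,M,N],R 0[B,A,C,F,G,D,E,J,K,H,I,M,
  L],R 0[B,A,C,F,G,D,E,J,K,H,I,U,P,Q,L,M,N]]], X, X, Z[A,F,H,N][X,Z[A,F,I,N][X,X,Z[A,F,I,U][X,X]],Z[A,F,H,
  U][X,X,Z[A,F,I,U][X]],Z[A,F,H,U][X,X,Z[A,F,I,N][X]]], Z[A,F,H,L][Z[B,D,J,L][X],Z[C,D,F,N][X]], X, X, X, Z[C,
  D,F,N][Z[C,D,F,U][Z[C,E,F,H,U][X,X],Z[C,D,G,J,U][X,X]],Z[C,E,F,H,N][X,Z[C,D,F,U][X]],Z[C,D,G,J,N][X,Z[C,D,F,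
  U][X]]], X, X, X, X, Z[C,D,F,N][Z[B,D,J,N][Z[C,D,F,U][X,X],Z[C,D,F,U][X]],Z[A,F,H,L,N][X,X,X],Z[B,D,J,N][X,
  X]], Z[C,E,G,H,J][Z[C,D,G,J,L][X],Z[C,E,F,H,N][X],Z[C,E,G,I,J][Z[C,E,F,H,N][X]]], Z[C,E,F,H][X], Z[C,D,F,
  L][X], Z[B,E,H,J][X,X], Z[C,E,F,H,N][X], Z[A,F,H,L,N][Z[C,E,F,H,N][X],Z[C,E,F,I,N][Z[B,E,H,J,N][Z[B,D,J,L,
  N][X,X],Z[B,E,I,J,N][X],Z[B,E,H,K,N][Z[B,D,K,L,N][X]]],Z[C,D,F,L,N][X,X],Z[B,E,H,J,N][X,X],Z[C,E,F,I,
  U][R 2[A,B,C,D,E,F,G,H,I,J,K,L,M,U,N],R 1[A,B,C,D,E,F,G,H,I,J,K,L,M,U,N],Z[B,E,H,J,N][X]]],R 0[A,B,C,E,D,F,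
  G,L,M,J,K,H,I],Z[A,F,H,L,U][Z[C,E,F,H,U][X],Z[B,E,H,J,N][X,X],Z[B,D,J,L,N][X,X],Z[B,E,H,J,N][Z[B,E,H,K,
  N][X],X,X],R 0[A,B,C,E,D,F,G,L,M,J,K,H,I]],Z[C,E,F,I,N][Z[A,F,I,L,N][R 6[A,B,C,D,E,F,G,I,H],R 6[A,B,C,E,D,F,
  G,L,M,J,K,H,I],Z[C,E,F,H,U][X,X]],R 8[A,B,C,D,E,F,G,I,H],R 2[]],R 0[A,B,C,E,D,F,G,L,M,J,K,H,I]], Z[B,E,H,
  J][X], Z[B,E,H,J][Z[B,D,J,L][X,X],Z[B,D,J,L][X]], Z[A,G,H,J][X,X], Z[A,F,H][X], Z[C,E,F,H][Z[C,D,F,L][X]],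
   Z[A,F,H,N][X,X], Z[A,F,H][X], Z[A,F,H,N][Z[C,E,F,H,N][Z[B,D,J,L,U][X,X]],Z[B,D,J,L,N][X,X,Z[B,D,K,L,N][X,
  X],R 0[A,D,E,B,C,H,I,F,G,L,M,J,K]],Z[A,F,H,U][Z[C,E,F,H,U][X],X,Z[A,F,H,P][X]],R 0[A,D,E,B,C,H,I,F,G,L,M,J,
  K]], X, X, X, Z[A,F,H,M][X,X,X], Z[C,D,F,L,U][Z[B,D,J,L,U][Z[C,D,F,M,U][Z[C,D,F,N,U][X,Z[C,D,F,N,P][X]],Z[C,
  D,G,M,U][Z[C,D,F,N,P][X,X]],Z[B,D,J,L,P][X,Z[B,D,K,L,P][X]]],Z[B,D,J,L,P][Z[B,D,J,L,Q][X,Z[B,D,J,M,Q][X]],X,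
  Z[B,D,J,M,P][X]],Z[B,D,K,L,U][R 0[]],Z[B,D,J,M,U][X,Z[B,D,J,L,P][Z[C,D,F,M,P][X],X]]],R 0[A,B,C,D,E,F,G,H,I,
  J,K,U,P,Q,L,M,N],Z[C,D,F,M,U][R 0[A,B,C,D,E,F,G,H,I,J,K,M,L],R 0[A,B,C,D,E,F,G,H,I,J,K,U,P,Q,L,M,N],Z[C,E,F,
  H,L,U][X,Z[C,E,F,H,M,U][X],Z[C,E,F,H,L,P][X]],Z[C,D,F,N,U][R 3[A,B,C,D,E,F,G,H,I,J,K,N,L,M],Z[B,D,J,M,U][X,
  Z[B,D,J,N,U][X]],Z[C,E,F,H,L,U][X,Z[C,D,G,M,P][X]],Z[C,D,G,M,U][Z[C,D,G,M,P][X]],Z[C,D,G,M,U][Z[B,D,J,M,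
  U][X],Z[C,D,G,M,P][Z[B,D,J,M,U][X],Z[C,E,F,H,L,U][X]]]],Z[C,D,G,M,U][R 15[A,B,C,D,E,F,G,H,I,J,K,M,L],Z[C,E,
  F,H,L,P][X],R 1[A,B,C,D,E,G,F],Z[C,D,G,N,U][Z[B,D,J,N,U][X],R 2[A,B,C,D,E,G,F,H,I,J,K,L,N,M]]],Z[C,D,F,N,
  U][Z[B,D,J,N,U][Z[C,D,F,M,P][X],X],Z[B,D,J,M,P][X],R 7[A,B,C,D,E,F,G,H,I,J,K,L,N,M],R 3[]]],R 0[A,B,C,D,E,F,
  G,H,I,J,K,U,P,Q,L,M,N],Z[C,D,F,M,U][R 24[A,B,C,D,E,F,G,H,I,J,K,M,L],R 24[A,B,C,D,E,F,G,H,I,J,K,U,P,Q,L,M,N],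
  R 0[A,B,C,D,E,F,G,H,I,J,K,M,L],R 0[A,B,C,D,E,F,G,H,I,J,K,U,P,Q,L,M,N],Z[C,D,G,L,U][Z[C,D,G,M,U][X],Z[C,D,G,
  L,P][X]],Z[C,D,F,N,U][R 27[A,B,C,D,E,F,G,H,I,J,K,N,L,M],R 27[A,B,C,D,E,F,G,H,I,J,K,U,P,Q,L,M,N],R 3[A,B,C,D,
  E,F,G,H,I,J,K,N,L,M],R 3[A,B,C,D,E,F,G,H,I,J,K,U,P,Q,L,M,N]]],R 0[A,B,C,D,E,F,G,H,I,J,K,U,P,Q,L,M,N],Z[C,D,
  F,M,U][R 29[A,B,C,D,E,F,G,H,I,J,K,M,L],R 29[A,B,C,D,E,F,G,H,I,J,K,U,P,Q,L,M,N],R 5[A,B,C,D,E,F,G,H,I,J,K,M,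
  L],R 5[A,B,C,D,E,F,G,H,I,J,K,U,P,Q,L,M,N],R 0[A,B,C,D,E,F,G,H,I,J,K,M,L],R 0[A,B,C,D,E,F,G,H,I,J,K,U,P,Q,L,
  M,N]]], X, Z[C,D,F,L,N][X,Z[C,E,F,H,L,N][X,Z[C,E,G,H,L,N][X]],Z[C,D,G,L,N][Z[C,E,G,H,L,N][X],X],Z[C,D,F,M,
  N][X]], X, X, X, Z[B,D,J,N][X,Z[B,D,J,U][X,X],Z[B,D,J,U][X,X]], X, X, X, Z[C,D,F,N][X,Z[C,D,F,U][X,X],Z[C,D,
  F,U][X,X]], Z[C,E,F,H][X], Z[B,E,H,J][X], Z[C,E,F,H,N][X], Z[C,E,F,H,N][Z[B,E,H,J,N][X,Z[B,E,I,J,N][X]],Z[C,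
  D,F,L,N][X,Z[C,D,G,L,N][X]],Z[C,E,G,I,N][Z[B,E,H,J,N][X,Z[B,E,I,J,N][X]],Z[C,D,F,L,N][X,Z[C,D,G,L,N][X]],
  Z[C,E,F,I,N][Z[C,D,F,L,N][X],Z[C,E,G,H,U][Z[B,E,H,J,N][X],Z[C,D,F,L,N][X]]],R 0[A,D,E,B,C,H,I,F,G,L,M,J,K]],
  Z[C,E,G,H,N][Z[C,D,G,L,N][X],R 1[A,B,C,D,E,G,F],Z[C,E,G,I,N][R 1[A,B,C,D,E,G,F,I,H]]],R 0[A,D,E,B,C,H,I,F,G,
  L,M,J,K]], Z[B,D,L,U][Z[B,D,M,U][X,Z[B,D,N,U][X,X,Z[B,D,N,P][X,X]],Z[B,D,M,P][X,X,Z[B,D,N,P][X]],Z[B,D,M,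
  P][X,X,Z[B,D,N,U][X]]],R 0[A,B,C,D,E,F,G,H,I,J,K,U,P,Q,L,M,N],Z[B,D,M,U][R 0[A,B,C,D,E,F,G,H,I,J,K,M,L],
  R 0[A,B,C,D,E,F,G,H,I,J,K,U,P,Q,L,M,N],X,Z[B,D,M,P][X,Z[B,D,N,U][X],X]],R 0[A,B,C,D,E,F,G,H,I,J,K,U,P,Q,L,M,
  N],Z[B,D,M,U][R 3[A,B,C,D,E,F,G,H,I,J,K,M,L],Z[B,D,L,P][X,X],R 1[A,B,C,D,E,F,G,H,I,J,K,M,L],Z[B,D,L,P][X,
  X]]], X, X, Z[B,D,L,N][X,X,X], X, Z[B,D,N][X,X], X, X, Z[B,D,N][X,X], Z[B,D,J,L,U][Z[C,D,F,J,L,U][Z[A,F,H,L,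
  U][Z[A,G,H,L,U][Z[A,F,I,M,U][X,X]],Z[A,F,H,M,U][Z[A,F,I,L,U][X],X],Z[A,F,I,L,U][X,Z[A,F,I,M,U][X]]],Z[B,E,H,
  J,M,U][Z[A,F,H,M,U][X,Z[A,G,H,M,U][X]],Z[B,E,I,J,M,U][X],Z[B,E,H,K,M,U][X,Z[B,D,J,N,P][X]],Z[B,D,J,M,P][X,
  Z[B,D,J,N,P][X],Z[B,D,K,M,P][X]]],Z[C,D,G,J,L,U][R 0[],X],Z[C,D,F,K,L,U][X,Z[B,D,J,M,P][Z[B,D,J,N,P][X],Z[B,
  D,J,M,Q][X]]],Z[C,D,F,J,L,P][Z[B,D,J,M,P][Z[B,D,J,N,P][X],X],R 7[A,B,C,D,E,F,G,H,I,J,K,L,M,N,P,U],Z[C,D,G,J,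
  L,P][Z[A,F,H,M,U][X],X],Z[C,D,F,K,L,P][X]]],R 0[A,B,C,D,E,F,G,H,I,J,K,U,P,Q,L,M,N],R 0[A,D,E,B,C,H,I,F,G],
  R 0[A,D,E,B,C,H,I,F,G,J,K,U,P,Q,L,M,N],Z[B,D,K,L,U][R 0[A,B,C,D,E,F,G,H,I,J,K,U,P,Q,L,M,N],R 0[A,D,E,B,C,H,
  I,F,G,J,K,U,P,Q,L,M,N],Z[B,D,J,M,U][R 0[A,B,C,D,E,F,G,H,I,J,K,M,L],R 0[A,D,E,B,C,H,I,F,G,J,K,M,L],Z[B,D,J,N,
  U][Z[C,D,F,J,N,U][X],Z[B,E,H,J,N,U][X]]],Z[B,D,K,L,P][Z[C,D,F,K,L,P][X],Z[B,E,H,K,L,P][X],R 2[A,B,C,D,E,F,G,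
  H,I,J,K,L,M,N,P,U]]],R 0[A,B,C,D,E,F,G,H,I,J,K,U,P,Q,L,M,N],Z[B,D,J,M,U][R 8[A,B,C,D,E,F,G,H,I,J,K,M,L],
  R 8[A,B,C,D,E,F,G,H,I,J,K,U,P,Q,L,M,N],R 8[A,D,E,B,C,H,I,F,G,J,K,M,L],R 8[A,D,E,B,C,H,I,F,G,J,K,U,P,Q,L,M,
  N],R 0[A,B,C,D,E,F,G,H,I,J,K,M,L],R 0[A,B,C,D,E,F,G,H,I,J,K,U,P,Q,L,M,N]]], X, Z[B,D,J,L,N][X,X,X,X], X, X,
   X, X, Z[B,D,J,N][X,X,X], Z[B,D,J][X,X], Z[C,D,F,J][Z[A,F,H,J][Z[B,D,J,U][X],Z[B,D,J,U][X,X]],Z[A,F,H,J][X,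
  X],Z[B,D,J,U][X,X]], Z[C,D,F,J][X,Z[C,E,F,H,J][X,Z[C,E,G,H,J][X]],Z[C,D,G,J][Z[C,E,G,H,J][X]]], Z[B,D,J][X,
  X], Z[B,D,J,U][X,X,X], Z[B,D,J,U][Z[C,D,F,J,U][Z[A,F,H,J,U][Z[A,G,H,J,U][Z[C,D,F,J,P][X]],Z[B,D,K,M,U][X,X],
  Z[A,F,I,J,U][X,Z[B,D,K,M,U][X,X]]],Z[C,D,F,J,P][Z[A,F,H,J,P][X,Z[A,F,I,J,P][X]],X,Z[B,D,K,M,P][X,X]],Z[C,D,
  G,J,U][R 0[]],Z[B,D,K,M,U][X,X,X]],Z[B,D,J,P][X,R 0[A,D,E,B,C,H,I,F,G],Z[B,D,J,Q][X,X,Z[C,D,F,J,U][Z[B,E,H,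
  J,P][X],X]],Z[B,D,J,Q][Z[B,D,K,M,P][X,X],Z[C,D,F,J,U][Z[B,E,H,J,Q][X],X]]],R 8[A,D,E,B,C,H,I,F,G],R 0[A,D,E,
  B,C,H,I,F,G],Z[B,D,J,P][Z[B,D,K,M,U][X,X,X],R 1[A,B,C,D,E,F,G,H,I,J,K,L,M,N,P,U],Z[B,D,K,M,U][X,X,X],R 2[A,
  D,E,B,C,H,I,F,G,J,K,L,M,N,P,U]]], Z[A,L,U][Z[A,M,U][X,X],Z[A,L,P][X,X],Z[A,M,U][X,X]], X, Z[A,N][X], Z[B,D,
  F,M][X,X,X], Z[A,F,K][X,X], Z[A,F,K,U][Z[B,D,F,M,U][X,X,X,X],Z[B,D,F,M,U][X,X,X,X],Z[A,F,L,U][R 0[],Z[A,G,I,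
  K,U][X,X,X],Z[A,F,L,P][Z[B,D,F,M,U][X,X],Z[A,G,I,K,U][X,X]]],Z[A,F,K,P][X,R 5[A,B,C,D,E,F,G,H,I,J,K,L,M,N,P,
  U],R 0[],Z[A,F,L,P][X,Z[A,G,I,L,P][X,X]]],Z[A,F,L,U][Z[B,D,F,M,U][X,X,X],R 4[A,B,C,D,E,F,G,H,I,J,L,K],Z[A,F,
  K,P][X,X]]], Z[B,D,F][X,X], Z[A,F,K][X,X], Z[B,D,F,U][Z[A,F,K,U][X,X,X],Z[A,F,K,U][X,X,X],Z[B,E,F,U][Z[A,F,
  K,U][X,X],Z[B,E,F,P][Z[A,F,K,U][X],Z[A,F,K,U][X,X]],Z[A,F,K,P][X,X,Z[B,E,F,P][X]]],Z[B,E,F,U][Z[A,F,K,U][X,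
  X],R 1[A,B,C,E,D],Z[B,D,F,P][X,X]],Z[B,D,F,P][X,Z[A,F,K,P][X,X],R 4[],Z[B,E,F,P][X,Z[A,F,K,P][X,X]]]], Z[B,
  D,G,I][Z[B,D,F,M][X,X],Z[B,D,F,M][Z[C,D,G,I,K][X],X,Z[B,D,G,J][X]],Z[B,D,F,M][X,X],R 1[A,D,E,B,C,F,G,H,I,J,
  U,P,M,N,K,L]], Z[C,D,G,I,K][Z[B,D,F,M,U][Z[B,E,F,M,U][X],X],Z[B,D,G,I,U][X,Z[B,E,G,I,U][X],Z[B,D,G,I,P][X]],
  Z[C,D,F,K,M][Z[B,E,G,I,U][X],R 1[A,B,C,D,E,G,F,H,M,N,K,L,I,J],Z[C,E,G,I,K][Z[B,E,G,I,U][X],Z[B,E,G,J,U][X,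
  X]],Z[B,D,F,M,U][X,Z[C,D,F,L,M][X],X]],Z[C,E,G,I,K][Z[B,E,G,I,U][X],R 1[A,B,C,E,D],R 1[B,A,C,K,L,F,G,H,I,J,
  D,E],Z[C,D,G,J,K][Z[B,E,G,I,U][X],R 9[A,B,C,D,E,F,G,H,J,I]]],R 4[B,A,C,K,L,F,G,H,I,J,D,E],R 0[B,A,C,K,L,F,G,
  H,I,J,D,E]], Z[A,G,I,K][X,Z[B,D,G,I,U][X,X,X],Z[A,F,K,M][X,X],Z[A,G,J,K][X,Z[A,F,K,M][X,X]]], Z[B,D,G,I,
  U][Z[A,F,K,M,U][Z[A,F,K,M,P][Z[A,F,K,M,Q][Z[A,F,L,M,Q][X],Z[A,F,K,N,Q][X]],Z[A,F,L,M,P][Z[A,G,I,K,Q][X],X],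
  Z[A,F,K,N,P][X]],R 0[F,G,H,I,J,A,B,C,D,E,M,N,K,L],Z[A,F,L,M,U][R 0[F,G,H,I,J,A,B,C,D,E,M,N,K,L],X],R 0[F,G,
  H,I,J,A,B,C,D,E,M,N,K,L]],Z[A,G,I,K,U][R 0[B,A,C,K,L,F,G,H,I,J,D,E],Z[B,D,G,J,U][Z[C,E,G,I,K,U][X],Z[B,E,G,
  J,U][Z[C,D,G,I,K,U][X],Z[B,E,G,J,P][X]],Z[B,D,G,J,P][Z[B,E,G,J,P][X],Z[B,D,G,J,Q][X]],Z[B,D,G,J,P][Z[B,E,G,
  J,P][X],Z[B,D,G,J,Q][X]]],Z[A,G,I,L,U][Z[C,D,G,I,L,U][X,X],Z[A,F,K,M,U][X,X],X,Z[A,G,I,L,P][Z[C,D,G,I,L,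
  P][X,X],Z[A,F,K,M,U][X],X]],Z[A,G,I,K,P][X,R 6[A,B,C,D,E,F,G,H,I,J,K,L,M,N,P,U],Z[A,F,K,M,U][X,X],Z[A,G,J,K,
  P][X,X],Z[A,G,I,L,P][X,Z[A,F,L,M,P][X]]],Z[A,G,J,K,U][R 22[B,A,C,K,L,F,G,H,I,J,D,E],X],Z[A,G,I,L,U][Z[C,D,G,
  I,L,U][X,X],R 7[A,B,C,D,E,F,G,H,I,J,L,K],R 2[]]],Z[A,G,I,K,U][R 26[B,A,C,K,L,F,G,H,I,J,D,E],R 0[B,A,C,K,L,F,
  G,H,I,J,D,E],R 0[F,G,H,I,J,B,A,C,K,L,M,N,D,E],Z[A,G,I,K,P][R 0[B,A,C,K,L,F,G,H,I,J,D,E],Z[A,G,I,L,P][X],Z[A,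
  G,J,K,P][Z[A,G,I,K,Q][X],X]],Z[A,G,I,L,U][Z[C,D,G,I,L,U][X],R 5[F,G,H,I,J,B,A,C,L,K,M,N,D,E],Z[A,G,I,L,
  P][X]],Z[A,G,J,K,U][R 33[B,A,C,K,L,F,G,H,I,J,D,E],R 7[B,A,C,K,L,F,G,H,J,I,D,E],Z[A,G,I,L,P][X],R 1[A,B,C,D,
  E,F,G,H,J,I]]],R 10[F,G,H,I,J,A,B,C,D,E,M,N,K,L],Z[B,E,G,J,U][R 36[],R 10[A,B,C,D,E,F,G,H,J,I],R 0[],R 10[F,
  G,H,I,J,A,B,C,E,D,M,N,K,L],Z[B,D,G,J,U][R 36[],R 10[A,B,C,D,E,F,G,H,J,I],R 0[F,G,H,I,J,A,B,C,D,E,M,N,K,L],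
  Z[B,E,G,I,P][R 36[],R 0[A,B,C,D,E,F,G,H,I,J,K,L,M,N,P,U],Z[B,D,F,M,U][Z[A,G,I,K,U][X],X],R 2[F,G,H,I,J,A,B,
  C,D,E,M,N,K,L,P,U]]],R 4[F,G,H,I,J,A,B,C,D,E,M,N,K,L],R 0[F,G,H,I,J,A,B,C,D,E,M,N,K,L]],Z[B,E,G,I,U][R 41[],
  R 15[],R 15[F,G,H,I,J,A,B,C,E,D,M,N,K,L],R 0[A,B,C,E,D],R 5[F,G,H,I,J,A,B,C,D,E,M,N,K,L],Z[B,E,G,J,
  U][R 41[],R 15[A,B,C,D,E,F,G,H,J,I],R 15[F,G,H,I,J,A,B,C,E,D,M,N,K,L],R 0[A,B,C,E,D,F,G,H,J,I]]],R 7[F,G,H,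
  I,J,A,B,C,D,E,M,N,K,L],R 0[F,G,H,I,J,A,B,C,D,E,M,N,K,L]], Z[A,F][X], Z[A,F,U][Z[A,G,I,U][X,X,X],Z[A,F,P][X,
  X],Z[A,F,P][X,X]], Z[A,F][X], Z[A,F,U][Z[B,D,F,K,U][X,X,X,X],Z[A,F,P][X,X],Z[A,F,P][X,X]], Z[B,D,F,K][Z[A,F,
  K,P][X,X,X],Z[A,F,K,P][X,X,X],Z[B,E,F,K][Z[A,F,K,P][X,X],Z[A,F,K,P][Z[B,D,G,I,K][X,X],Z[B,E,F,L,N][X,X]],
  Z[B,D,G,I,K][X,X,X]],R 0[A,B,C,D,E,K,L,M,N,U,F,G,H,I,J],Z[B,D,G,I,K][Z[B,D,H,I,K][Z[B,E,H,I,K][X,Z[B,D,F,L,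
  N][X,X]],X,Z[B,D,F,L,N][X,X]],R 0[A,B,C,D,E,F,I,J,G,H],X,Z[B,D,H,I,K][Z[B,E,G,I,K][X,Z[B,D,F,L,N][X,X]],X,
  X],R 0[A,B,C,D,E,F,I,J,G,H],Z[B,D,F,L,N][X,X,X]]], Z[A,F,K][Z[A,G,I,K][X,X,X],Z[A,F,L,N][X,X,X],Z[A,G,I,
  K][X,X,X]]]"

definition ext_cert8 :: "act list list" where "ext_cert8 =
  [[], [], [], [], [], [], [], [], [], [], [], [], [], [], [], [], [], [], [], [], [], [], [], [], [], [], [],
   [], [], [], [], [], [], [], [], [], [], [], [], [], [], [], [], [], [], [], [], [Y,S 0[A,D,E,B,C,H,I,F,G,J,
  L,K],Y], [], [], [], [], [], [Y,S 0[B,A,C,F,G,D,E,J,K,H,I],S 0[C,A,B,M,N,D,E,L,U,H,I,J,F,G,K],Y,Y,S 1[B,A,C,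
  F,G,D,E,J,K,H,I],S 0[B,A,C,F,G,D,E,J,K,H,I],S 2[H,J,L,D,I,F,K,A,E,B,G,C,M,U,N],S 0[H,J,L,D,I,F,K,A,E,B,G,C,
  M,U,N],S 2[J,H,L,F,K,D,I,B,G,A,E,C,M,U,N],S 0[J,H,L,F,K,D,I,B,G,A,E,C,M,U,N],S 2[L,H,J,M,U,D,I,C,N,A,E,B,F,
  K,G],S 1[C,A,B,M,N,D,E,L,U,H,I,J,F,G,K],S 0[C,A,B,M,N,D,E,L,U,H,I,J,F,G,K],S 0[L,H,J,M,U,D,I,C,N,A,E,B,F,K,
  G],Y,S 0[A,C,B,D,E,M,N,H,I,L,U,J,F,G,K],S 0[B,A,C,F,G,D,E,J,K,H,I],S 0[B,C,A,F,G,M,N,J,K,L,U,H,D,E,I],S 0[C,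
  A,B,M,N,D,E,L,U,H,I,J,F,G,K],S 0[C,B,A,M,N,F,G,L,U,J,K,H,D,E,I]], [Y,Y,S 1[B,A,C,F,G,D,E,J,K,H,I],S 0[B,A,C,
  F,G,D,E,J,K,H,I],Y,Y,S 1[B,A,C,F,G,D,E,J,K,H,I],S 0[B,A,C,F,G,D,E,J,K,H,I],Y], [S 0[A,B,C,D,E,F,G,H,I,J,K,L,
  M,N,U,Q,P]], [S 1[A,B,C,D,E,F,G,H,I,J,K,L,M,N,U,Q,P]], [], [S 3[A,B,C,D,E,F,G,H,I,J,K,L,M,N,U,Q,P]], [], [],
   [], [], [Y,Y,Y,S 0[A,C,B,E,D,L,M,K,N,J,H,F,G,I],S 0[A,D,E,B,C,H,I,F,G,J,L,K,N,M],S 0[A,E,D,C,B,K,N,L,M,J,F,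
  H,I,G],S 0[J,F,K,H,L,B,G,D,I,A,C,E,N,M],Y,S 1[J,H,L,F,K,D,I,B,G,A,E,C],S 0[J,H,L,F,K,D,I,B,G,A,E,C],S 2[J,H,
  L,F,K,D,I,B,G,A,E,C],S 1[J,K,F,L,H,E,N,C,M,A,D,B,G,I],S 1[J,L,H,K,F,C,M,E,N,A,B,D,I,G],S 0[A,C,B,E,D,L,M,K,
  N,J,H,F,G,I],S 0[A,E,D,C,B,K,N,L,M,J,F,H,I,G],Y,S 0[A,C,B,E,D,L,M,K,N,J,H,F,G,I]], [Y,S 0[B,A,C,F,G,D,E,J,K,
  H,I],Y,Y,Y,S 1[B,A,C,F,G,D,E,J,K,H,I],S 0[B,A,C,F,G,D,E,J,K,H,I],S 3[H,J,L,D,I,F,K,A,E,B,G,C],S 0[H,J,L,D,I,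
  F,K,A,E,B,G,C],S 3[J,H,L,F,K,D,I,B,G,A,E,C],S 0[J,H,L,F,K,D,I,B,G,A,E,C],S 2[H,J,L,D,I,F,K,A,E,B,G,C],Y,Y,Y,
  Y,S 1[B,A,C,F,G,D,E,J,K,H,I],S 0[B,A,C,F,G,D,E,J,K,H,I],S 0[H,J,L,D,I,F,K,A,E,B,G,C],S 0[J,H,L,F,K,D,I,B,G,
  A,E,C]], [Y,Y,Y,Y,Y,Y,Y,Y,Y,Y,Y,Y,S 16[A,B,C,D,E,F,G,H,I,J,K,L,M,P,Q,N,U],Y,Y,Y,Y,S 34[A,D,E,B,C,H,I,F,G,J,
  L,K,N,U,P,M],Y,S 17[A,B,C,D,E,F,G,H,I,J,K,L,M,N,P,U]], [Y,Y,Y,Y,Y,S 4[H,J,L,D,I,F,K,A,E,B,G,C],S 3[H,J,L,D,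
  I,F,K,A,E,B,G,C],S 2[H,J,L,D,I,F,K,A,E,B,G,C],Y,Y], [Y,S 0[B,A,C,F,G,D,E,J,K,H,I],Y,S 6[A,B,C,D,E,F,G,H,I,J,
  K,L,M,P,Q,N,U],S 6[B,A,C,F,G,D,E,J,K,H,I,L,M,P,Q,N,U],Y,S 0[B,A,C,F,G,D,E,J,K,H,I],Y,Y], [Y,Y,S 6[A,B,C,D,E,
  F,G,H,I,J,K,L,M,P,Q,N,U],S 13[A,B,C,D,E,F,G,H,I,J,K,L,M,P,Q,N,U],S 12[B,A,C,F,G,D,E,J,K,H,I,L,M,P,Q,N,U],Y,
  Y,S 6[H,J,L,D,I,F,K,A,E,B,G,C,M,P,Q,N,U],Y,Y], [], [], [], [], [], [], [], [], [], [], [], [], [], [], [],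
   [], [], [], [], [], [], [], [], [], [], [], [Y,S 53[U,N,J,A,Q,L,P,D,E,H,M,I,F,K,B,G,C],S 53[P,N,L,A,Q,J,U,
  B,C,F,K,G,H,M,D,I,E],S 0[B,A,C,F,G,D,E,J,K,H,I,N,U,L,M],S 53[M,L,H,B,Q,N,P,F,G,J,U,K,D,I,A,E,C],S 53[P,L,N,
  B,Q,H,M,A,C,D,I,E,J,U,F,K,G],S 53[C,B,A,L,Q,F,G,N,P,J,K,U,D,E,H,I,M],Y,S 54[C,A,B,N,Q,D,E,L,P,H,I,M,F,G,J,K,
  U],S 0[B,A,C,F,G,D,E,J,K,H,I,N,U,L,M],S 51[C,A,B,P,Q,D,E,L,N,H,I,M,F,G,J,K,U],S 1[D,A,E,H,I,B,C,L,M,F,G,N,P,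
  J,K,U],S 54[K,J,F,D,Q,N,U,H,I,L,P,M,B,G,A,C,E],S 54[U,J,N,D,Q,F,K,A,E,B,G,C,L,P,H,M,I],S 54[E,D,A,J,Q,H,I,N,
  U,L,M,P,B,C,F,G,K],S 0[A,D,E,B,C,H,I,F,G,L,M,J,K,N,P,U],S 54[E,A,D,N,Q,B,C,J,U,F,G,K,H,I,L,M,P],S 51[E,A,D,
  U,Q,B,C,J,N,F,G,K,H,I,L,M,P],S 0[D,A,E,H,I,B,C,L,M,F,G,N,P,J,K,U],S 1[F,B,G,J,K,A,C,N,U,D,E,L,P,H,I,M],
  S 54[I,H,D,F,Q,L,M,J,K,N,P,U,A,E,B,C,G],S 54[M,H,L,F,Q,D,I,B,G,A,E,C,N,P,J,U,K],S 54[G,F,B,H,Q,J,K,L,M,N,U,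
  P,A,C,D,E,I],S 0[B,F,G,A,C,J,K,D,E,N,U,H,I,L,P,M],S 54[G,B,F,L,Q,A,C,H,M,D,E,I,J,K,N,U,P],S 51[G,B,F,M,Q,A,
  C,H,L,D,E,I,J,K,N,U,P],S 0[F,B,G,J,K,A,C,N,U,D,E,L,P,H,I,M],S 54[K,F,J,H,Q,B,G,D,I,A,C,E,N,U,L,P,M],S 54[I,
  D,H,J,Q,A,E,F,K,B,C,G,L,M,N,P,U],S 51[I,D,H,K,Q,A,E,F,J,B,C,G,L,M,N,P,U],S 0[H,D,I,L,M,A,E,N,P,B,C,J,U,F,G,
  K],S 0[J,F,K,N,U,B,G,L,P,A,C,H,M,D,E,I]], [], [], [], [], [], [], [], [Y,S 1[C,B,A,U,P,F,G,I,Q,J,K,H,D,L,N,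
  M,E],S 0[B,A,C,F,G,D,E,J,K,H,I,L,N,M],S 1[C,A,B,U,P,D,E,K,Q,H,I,J,F,L,M,N,G],S 53[C,A,B,U,P,D,E,L,Q,H,I,M,F,
  G,J,K,N],S 51[A,C,B,D,E,U,P,H,I,M,Q,L,F,G,J,K,N],S 51[B,C,A,F,G,U,P,J,K,N,Q,L,D,E,H,I,M]], [S 61[A,U,P,D,E,
  J,Q,H,I,L,N,M,B,C,F,G,K],S 61[A,U,P,B,C,L,Q,F,G,J,N,K,D,E,H,I,M]], [], [], [], [], [], [], [], [], [], [],
   [], [], [], [], [], [], [], [], [], [], [], [], [], [], [], [], [], [], [], [], [], [], [], [], [], [], [],
   [], [], [], [], [], [], [], [], [], [], [], [], [], [], [], [], [], [], [], [], [], [], [], [], [], [], [],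
   [], [], [], [], [], [], [], [Y,Y,Y,S 2[D,H,I,A,E,F,J,B,C,G,M,U,K,N,L],Y,Y,Y,S 4[D,H,I,A,E,F,J,B,C,G,M,U,K,
  N,L],S 3[D,H,I,A,E,F,J,B,C,G,M,U,K,N,L],S 0[D,H,I,A,E,F,J,B,C,G,M,U,K,N,L],Y,Y,S 1[D,H,I,A,E,F,J,B,C,G,M,U,
  K,N,L],Y,S 1[D,H,I,A,E,F,J,B,C,G,M,U,K,N,L],S 30[I,M,U,D,H,K,N,A,E,C,L,B,P,F,J,G],S 32[A,D,E,C,B,I,H,K,L,M,
  U,N,P,F,G,J],Y,S 34[B,G,F,A,C,M,P,D,E,I,U,H,J,K,L,N],Y,S 67[B,A,C,G,F,D,E,U,P,I,H,M,K,L,N,J],S 32[C,K,L,A,B,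
  M,N,D,E,I,U,H,P,F,G,J],S 35[H,J,F,D,I,K,P,A,E,C,L,B,G,M,U,N],S 67[C,L,K,A,B,J,P,D,E,H,F,I,M,N,U,G],S 0[D,H,
  I,A,E,F,J,B,C,G,M,U,K,N,L]], [Y,S 0[B,A,C,F,G,D,E,H,J,I],Y,Y,Y,S 1[B,A,C,F,G,D,E,H,J,I],S 0[B,A,C,F,G,D,E,H,
  J,I],Y,Y,S 0[B,A,C,F,G,D,E,H,J,I],Y,Y,Y,Y,Y], [Y,Y,S 0[A,C,B,E,D,K,L,M,U,N,F,G,H,J,I],S 0[A,D,E,B,C,H,I,F,G,
  J,M,U,K,N,L],S 0[A,E,D,C,B,M,U,K,L,N,H,I,F,J,G],Y,Y,S 1[A,D,E,B,C,H,I,F,G,J,M,U,K,N,L],S 0[A,D,E,B,C,H,I,F,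
  G,J,M,U,K,N,L],Y,S 2[A,C,B,E,D,K,L,M,U,N,F,G,H,J,I],S 1[A,C,B,E,D,K,L,M,U,N,F,G,H,J,I],S 2[A,E,D,C,B,M,U,K,
  L,N,H,I,F,J,G],S 0[A,C,B,E,D,K,L,M,U,N,F,G,H,J,I],S 1[A,E,D,C,B,M,U,K,L,N,H,I,F,J,G],Y,S 52[A,B,C,E,D,F,G,M,
  U,N,P,K,L,H,I,J],S 67[B,C,A,F,G,K,L,U,P,M,N,E,D,H,I,J],S 67[E,D,A,M,U,H,I,G,P,F,J,B,C,K,L,N],S 51[A,B,C,E,D,
  G,F,M,U,N,P,K,L,H,I,J],S 66[B,C,A,G,F,K,L,U,P,M,N,E,D,H,I,J],S 0[A,C,B,E,D,K,L,M,U,N,F,G,H,J,I],S 67[D,E,A,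
  H,I,M,U,L,P,K,N,C,B,F,G,J],S 52[A,D,E,C,B,H,I,K,L,N,P,M,U,F,G,J],S 67[C,B,A,K,L,F,G,I,P,H,J,D,E,M,U,N],
  S 66[C,B,A,L,K,F,G,I,P,H,J,D,E,M,U,N],S 51[A,D,E,C,B,I,H,K,L,N,P,M,U,F,G,J],S 52[A,C,B,D,E,K,L,H,I,J,P,F,G,
  M,U,N],S 51[A,C,B,D,E,L,K,H,I,J,P,F,G,M,U,N],S 52[A,E,D,B,C,M,U,F,G,J,P,H,I,K,L,N],S 17[B,A,C,F,G,D,E,H,J,I,
  K,L,N,M,P,U],S 51[A,E,D,B,C,U,M,F,G,J,P,H,I,K,L,N]], [Y,Y,S 0[A,C,B,D,E,K,L,M,U,N,F,G,H,J,I],Y,Y,Y,Y,Y,Y,Y,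
  S 4[A,C,B,D,E,K,L,M,U,N,F,G,H,J,I],S 3[A,C,B,D,E,K,L,M,U,N,F,G,H,J,I],S 2[A,C,B,D,E,K,L,M,U,N,F,G,H,J,I],
  S 0[A,C,B,D,E,K,L,M,U,N,F,G,H,J,I],S 1[A,C,B,D,E,K,L,M,U,N,F,G,H,J,I],S 51[A,B,C,D,E,F,G,M,U,N,P,K,L,H,I,J],
  S 51[A,C,B,D,E,K,L,H,I,J,P,F,G,M,U,N]], [Y,S 0[B,A,C,F,G,D,E,H,J,I],S 93[A,C,B,D,E,K,L,U,Q,M,N,P,F,G,H,J,I],
  S 92[A,C,B,E,D,K,L,U,Q,M,N,P,F,G,H,J,I],S 93[B,C,A,F,G,K,L,U,Q,M,N,P,D,E,H,I,J],S 92[B,C,A,G,F,K,L,U,Q,M,N,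
  P,D,E,H,I,J],S 38[A,C,B,D,E,K,L,H,I,M,N,U,Q,P,F,G,J],S 39[B,C,A,F,G,K,L,H,J,M,N,I,D,U,P,Q,E],S 39[A,C,B,D,E,
  K,L,H,I,M,N,J,F,U,P,Q,G]], [], [], [S 39[B,C,A,F,G,K,L,H,J,M,N,I,D,U,Q,P,E]], [], [S 92[A,C,B,E,D,K,L,U,P,M,
  N,Q,F,G,H,J,I]], [], [], [], [], [Y,Y,S 0[A,C,B,D,E,K,L,H,I,M,F,G,J],Y,Y,Y,Y,Y,Y,Y,S 4[A,C,B,D,E,K,L,H,I,M,
  F,G,J],S 3[A,C,B,D,E,K,L,H,I,M,F,G,J],S 0[A,C,B,D,E,K,L,H,I,M,F,G,J],Y,S 51[B,C,A,N,P,K,L,I,U,H,M,D,E,F,G,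
  J],S 51[C,B,A,N,P,F,G,I,U,H,J,D,E,K,L,M]], [Y,Y], [Y,Y,S 0[A,C,B,D,E,K,L,H,I,M,F,G,J],Y,Y,Y,Y,Y,S 15[A,B,C,
  D,E,F,G,H,I,J,K,L,M,P,Q,N,U],S 13[B,A,C,F,G,D,E,H,J,I,K,L,M,P,Q,N,U],S 2[A,C,B,D,E,K,L,H,I,M,F,G,J],S 1[A,C,
  B,D,E,K,L,H,I,M,F,G,J],S 13[C,A,B,K,L,D,E,H,M,I,F,G,J,P,Q,N,U],Y], [Y,Y,S 0[A,C,B,D,E,K,L,H,I,M,F,G,J],Y,Y,
  Y,S 1[A,C,B,D,E,K,L,H,I,M,F,G,J],Y], [Y,Y,S 0[A,C,B,D,E,K,L,H,I,M,F,G,J],S 7[A,B,C,D,E,F,G,H,I,J,K,L,M,P,Q,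
  N,U],S 6[B,A,C,F,G,D,E,H,J,I,K,L,M,P,Q,N,U],Y,S 7[C,A,B,K,L,D,E,H,M,I,F,G,J,P,Q,N,U],Y], [], [], [], [], [],
   [], [], [], [], [Y,Y,Y,Y,Y,S 4[F,B,G,H,J,A,C,D,I,E,M,U,K,N,L],S 2[F,B,G,H,J,A,C,D,I,E,M,U,K,N,L],S 1[F,B,G,
  H,J,A,C,D,I,E,M,U,K,N,L],Y,S 1[F,B,G,H,J,A,C,D,I,E,M,U,K,N,L],S 2[A,B,C,K,L,F,G,M,N,U,D,E,H,I,J],S 1[A,B,C,
  K,L,F,G,M,N,U,D,E,H,I,J],S 2[F,B,G,M,U,A,C,K,N,L,H,J,D,I,E],S 0[A,B,C,K,L,F,G,M,N,U,D,E,H,I,J],S 1[F,B,G,M,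
  U,A,C,K,N,L,H,J,D,I,E]], [S 135[A,B,C,K,L,F,G,M,N,U,Q,P,D,E,H,I,J],S 135[A,D,E,K,L,H,I,M,N,U,Q,P,B,C,F,G,
  J]], [], [], [], [], [], [], [], [], [], [], [], [], [], [], [], [], [], [], [], []]"

definition kill_cert8 :: "cert list" where "kill_cert8 =
  [X, X, X, X, X, X, X, X, X, X, X, X, X, X, X, X, X, X, X, X, X, X, Z[C,E,F,H,N][X], Z[C,E,F,H,N,P][X], Z[B,
  D,J,L][X], Z[C,E,F,H,N][X,X], Z[B,E,H,J][X], Z[B,E,H,J,P][X], Z[C,E,F,H][X], Z[C,D,F,L][X], Z[C,E,F,H][X],
   Z[C,E,F,H,P][Z[C,E,F,I,P][X],X], Z[C,E,F,H,P][X], X, X, X, X, X, X, X, X, X, X, X, X, X, Z[A,F,H,M][X,X,X],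
   X, Z[B,D,J,M][X], X, Z[B,D,J,M][X], X, Z[A,F,H,U][X,X,X], X, Z[A,F,H,M][X], Z[C,D,F,L][X], Z[C,E,G,I,
  J][Z[C,E,F,H,U][X]], X, X, X, X, X, Z[C,E,F,H,U][Z[A,F,H,M,U][X,Z[B,D,J,M,U][X]],Z[C,E,F,H,P][Z[A,F,H,M,
  U][X,X],X,Z[C,D,G,J,P][Z[C,D,G,J,U][X],X]],Z[C,D,G,J,P][Z[C,D,G,J,U][X],X],Z[B,D,J,M,U][X,X,Z[C,D,G,J,
  U][X]]], X, X, X, X, X, X, Z[C,E,F,H,N][X,Z[A,F,I,L,N][X,X],Z[C,D,G,J,U][X,X],X], Z[C,E,F,H,N][Z[B,D,J,L,
  N][Z[B,D,K,L,N][X],Z[B,D,J,M,N][X]]], Z[A,F,H][X], Z[A,F,H,N][X,X], Z[B,D,J,L][X,X,Z[B,D,K,L][X]], Z[A,F,H,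
  N,P][X,X,X], Z[A,F,H,N][X,X], Z[C,E,F,H][Z[C,E,G,H,J][X]], Z[C,E,F,H][Z[C,D,F,L][X]], Z[C,E,F,H][Z[C,E,G,H,
  J][X]], Z[C,E,F,H,P][Z[C,D,F,L][X],X], Z[C,E,F,H][Z[C,D,F,L][X]], Z[C,E,F,H,P][Z[C,E,G,H,J,P][X],X], Z[C,E,
  F,H,P][Z[A,G,H,J,N][X,X]], Z[A,F,H][X], Z[A,F,H][X], Z[A,F,H,P][X,X], Z[A,F,H,P][X,X], Z[A,F,H][X], Z[A,G,I,
  J,L][X,Z[A,F,I,L,N][X,X],R 0[A,D,E,B,C,H,I,F,G,L,M,J,K,P,Q,N,U],Z[A,G,I,K,L][X,Z[A,F,I,L,N][X,X]]], Z[A,G,H,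
  J][X,X], Z[A,F,H,N][X,X], Z[B,D,J,L,N][Z[C,D,G,J,L][X],Z[A,G,H,J,P][X,X],Z[A,F,H,N,P][X,X],Z[C,D,G,K,L][Z[C,
  D,F,M,N][Z[C,D,G,J,M][X],X],R 3[A,B,C,D,E,F,G,H,I,K,J]],R 0[A,B,C,D,E,G,F,H,I,N,U,L,M,J,K]], Z[C,E,G,H,
  J][Z[C,E,G,H,K][Z[C,E,F,H,N][X],Z[C,D,G,J,L][Z[A,G,H,J,P][X],Z[C,E,F,H,N][X]]],Z[C,E,F,H,N][X],Z[C,E,G,H,
  K][R 1[A,B,C,D,E,F,G,H,I,K,J]]], Z[A,G,H,J,P][X,Z[A,G,H,K,P][X],Z[A,G,H,J,Q][X]], Z[A,G,H,J][X,X], Z[B,D,J,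
  L][X,X], Z[B,D,J,L][Z[A,G,H,J,P][X,X],R 0[A,D,E,B,C,H,I,F,G,L,M,J,K,P,Q,N,U],Z[C,D,F,L,N][X,Z[B,D,K,L,N][X],
  X]], Z[B,D,J,L,P][Z[A,G,H,J,P][Z[A,G,I,J,L][X],X,Z[A,G,I,J,L][X]],R 0[A,B,C,D,E,F,G,I,H,J,K,P,Q,N,U,L,M],
  Z[B,E,I,J,L][X],Z[A,G,I,J,M][Z[A,G,H,J,P][X],Z[A,G,H,J,P][X,Z[B,E,I,J,M][X]]],R 0[A,B,C,D,E,F,G,I,H,J,K,P,Q,
  N,U,L,M]], Z[B,E,H,J][Z[A,F,H,N][X,X],Z[A,F,H,N][X]], Z[B,E,H,J][Z[B,E,H,K,N][X,X],Z[B,E,I,J,L][X]], Z[B,D,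
  J,L][Z[C,D,G,J,L][X],X,Z[B,D,J,M][X]], Z[C,E,G,H,J][Z[C,E,F,H,N][Z[C,E,F,H,U][X,Z[A,F,H,N,P][X]],Z[C,D,G,J,
  L][X],Z[C,E,F,H,U][Z[A,F,H,U,P][X]]],R 0[B,A,C,F,G,D,E,J,K,H,I,N,U,L,M],Z[C,D,F,L,N][Z[C,D,F,M,N][X],Z[C,D,
  F,L,U][X]]], Z[A,F,H,N][Z[B,E,H,J,P][X],X,Z[A,G,H,J][X]], Z[C,D,F,L][X], Z[A,G,H,J][X], Z[B,E,H,J,U][Z[A,G,
  H,J,U][Z[C,D,F,L,U][Z[A,F,I,L,U][X],X],Z[C,D,F,L,U][X]],Z[B,D,K,L,U][R 0[],Z[A,G,H,J,U][X,Z[A,F,I,L,U][X]],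
  Z[A,F,H,N,U][Z[C,D,F,L,U][X],Z[B,D,K,L,P][X]],Z[A,F,H,N,U][X]],Z[C,D,F,L,U][Z[B,D,J,M,U][X,Z[A,F,H,N,U][X]],
  Z[B,E,H,J,P][X],Z[B,E,H,J,P][X]],R 12[D,H,I,A,E,L,M,B,C,J,N,F,G,K],R 12[F,J,K,B,G,L,N,A,C,H,M,D,E,I]], Z[C,
  E,F,H,N][X], Z[C,E,F,H,N,P][X], Z[C,E,F,H,N][Z[C,E,G,H,J,N][X],Z[C,E,F,H,U,P][X]], Z[B,E,H,J][X,X], Z[C,E,F,
  H,N,P][Z[C,E,F,I,N,P][X],X], Z[C,E,F,H,N][X,X], Z[C,D,F,L][X], Z[B,D,J,L][X,X], Z[C,D,F,L,P][X], Z[C,E,F,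
  H][X], Z[C,D,F,L][X], Z[C,E,F,H,P][Z[C,E,F,I,P][X],X], Z[C,E,F,H,P][X], Z[C,E,G,H,J][Z[C,E,G,H,K][Z[C,E,F,H,
  N][X],Z[A,G,H,J,L][X]],Z[C,E,F,H,N][X],Z[C,E,G,H,K][Z[A,G,H,K,L][X]]], Z[C,D,G,J,L][Z[C,E,G,H,J,P][X,X],Z[C,
  D,F,L,N][X],Z[C,D,G,K,L][Z[C,D,F,L,N][X,X]]], Z[C,E,G,H,J][Z[C,D,G,J,L][X],Z[C,E,F,H,N][X],Z[C,E,G,I,J][Z[C,
  E,F,H,N][X]]], Z[A,G,H,J,L][Z[A,F,H,L,N][Z[A,G,I,J,L][X],X],Z[A,F,H,L,N][Z[A,G,H,J,M][X],X],Z[C,E,G,H,K,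
  P][Z[A,G,H,K,L][X],X],R 0[A,B,C,E,D,F,G,L,M,J,K,H,I]], X, X, X, X, X, X, X, X, X, X, X, X, X, X, X, X, X,
   Z[A,F,H,L][Z[A,G,H,J,L][X,X],Z[A,F,H,M,N][X,X]], Z[A,F,H,L,P][Z[B,E,H,J,L][Z[B,D,J,L,P][X,X],Z[B,E,I,J,
  L][X],Z[B,E,H,K,L][Z[B,D,K,L,P][X]]],R 0[A,B,C,E,D,F,G,P,Q,J,K,L,M,N,U,H,I],R 0[A,C,B,D,E,L,M,H,I,N,U,F,G,J,
  K],R 0[A,C,B,E,D,L,M,P,Q,N,U,F,G,J,K,H,I]], Z[B,D,J,L][Z[C,D,F,N][X,X],Z[C,D,F,N][X]], Z[A,F,H,L][Z[A,G,H,J,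
  L][X,X],Z[A,F,H,M,N][X,X]], X, X, X, X, X, Z[C,D,F,M,U][Z[A,G,H,K,U][X,Z[A,F,I,K,U][X]],X,Z[C,D,F,M,P][Z[A,
  G,H,K,U][X],X,X],Z[C,D,F,N,U][X]], X, X, Z[C,D,F,U][Z[C,D,F,P][X,X],X,X], X, X, X, X, X, Z[C,D,F,U][Z[C,D,F,
  P][X,X],X,X], X, X, X, X, Z[C,E,G,H,U][Z[B,E,H,K,U][X,Z[C,E,F,I,P][X]],Z[C,D,F,M,U][X,Z[C,E,G,H,P][X]],Z[C,
  E,F,I,U][Z[C,D,F,M,U][X],Z[C,E,G,H,P][Z[B,E,H,K,U][X],Z[C,D,F,M,U][X]]],Z[C,E,F,I,U][Z[C,E,F,I,P][X]]], X,
   Z[C,D,F,M][X], X, X, Z[C,E,G,H,U][Z[B,E,H,K,U][X,X],Z[C,E,G,H,P][R 0[A,B,C,D,E,F,G,H,I,J,K,L,M,N,P,U],Z[C,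
  E,G,H,Q][Z[A,G,H,K,U][X],Z[C,D,F,M,U][X]],Z[C,D,F,M,U][X]],R 0[B,A,C,F,G,D,E,H,J,I],Z[C,D,F,M,U][X,X]], X,
   X, X, X, Z[C,E,F,I,U][X], X, Z[C,E,F,I,U][Z[A,F,I,K,U][X,Z[A,F,I,K,P][X]],Z[C,E,F,I,P][R 0[A,B,C,D,E,F,G,H,
  I,J,K,L,M,N,P,U],X,R 0[D,H,I,A,E,F,J,B,C,G,M,N,K,L,P,U]],Z[C,E,G,I,J,U][R 0[]],Z[C,D,F,M,U][X,Z[A,F,I,K,
  P][X]]], X, X, Z[B,E,H,K][X], X, Z[C,D,F,M][X,X], Z[B,E,H,L,M][Z[A,G,H,L,M][Z[A,F,I,L,M][X],X],X,Z[A,F,I,L,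
  M][X]], Z[B,E,H,K][X], Z[A,F,I,K][Z[A,F,I,L,M][X]], Z[B,E,H,K][X], Z[B,E,H,K][X], Z[C,D,F,M][X,X], Z[C,D,F,
  M][X,X], Z[A,G,H,K][X], Z[C,D,F,M,U][Z[B,E,H,K,U][Z[A,F,I,K,U][X],Z[A,F,I,K,U][X]],Z[B,E,H,K,U][X,Z[B,E,H,K,
  P][X,Z[A,F,I,K,U][X],Z[A,G,H,K,U][X]],Z[A,F,I,K,U][X],Z[B,E,H,K,P][X,Z[A,G,H,K,P][X],X]],Z[B,E,H,K,U][X,Z[B,
  E,H,K,P][X]],R 2[B,A,C,F,G,D,E,H,J,I],Z[A,G,H,K,U][X,Z[B,E,H,K,P][X]],Z[C,D,F,N,U][Z[B,E,H,K,U][X,Z[A,G,H,K,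
  U][X],X],Z[B,E,H,K,U][X],R 1[B,A,C,F,G,D,E,H,J,I],Z[A,G,H,K,U][X]]], X, X, X, X, X, Z[C,D,F,M,N][X,X,X,Z[A,
  F,I,K,N][X]], X, Z[A,G,H,U][X,Z[A,G,H,P][X,X],X], X, Z[C,D,F,K,M,U][Z[B,E,H,K,U][Z[B,D,J,K,U][X]],X,X,Z[C,D,
  F,L,M,U][X,X],R 0[B,A,C,F,G,D,E,H,J,I,M,N,K,L]], X, X, X, Z[A,F,I,U][X,X,Z[A,F,I,P][X,X]], X, Z[C,D,F,L,
  M][X], Z[C,D,F,L,M][X], X, Z[B,D,J,K][X], X, X, X, X, X, Z[C,D,F,K,U][Z[B,E,H,K,U][Z[C,D,F,K,P][X]],X,Z[B,E,
  H,K,P][X,Z[B,E,H,K,U][X]],Z[C,D,F,L,M,U][X,Z[B,E,H,K,P][X]]], Z[C,D,F,L,N][Z[B,E,H,L,N][Z[A,G,H,L,N][X],Z[A,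
  G,H,L,N][Z[A,F,I,L,N][X],X],X,Z[A,F,I,L,N][X]],Z[B,E,H,L,N][Z[A,G,H,L,N][X],Z[A,F,I,L,N][X,Z[A,G,H,L,N][X]],
  Z[A,F,I,L,N][X],Z[C,D,F,L,U][X,X]],Z[A,G,H,K,P][Z[B,E,H,K,P][X],X],Z[B,E,H,L,N][Z[A,G,H,L,N][X],Z[A,F,I,L,
  N][X],X],Z[B,E,H,K,P][Z[A,G,H,K,P][X],X],R 2[B,A,C,F,G,D,E,H,J,I]], Z[C,D,F,K][Z[B,E,H,K][X],X,X], Z[C,D,F,
  K][Z[B,E,H,K,P][X,X],X,X], Z[A,G,H,K][X,Z[C,D,F,K,P][X,X],X], X, X, X, X, X, X, X]"

definition ext_cert9 :: "act list list" where "ext_cert9 =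
  [[], [], [], [], [], [], [], [], [], [], [], [], [], [], [], [], [], [], [], [], [], [], [], [], [], [], [],
   [], [], [], [], [], [], [], [], [], [], [], [], [], [], [], [], [], [], [], [], [], [], [], [], [], [], [],
   [], [], [], [], [], [], [], [], [], [Y,Y,S 0[G,B,F,N,P,C,A,K,M,L,H,J,I,D,U,E],Y,S 1[F,B,G,H,J,A,C,D,I,E,N,
  P,M,K,U,L],S 1[C,B,A,K,L,G,F,N,M,P,D,E,I,H,U,J],S 0[C,B,A,K,L,G,F,N,M,P,D,E,I,H,U,J]], [], [], [], [], [],
   [], [], [], [], [], [], [], [], [], [], [], [], [], [], [], [], [], [], [], [], [], [], [], [], [], [], [Y,
  Y], [], [Y,S 0[B,A,C,F,G,D,E,J,K,H,I,L,M,N,P,U],Y,Y,S 1[B,A,C,F,G,D,E,J,K,H,I,L,M,N,P,U],S 0[B,A,C,F,G,D,E,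
  J,K,H,I,L,M,N,P,U],Y,S 7[U,E,N,L,Q,D,A,H,J,I,G,P,F,B,K,C,M],S 7[P,G,N,L,Q,F,B,J,H,K,E,U,D,A,I,C,M],Y,Y,
  S 0[B,A,C,F,G,D,E,J,K,H,I,L,M,N,P,U]], [S 6[A,B,C,D,E,F,G,H,I,J,K,L,M,U,N,Q,P]], [], [], [], [], [], [], [],
   [], [], [], [], [], [], [Y,Y,S 3[L,M,C,H,J,N,U,D,I,E,P,A,B,F,K,Q,G],Y,Y,S 5[A,B,C,D,E,F,G,H,I,J,K,L,M,N,P,
  Q,U],Y,S 5[A,B,C,D,E,F,G,H,I,J,K,L,M,P,N,Q,U],S 1[L,M,C,H,J,N,U,D,I,E,P,A,B,F,G,K],S 4[L,M,C,H,J,N,U,D,I,E,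
  P,A,B,F,G,K],S 2[L,M,C,H,J,N,U,D,I,E,P,A,B,F,G,K],S 5[C,M,L,B,A,U,N,F,G,K,Q,J,H,E,D,P,I],S 13[A,C,B,E,D,M,L,
  N,P,U,F,G,K,J,Q,H,I]], [Y,Y,S 13[C,B,A,M,L,F,G,N,U,P,Q,D,E,H,J,I,K]], [], [], [], [], [], [], [Y,S 0[B,A,C,
  F,G,D,E,J,K,H,I,L,M,U,N],Y,S 1[D,A,E,H,I,B,C,J,L,F,G,K,N,U,M],S 0[A,D,E,B,C,H,I,F,G,J,L,K,N,M],S 1[F,B,G,J,
  K,A,C,H,L,D,E,I,U,N,M],S 0[B,F,G,A,C,J,K,D,E,H,L,I,U,M,N],S 1[H,D,I,J,L,A,E,F,K,B,C,G,U,M,N],S 0[D,H,I,A,E,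
  J,L,B,C,F,K,G,U,N,M],S 1[J,H,L,F,K,D,I,B,G,A,E,C],S 0[J,F,K,H,L,B,G,D,I,A,C,E,N,M],S 0[J,H,L,F,K,D,I,B,G,A,
  E,C],Y,S 0[A,D,E,B,C,H,I,F,G,J,L,K,N,M],S 0[B,F,G,A,C,J,K,D,E,H,L,I,U,M,N],Y,S 0[B,A,C,F,G,D,E,J,K,H,I,L,M,
  U,N],S 0[D,A,E,H,I,B,C,J,L,F,G,K,N,U,M],Y], [S 11[A,C,B,E,D,L,M,K,N,J,H,F,G,U,P,Q,I],S 17[A,B,C,D,E,F,G,H,I,
  J,K,L,M,U,Q,P,N],S 11[J,K,F,L,H,E,N,C,M,A,D,B,G,U,P,Q,I],Y,S 18[J,F,K,H,L,B,G,D,I,A,C,E,N,U,Q,P,M],S 9[B,A,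
  C,F,G,D,E,J,K,H,I,L,M,U,Q,P,N],S 9[F,J,K,B,G,H,L,A,C,D,I,E,N,U,Q,P,M]], [S 20[A,E,D,C,B,K,N,L,M,J,F,H,I,U,P,
  Q,G]], [Y], [], [], [], [], [], [], [Y,S 2[D,A,E,H,I,B,C,J,L,F,G,K,P,Q,M,N,U],S 18[F,B,G,J,K,C,A,L,H,M,N,U,
  Q,E,P,D,I],S 18[D,A,E,H,I,B,C,J,L,F,G,K,P,N,Q,M,U],S 0[J,H,L,F,K,D,I,B,G,A,E,C,M,U,N],S 12[E,P,K,D,A,M,Q,H,
  I,L,U,J,F,B,G,C,N],S 23[A,E,D,C,B,P,K,N,M,Q,H,I,L,J,U,F,G],S 23[E,K,P,A,D,F,J,B,C,G,U,Q,M,L,N,H,I]], [], [],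
   [], [], []]"

definition kill_cert9 :: "cert list" where "kill_cert9 =
  [X, X, X, X, X, X, X, X, X, X, X, X, X, X, X, X, Z[A,F,I,K,N][X,X], X, X, X, X, X, X, X, X, X, Z[B,D,J,K,
  N][X], X, X, X, X, X, X, X, X, X, Z[B,E,H,K,U][X], Z[B,D,J,K][X], X, X, Z[C,E,G,H,M][X], X, X, X, X, X, X,
   Z[B,E,I,J,K][Z[B,E,H,K,P][X,X],X], Z[C,E,G,H,N][Z[C,D,G,J,M][X],X], Z[C,D,F,M][X], Z[B,E,H,K][X], Z[B,E,H,
  K,P][X], X, X, X, Z[A,F,I,L,M][X], X, X, X, X, X, X, X, X, X, Z[A,F,I,K,P][X,X], Z[B,E,H,L,M][X], X, Z[C,E,
  G,H,M][X], X, Z[B,E,I,J,K][X], X, Z[B,E,I,J,K][X], X, Z[A,F,I,L,U][X], Z[A,F,H,N,Q][X,X], X, X, X, Z[C,D,G,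
  J,N][X], X, Z[B,D,K,L,N][X], X, X, X, X, X, X, X, Z[C,E,F,H,N][Z[C,D,G,J,P][X]], Z[C,E,F,H,N][X], X, X, X,
   Z[A,F,I,L,N][X], X, X, Z[C,E,G,I,J][X], X, Z[A,F,I,L,N][X,X], Z[C,E,F,H,P][X], Z[C,E,G,H,K][Z[B,D,K,L,
  N][X]], X, X, X, Z[C,E,G,I,J][Z[C,E,F,H,P][X]], X, X, Z[C,E,F,H,P][X], X, X, X, X, X, Z[A,F,H,M,P][Z[C,E,F,
  H,N][X],X,Z[C,D,G,J,N][X]], X, X, X, X, X, X, X, X, X, Z[C,E,F,H,U][Z[B,D,K,L,P][X,X],Z[B,D,K,L,P][X,X],
  R 0[J,L,H,K,F,C,M,E,N,A,B,D,I,G],R 0[J,K,F,L,H,E,N,C,M,A,D,B,G,I]], Z[A,F,I,L,M][X], Z[B,E,I,J,M][X], X,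
   Z[A,F,H,N,U][X,X], Z[B,D,J,M][X], X, X, X, X, X, X]"

definition ext_cert10 :: "act list list" where "ext_cert10 =
  [[], [], [], [Y,S 0[B,A,C,F,G,D,E,J,K,H,I,L,M,U,N],S 0[C,A,B,L,M,E,D,J,H,K,N,F,G,U,I],S 0[D,A,E,H,I,B,C,J,L,
  F,G,K,N,U,M],S 0[E,A,D,K,N,C,B,J,F,L,M,H,I,U,G],S 0[F,B,G,J,K,A,C,H,L,D,E,I,U,N,M],S 0[G,B,F,I,U,C,A,H,D,L,
  M,J,K,N,E],S 0[H,D,I,J,L,A,E,F,K,B,C,G,U,M,N],S 0[I,D,H,G,U,E,A,F,B,K,N,J,L,M,C],S 0[J,H,L,F,K,D,I,B,G,A,E,
  C],S 0[K,E,N,F,J,D,A,G,B,I,H,U,M,L,C],S 0[L,C,M,H,J,B,A,I,D,G,F,U,N,K,E],S 0[M,C,L,N,U,B,A,K,E,F,G,J,H,I,D],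
  S 0[N,E,K,M,U,D,A,L,C,H,I,J,F,G,B],S 0[U,G,I,M,N,F,B,L,C,J,K,H,D,E,A]], [Y,S 0[J,H,L,F,K,D,I,B,G,A,E,C],
  S 0[A,C,B,E,D,L,M,K,N,J,H,F,G,I,P,U],S 0[A,E,D,C,B,K,N,L,M,J,F,H,I,G,P,U],Y], [], [], [], [], [], [], [],
   [], [], [], [], [], [], [], [], [], [], [], [], [], []]"

definition kill_cert10 :: "cert list" where "kill_cert10 =
  [X, X, X, X, X, X, X, X, X, X, X, X, X, X, X, X, X, X, X, X, X, X, X, X, X, X]"

definition ext_cert11 :: "act list list" where "ext_cert11 =
  [[], [], []]"

definition kill_cert11 :: "cert list" where "kill_cert11 =
  [X, X]"

text \<open>The order of the triangles and of their corners is the one in which the enumeration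
  produces them, latest triangle first, because this list is matched literally with the head of the
  systems having 11 triangles. Every vertex lies in two of the triangles except \<open>Q\<close>,
  which lies in one.\<close>

definition triangles17 :: "(vertex \<times> vertex \<times> vertex) list" where
  "triangles17 = [(U,P,Q), (M,N,P), (G,I,U), (E,K,N), (C,L,M), (H,J,L), (F,J,K), (D,H,I), (B,F,G), (A,D,E), (A,B,C)]"

text \<open>The 33 edges of the triangles and the two forced edges \<open>A\<close> \<open>Q\<close>
  and \<open>J\<close> \<open>Q\<close>. Inside a row the order is that left by the successive
  insertions, so the later comparison is an identity of terms.\<close>

definition row17 :: "vertex list vec" where
  "row17 = V [Q,D,E,B,C] [F,G,A,C] [L,M,B,A] [H,I,A,E] [K,N,D,A] [J,K,B,G] [I,U,F,B] [J,L,D,I] [G,U,H,D]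
    [Q,H,L,F,K] [E,N,J,F] [C,M,J,H] [N,P,L,C] [M,P,K,E] [P,Q,I,G] [U,Q,N,M] [J,A,P,U]"

text \<open>Candidates for the zeros of a colouring. Both sets meet all triangles of
  \<open>triangles17\<close>. The only pair of \<open>zeros1\<close> that could still be an edge is
  \<open>A\<close> \<open>Q\<close>; once this edge is present, \<open>zeros2\<close> leaves only
  \<open>J\<close> \<open>Q\<close>.\<close>

definition zeros1 :: "vertex list" where "zeros1 = [A,F,I,L,N,Q]"
definition zeros2 :: "vertex list" where "zeros2 = [C,D,G,J,N,Q]"

hide_const (open) A B C D E F G H I J K L M N U P Q V Y S X Z R

section \<open>The checkers\<close>

type_synonym tri = "vertex \<times> vertex \<times> vertex"
type_synonym edge = "vertex \<times> vertex"

section \<open>Tables indexed by the seventeen vertices\<close>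

fun get :: "'a vec \<Rightarrow> vertex \<Rightarrow> 'a" where
  "get (vec.V x0 _ _ _ _ _ _ _ _ _ _ _ _ _ _ _ _) vertex.A = x0"
| "get (vec.V _ x1 _ _ _ _ _ _ _ _ _ _ _ _ _ _ _) vertex.B = x1"
| "get (vec.V _ _ x2 _ _ _ _ _ _ _ _ _ _ _ _ _ _) vertex.C = x2"
| "get (vec.V _ _ _ x3 _ _ _ _ _ _ _ _ _ _ _ _ _) vertex.D = x3"
| "get (vec.V _ _ _ _ x4 _ _ _ _ _ _ _ _ _ _ _ _) vertex.E = x4"
| "get (vec.V _ _ _ _ _ x5 _ _ _ _ _ _ _ _ _ _ _) vertex.F = x5"
| "get (vec.V _ _ _ _ _ _ x6 _ _ _ _ _ _ _ _ _ _) vertex.G = x6"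
| "get (vec.V _ _ _ _ _ _ _ x7 _ _ _ _ _ _ _ _ _) vertex.H = x7"
| "get (vec.V _ _ _ _ _ _ _ _ x8 _ _ _ _ _ _ _ _) vertex.I = x8"
| "get (vec.V _ _ _ _ _ _ _ _ _ x9 _ _ _ _ _ _ _) vertex.J = x9"
| "get (vec.V _ _ _ _ _ _ _ _ _ _ x10 _ _ _ _ _ _) vertex.K = x10"
| "get (vec.V _ _ _ _ _ _ _ _ _ _ _ x11 _ _ _ _ _) vertex.L = x11"
| "get (vec.V _ _ _ _ _ _ _ _ _ _ _ _ x12 _ _ _ _) vertex.M = x12"
| "get (vec.V _ _ _ _ _ _ _ _ _ _ _ _ _ x13 _ _ _) vertex.N = x13"
| "get (vec.V _ _ _ _ _ _ _ _ _ _ _ _ _ _ x14 _ _) vertex.U = x14"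
| "get (vec.V _ _ _ _ _ _ _ _ _ _ _ _ _ _ _ x15 _) vertex.P = x15"
| "get (vec.V _ _ _ _ _ _ _ _ _ _ _ _ _ _ _ _ x16) vertex.Q = x16"

fun put :: "'a vec \<Rightarrow> vertex \<Rightarrow> 'a \<Rightarrow> 'a vec" where
  "put (vec.V _ x1 x2 x3 x4 x5 x6 x7 x8 x9 x10 x11 x12 x13 x14 x15 x16) vertex.A y = vec.V y x1 x2 x3 x4 x5 x6 x7 x8 x9 x10 x11 x12 x13 x14 x15 x16"
| "put (vec.V x0 _ x2 x3 x4 x5 x6 x7 x8 x9 x10 x11 x12 x13 x14 x15 x16) vertex.B y = vec.V x0 y x2 x3 x4 x5 x6 x7 x8 x9 x10 x11 x12 x13 x14 x15 x16"
| "put (vec.V x0 x1 _ x3 x4 x5 x6 x7 x8 x9 x10 x11 x12 x13 x14 x15 x16) vertex.C y = vec.V x0 x1 y x3 x4 x5 x6 x7 x8 x9 x10 x11 x12 x13 x14 x15 x16"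
| "put (vec.V x0 x1 x2 _ x4 x5 x6 x7 x8 x9 x10 x11 x12 x13 x14 x15 x16) vertex.D y = vec.V x0 x1 x2 y x4 x5 x6 x7 x8 x9 x10 x11 x12 x13 x14 x15 x16"
| "put (vec.V x0 x1 x2 x3 _ x5 x6 x7 x8 x9 x10 x11 x12 x13 x14 x15 x16) vertex.E y = vec.V x0 x1 x2 x3 y x5 x6 x7 x8 x9 x10 x11 x12 x13 x14 x15 x16"
| "put (vec.V x0 x1 x2 x3 x4 _ x6 x7 x8 x9 x10 x11 x12 x13 x14 x15 x16) vertex.F y = vec.V x0 x1 x2 x3 x4 y x6 x7 x8 x9 x10 x11 x12 x13 x14 x15 x16"
| "put (vec.V x0 x1 x2 x3 x4 x5 _ x7 x8 x9 x10 x11 x12 x13 x14 x15 x16) vertex.G y = vec.V x0 x1 x2 x3 x4 x5 y x7 x8 x9 x10 x11 x12 x13 x14 x15 x16"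
| "put (vec.V x0 x1 x2 x3 x4 x5 x6 _ x8 x9 x10 x11 x12 x13 x14 x15 x16) vertex.H y = vec.V x0 x1 x2 x3 x4 x5 x6 y x8 x9 x10 x11 x12 x13 x14 x15 x16"
| "put (vec.V x0 x1 x2 x3 x4 x5 x6 x7 _ x9 x10 x11 x12 x13 x14 x15 x16) vertex.I y = vec.V x0 x1 x2 x3 x4 x5 x6 x7 y x9 x10 x11 x12 x13 x14 x15 x16"
| "put (vec.V x0 x1 x2 x3 x4 x5 x6 x7 x8 _ x10 x11 x12 x13 x14 x15 x16) vertex.J y = vec.V x0 x1 x2 x3 x4 x5 x6 x7 x8 y x10 x11 x12 x13 x14 x15 x16"
| "put (vec.V x0 x1 x2 x3 x4 x5 x6 x7 x8 x9 _ x11 x12 x13 x14 x15 x16) vertex.K y = vec.V x0 x1 x2 x3 x4 x5 x6 x7 x8 x9 y x11 x12 x13 x14 x15 x16"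
| "put (vec.V x0 x1 x2 x3 x4 x5 x6 x7 x8 x9 x10 _ x12 x13 x14 x15 x16) vertex.L y = vec.V x0 x1 x2 x3 x4 x5 x6 x7 x8 x9 x10 y x12 x13 x14 x15 x16"
| "put (vec.V x0 x1 x2 x3 x4 x5 x6 x7 x8 x9 x10 x11 _ x13 x14 x15 x16) vertex.M y = vec.V x0 x1 x2 x3 x4 x5 x6 x7 x8 x9 x10 x11 y x13 x14 x15 x16"
| "put (vec.V x0 x1 x2 x3 x4 x5 x6 x7 x8 x9 x10 x11 x12 _ x14 x15 x16) vertex.N y = vec.V x0 x1 x2 x3 x4 x5 x6 x7 x8 x9 x10 x11 x12 y x14 x15 x16"
| "put (vec.V x0 x1 x2 x3 x4 x5 x6 x7 x8 x9 x10 x11 x12 x13 _ x15 x16) vertex.U y = vec.V x0 x1 x2 x3 x4 x5 x6 x7 x8 x9 x10 x11 x12 x13 y x15 x16"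
| "put (vec.V x0 x1 x2 x3 x4 x5 x6 x7 x8 x9 x10 x11 x12 x13 x14 _ x16) vertex.P y = vec.V x0 x1 x2 x3 x4 x5 x6 x7 x8 x9 x10 x11 x12 x13 x14 y x16"
| "put (vec.V x0 x1 x2 x3 x4 x5 x6 x7 x8 x9 x10 x11 x12 x13 x14 x15 _) vertex.Q y = vec.V x0 x1 x2 x3 x4 x5 x6 x7 x8 x9 x10 x11 x12 x13 x14 x15 y"

fun entries :: "'a vec \<Rightarrow> 'a list" where
  "entries (vec.V x0 x1 x2 x3 x4 x5 x6 x7 x8 x9 x10 x11 x12 x13 x14 x15 x16) = [x0,x1,x2,x3,x4,x5,x6,x7,x8,x9,x10,x11,x12,x13,x14,x15,x16]"

definition const :: "'a \<Rightarrow> 'a vec" where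
  "const x = vec.V x x x x x x x x x x x x x x x x x"

fun assign :: "'a list \<Rightarrow> vertex list \<Rightarrow> 'a vec \<Rightarrow> 'a vec" where
  "assign [] us v = v"
| "assign (x # xs) [] v = v"
| "assign (x # xs) (u # us) v = assign xs us (put v u x)"

text \<open>The inner \<open>assign\<close> builds the identity table, so a certificate has to list
  the images of an initial segment of \<open>vertices\<close> only; the remaining vertices stay
  fixed. Whether the result is a bijection is tested where it is used.\<close>

definition perm :: "vertex list \<Rightarrow> vertex vec" where
  "perm xs = assign xs vertices (assign vertices vertices (const vertex.A))"

definition push :: "'a list vec \<Rightarrow> vertex \<Rightarrow> 'a \<Rightarrow> 'a list vec" where
  "push v x y = put v x (y # get v x)"

fun triangle_rows :: "tri list \<Rightarrow> edge list vec" where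
  "triangle_rows [] = const []"
| "triangle_rows ((a,b,c) # T) = push (push (push (triangle_rows T) a (b,c)) b (a,c)) c (a,b)"

definition add_edge :: "vertex \<Rightarrow> vertex \<Rightarrow> vertex list vec \<Rightarrow> vertex list vec" where
  "add_edge a b v = push (push v a b) b a"

fun neighbour_rows :: "tri list \<Rightarrow> vertex list vec" where
  "neighbour_rows [] = const []"
| "neighbour_rows ((a,b,c) # T) = add_edge a b (add_edge b c (add_edge a c (neighbour_rows T)))"

fun mark :: "vertex list \<Rightarrow> bool vec \<Rightarrow> bool vec" where
  "mark [] v = v"
| "mark (x # xs) v = mark xs (put v x True)"

fun marks :: "vertex list vec \<Rightarrow> vertex list \<Rightarrow> bool vec \<Rightarrow> bool vec" where
  "marks nr [] v = v"
| "marks nr (y # ys) v = marks nr ys (mark (get nr y) v)"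

fun touch :: "vertex list \<Rightarrow> bool vec \<Rightarrow> bool" where
  "touch [] v = False"
| "touch (x # xs) v = (if get v x then True else touch xs v)"

text \<open>The ends of walks of one or two steps. With symmetric rows, \<open>x\<close> itself
  belongs to them as soon as it has a neighbour, so pairs that are already joined also count as not
  open.\<close>

definition reach :: "vertex list vec \<Rightarrow> vertex \<Rightarrow> bool vec" where
  "reach nr x = marks nr (get nr x) (mark (get nr x) (const False))"

text \<open>A pair is open unless some neighbour of one end is within two steps of the other, so that an edge would
  close a square or a triangle.\<close>

fun open1 :: "vertex list vec \<Rightarrow> vertex \<Rightarrow> bool vec \<Rightarrow> vertex list \<Rightarrow> edge list" where
  "open1 nr x w [] = []"
| "open1 nr x w (y # ys) = (if touch (get nr y) w then open1 nr x w ys else (x,y) # open1 nr x w ys)"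

fun opens :: "vertex list vec \<Rightarrow> vertex list \<Rightarrow> edge list" where
  "opens nr [] = []"
| "opens nr (x # ys) = open1 nr x (reach nr x) ys @ opens nr ys"

fun indep :: "vertex list vec \<Rightarrow> bool vec \<Rightarrow> vertex list \<Rightarrow> bool" where
  "indep nr w [] = True"
| "indep nr w (x # ys) = (if touch (get nr x) w then False else indep nr w ys)"

fun hits :: "tri list \<Rightarrow> bool vec \<Rightarrow> bool" where
  "hits [] w = True"
| "hits ((a,b,c) # T) w = (if touch [a,b,c] w then hits T w else False)"

fun mem :: "vertex \<Rightarrow> vertex list \<Rightarrow> bool" where
  "mem x [] = False"
| "mem x (y # ys) = (if x = y then True else mem x ys)"

fun fresh_list :: "vertex list \<Rightarrow> bool vec \<Rightarrow> bool" where
  "fresh_list [] v = True"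
| "fresh_list (x # xs) v = (if get v x then False else fresh_list xs (put v x True))"

text \<open>Adjacency is tested separately because the test by \<open>reach\<close> holds for joined
  pairs as well. What is wanted is a pair that is no edge and can never become one.\<close>

fun fits :: "vertex list vec \<Rightarrow> vertex \<Rightarrow> bool vec \<Rightarrow> vertex list \<Rightarrow> bool" where
  "fits nr x w [] = True"
| "fits nr x w (y # ys) = (if mem x (get nr y) then False else if mem y (get nr x) then False
     else if touch (get nr y) w then fits nr x w ys else False)"

text \<open>A triangle that is not yet met must receive one of its three corners, which gives a
  backtracking search. A leaf \<open>cert.X\<close> therefore carries no vertex set; the set is
  found again here.\<close>

fun seek :: "vertex list vec \<Rightarrow> tri list \<Rightarrow> vertex list \<Rightarrow> bool" where
  "seek nr [] z = True"
| "seek nr ((a,b,c) # T) z = (if mem a z then seek nr T z else if mem b z then seek nr T z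
     else if mem c z then seek nr T z
     else (fits nr a (reach nr a) z \<and> seek nr T (a # z)) \<or> (fits nr b (reach nr b) z \<and> seek nr T (b # z))
       \<or> (fits nr c (reach nr c) z \<and> seek nr T (c # z)))"

section \<open>Symmetry tests and the refutation checker\<close>

fun haspair :: "edge list \<Rightarrow> vertex \<Rightarrow> vertex \<Rightarrow> bool" where
  "haspair [] b c = False"
| "haspair ((x,y) # es) b c = (if x = b then if y = c then True else haspair es b c
     else if x = c then if y = b then True else haspair es b c else haspair es b c)"

text \<open>Only an inclusion of the image in the other system is tested; equality comes later from
  counting triangles.\<close>

fun tmaps :: "vertex vec \<Rightarrow> tri list \<Rightarrow> edge list vec \<Rightarrow> bool" where
  "tmaps p [] tr = True"
| "tmaps p ((a,b,c) # T) tr = (if haspair (get tr (get p a)) (get p b) (get p c) then tmaps p T tr else False)"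

fun emaps :: "vertex vec \<Rightarrow> edge list \<Rightarrow> vertex list vec \<Rightarrow> bool" where
  "emaps p [] nr = True"
| "emaps p ((a,b) # X) nr = (if mem (get p b) (get nr (get p a)) then emaps p X nr else False)"

fun item :: "'a list \<Rightarrow> nat \<Rightarrow> 'a option" where
  "item [] i = None"
| "item (x # xs) i = (if i = 0 then Some x else item xs (i - 1))"

text \<open>\<open>nr\<close> holds the triangle edges together with the extra edges
  \<open>X\<close>. \<open>Ds\<close> collects refuted edge sets, newest first: a node
  \<open>cert.Z\<close> enters its own set after all its branches have been refuted, and this order
  gives the indices in \<open>cert.R\<close> their meaning. A branch adds its pair without
  forbidding the pairs of earlier branches, so an edge set refuted in one branch may reappear in
  another.\<close>

fun run :: "tri list \<Rightarrow> edge list vec \<Rightarrow> vertex list vec \<Rightarrow> edge list \<Rightarrow> cert \<Rightarrow> edge list list \<Rightarrow> edge list list option"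
and runs :: "tri list \<Rightarrow> edge list vec \<Rightarrow> vertex list vec \<Rightarrow> edge list \<Rightarrow> edge list \<Rightarrow> cert list \<Rightarrow> edge list list \<Rightarrow> edge list list option" where
  "run T tr nr X cert.X Ds = (if seek nr T [] then Some Ds else None)"
| "run T tr nr X (cert.R i p) Ds = (case item Ds i of None \<Rightarrow> None | Some X' \<Rightarrow>
     if fresh_list (entries (perm p)) (const False) then if tmaps (perm p) T tr then if emaps (perm p) X' nr then Some Ds else None else None else None)"
| "run T tr nr X (cert.Z z cs) Ds = (if hits T (mark z (const False)) then if indep nr (mark z (const False)) z then
     (case runs T tr nr X (opens nr z) cs Ds of None \<Rightarrow> None | Some Ds' \<Rightarrow> Some (X # Ds')) else None else None)"
| "runs T tr nr X [] cs Ds = Some Ds"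
| "runs T tr nr X ((a,b) # es) [] Ds = None"
| "runs T tr nr X ((a,b) # es) (c # cs) Ds = (case run T tr (add_edge a b nr) ((a,b) # X) c Ds of None \<Rightarrow> None
     | Some Ds' \<Rightarrow> runs T tr nr X es cs Ds')"

definition killed :: "tri list \<Rightarrow> cert \<Rightarrow> bool" where
  "killed T c = (case run T (triangle_rows T) (neighbour_rows T) [] c [] of None \<Rightarrow> False | Some _ \<Rightarrow> True)"

fun kills :: "tri list list \<Rightarrow> cert list \<Rightarrow> bool" where
  "kills [] cs = True"
| "kills (T # Ts) [] = False"
| "kills (T # Ts) (c # cs) = (if killed T c then kills Ts cs else False)"

section \<open>Candidates for the next triangle\<close>

fun cnt :: "edge list \<Rightarrow> nat" where
  "cnt [] = 0"
| "cnt (x # xs) = Suc (cnt xs)"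

fun used :: "edge list vec \<Rightarrow> vertex list \<Rightarrow> vertex list" where
  "used tr [] = []"
| "used tr (v # vs) = (if cnt (get tr v) = 0 then used tr vs else v # used tr vs)"

fun fresh :: "edge list vec \<Rightarrow> vertex list \<Rightarrow> vertex list" where
  "fresh tr [] = []"
| "fresh tr (v # vs) = (if cnt (get tr v) = 0 then v # fresh tr vs else fresh tr vs)"

fun pend :: "edge list vec \<Rightarrow> vertex list \<Rightarrow> vertex list" where
  "pend tr [] = []"
| "pend tr (v # vs) = (if cnt (get tr v) = Suc 0 then v # pend tr vs else pend tr vs)"

fun tail :: "'a list \<Rightarrow> 'a list" where "tail [] = []" | "tail (x # xs) = xs"

text \<open>Vertices of degree one in the same triangle are interchangeable: only the first is extended.\<close>

fun nonreps :: "edge list vec \<Rightarrow> tri list \<Rightarrow> vertex list" where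
  "nonreps tr [] = []"
| "nonreps tr ((a,b,c) # T) = tail (pend tr [a,b,c]) @ nonreps tr T"

fun diff :: "vertex list \<Rightarrow> vertex list \<Rightarrow> vertex list" where
  "diff [] ys = []"
| "diff (x # xs) ys = (if mem x ys then diff xs ys else x # diff xs ys)"

text \<open>Every system arises by adding a triangle of maximal total priority last. Any function of the degree would
  do; this one leaves few candidates to consider.\<close>

fun priority :: "nat \<Rightarrow> nat" where
  "priority 0 = 0"
| "priority (Suc 0) = Suc (Suc (Suc (Suc (Suc (Suc (Suc (Suc (Suc 0))))))))"
| "priority (Suc (Suc n)) = n"

definition key :: "edge list vec \<Rightarrow> vertex \<Rightarrow> vertex \<Rightarrow> vertex \<Rightarrow> nat" where
  "key tr a b c = priority (cnt (get tr a)) + priority (cnt (get tr b)) + priority (cnt (get tr c))"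

fun below :: "edge list vec \<Rightarrow> tri list \<Rightarrow> nat \<Rightarrow> bool" where
  "below tr [] m = True"
| "below tr ((a,b,c) # T) m = (if key tr a b c \<le> m then below tr T m else False)"

definition heaviest :: "tri list \<Rightarrow> vertex \<Rightarrow> vertex \<Rightarrow> vertex \<Rightarrow> edge list vec \<Rightarrow> bool" where
  "heaviest T a b c tr = below tr T (key tr a b c)"

definition add_triangle :: "vertex \<Rightarrow> vertex \<Rightarrow> vertex \<Rightarrow> edge list vec \<Rightarrow> edge list vec" where
  "add_triangle a b c tr = push (push (push tr a (b,c)) b (a,c)) c (a,b)"

text \<open>The digit in \<open>ext3\<close>, \<open>ext2\<close>, \<open>ext1\<close>,
  \<open>ext0\<close> is the number of corners so far in no triangle. Such vertices are
  interchangeable, so the first ones of the list stand for all.\<close>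

fun ext3 :: "vertex list \<Rightarrow> tri list" where
  "ext3 [] = []" | "ext3 [f] = []" | "ext3 [f,g] = []"
| "ext3 (f # g # h # fs) = [(f,g,h)]"

fun ext2 :: "vertex list \<Rightarrow> vertex list \<Rightarrow> tri list" where
  "ext2 [] us = []" | "ext2 [f] us = []"
| "ext2 (f # g # fs) us = map (\<lambda>u. (u,f,g)) us"

fun ext1 :: "vertex list \<Rightarrow> edge list \<Rightarrow> tri list" where
  "ext1 [] es = []"
| "ext1 (f # fs) es = map (\<lambda>(u,v). (u,v,f)) es"

fun tri1 :: "vertex \<Rightarrow> vertex \<Rightarrow> edge list \<Rightarrow> edge list \<Rightarrow> tri list" where
  "tri1 u v [] es = []"
| "tri1 u v ((x,y) # r) es = (if x = v then if haspair es u y then (u,v,y) # tri1 u v r es else tri1 u v r es else tri1 u v r es)"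

fun ext0 :: "edge list \<Rightarrow> edge list \<Rightarrow> tri list" where
  "ext0 [] es = []"
| "ext0 ((u,v) # r) es = tri1 u v es es @ ext0 r es"

definition exts :: "vertex list \<Rightarrow> vertex list \<Rightarrow> edge list \<Rightarrow> tri list" where
  "exts fs us es = ext3 fs @ ext2 fs us @ ext1 fs es @ ext0 es es"

text \<open>The enlarged table is passed to \<open>extend_one\<close> as an argument, so that
  rewriting computes it once for both the maximality test and the comparison with a recorded
  system.\<close>

fun extend_by :: "tri list \<Rightarrow> edge list vec \<Rightarrow> tri list \<Rightarrow> act list \<Rightarrow> tri list list \<Rightarrow> tri list list option"
and extend_one :: "tri list \<Rightarrow> edge list vec \<Rightarrow> tri \<Rightarrow> edge list vec \<Rightarrow> tri list \<Rightarrow> act list \<Rightarrow> tri list list \<Rightarrow> tri list list option" where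
  "extend_by T tr [] as Ts = Some Ts"
| "extend_by T tr ((a,b,c) # cs) as Ts = extend_one T tr (a,b,c) (add_triangle a b c tr) cs as Ts"
| "extend_one T tr (a,b,c) tr' cs as Ts = (if heaviest T a b c tr' then
     (case as of [] \<Rightarrow> None
      | Cons act as' \<Rightarrow> (case act of act.Y \<Rightarrow> if fresh_list [a,b,c] (const False) then if haspair (get tr a) b c then None else extend_by T tr cs as' (((a,b,c) # T) # Ts) else None
      | act.S i p \<Rightarrow> (case item Ts i of None \<Rightarrow> None | Some T' \<Rightarrow>
     if fresh_list (entries (perm p)) (const False) then if tmaps (perm p) T' tr' then extend_by T tr cs as' Ts else None else None)))
   else extend_by T tr cs as Ts)"

text \<open>The three nested definitions are stages of evaluation: each passes its tables and lists
  on as arguments, so that they are in normal form before the next stage uses them several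
  times.\<close>

definition extend_system2 where "extend_system2 T tr fs us as Ts = extend_by T tr (exts fs us (opens (neighbour_rows T) us)) as Ts"
definition extend_system1 where "extend_system1 T tr as Ts = extend_system2 T tr (fresh tr vertices) (diff (used tr vertices) (nonreps tr T)) as Ts"
definition extend_system where "extend_system T as Ts = extend_system1 T (triangle_rows T) as Ts"

fun extend :: "tri list list \<Rightarrow> act list list \<Rightarrow> tri list list \<Rightarrow> tri list list option" where
  "extend [] as Ts = Some Ts"
| "extend (T # Us) [] Ts = None"
| "extend (T # Us) (as # ass) Ts = (case extend_system T as Ts of None \<Rightarrow> None | Some Ts' \<Rightarrow> extend Us ass Ts')"

section \<open>Evaluation by rewriting\<close>

text \<open>The simplifier visits a branch of a conditional again after selecting it, including all data in it that
  is already in normal form. Moving the condition into an argument of an auxiliary function avoids this.\<close>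

definition "open1_if u nr x w y ys = (if u then open1 nr x w ys else (x,y) # open1 nr x w ys)"
definition "indep_if u nr w ys = (if u then False else indep nr w ys)"
definition "hits_if u T w = (if u then hits T w else False)"
text \<open>\<open>u\<close> tells whether an earlier corner has already led to a solution. Turning
  the disjunction into this accumulator makes the search proceed from left to right and stop at the
  first success.\<close>

definition "seek_or u nr xs T z = (u \<or> (\<exists>x\<in>set xs. fits nr x (reach nr x) z \<and> seek nr T (x # z)))"
definition "seek_and u nr x xs T z = seek_or (u \<and> seek nr T (x # z)) nr xs T z"
definition "seek_hit u v w nr a b c T z = (if u then seek nr T z else if v then seek nr T z
  else if w then seek nr T z else seek_or False nr [a,b,c] T z)"
definition "seek_case u Ds = (if u then Some Ds else None)"
definition "tmaps_if u p T tr = (if u then tmaps p T tr else False)"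
definition "emaps_if u p X nr = (if u then emaps p X nr else False)"
definition "below_if u tr T m = (if u then below tr T m else False)"
definition "ref_if d t e Ds = (if d then if t then if e then Some Ds else None else None else None)"
definition "ref_case x T tr nr p Ds = (case x of None \<Rightarrow> None | Some X' \<Rightarrow>
  ref_if (fresh_list (entries p) (const False)) (tmaps p T tr) (emaps p X' nr) Ds)"
definition "zero_case x X = (case x of None \<Rightarrow> None | Some Ds \<Rightarrow> Some (X # Ds))"
definition "zero_if h i T tr nr X z cs Ds =
  (if h then if i then zero_case (runs T tr nr X (opens nr z) cs Ds) X else None else None)"
definition "runs_case x T tr nr X es cs = (case x of None \<Rightarrow> None | Some Ds \<Rightarrow> runs T tr nr X es cs Ds)"
definition "killed_case x = (case x of None \<Rightarrow> False | Some _ \<Rightarrow> True)"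
definition "kills_if u Ts cs = (if u then kills Ts cs else False)"
definition "new_if d h T tr a b c cs as Ts =
  (if d then if h then None else extend_by T tr cs as (((a,b,c) # T) # Ts) else None)"
definition "same_if d t T tr cs as Ts = (if d then if t then extend_by T tr cs as Ts else None else None)"
definition "same_case x p T tr tr' cs as Ts = (case x of None \<Rightarrow> None | Some T' \<Rightarrow>
  same_if (fresh_list (entries p) (const False)) (tmaps p T' tr') T tr cs as Ts)"
definition "act_case as T tr a b c tr' cs Ts = (case as of [] \<Rightarrow> None
  | Cons act as' \<Rightarrow> (case act of act.Y \<Rightarrow> new_if (fresh_list [a,b,c] (const False)) (haspair (get tr a) b c) T tr a b c cs as' Ts
    | act.S i p \<Rightarrow> same_case (item Ts i) (perm p) T tr tr' cs as' Ts))"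
definition "heaviest_case u T tr a b c tr' cs as Ts = (if u then act_case as T tr a b c tr' cs Ts else extend_by T tr cs as Ts)"
definition "extend_case x Us ass = (case x of None \<Rightarrow> None | Some Ts \<Rightarrow> extend Us ass Ts)"

text \<open>These are the rewrite rules of the evaluator. Outcomes that a correct certificate never
  produces have no rule, so a wrong certificate leaves a stuck term; rules for a negative answer
  exist where the search itself may meet one, as in \<open>seek\<close>, \<open>open1\<close> and
  \<open>below\<close>.\<close>

lemma lazy:
  "open1 nr x w [] = []"
  "open1 nr x w (y # ys) = open1_if (touch (get nr y) w) nr x w y ys"
  "open1_if True nr x w y ys = open1 nr x w ys"
  "open1_if False nr x w y ys = (x,y) # open1 nr x w ys"
  "indep nr w [] = True"
  "indep nr w (x # ys) = indep_if (touch (get nr x) w) nr w ys"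
  "indep_if False nr w ys = indep nr w ys"
  "hits [] w = True"
  "hits ((a,b,c) # T) w = hits_if (touch [a,b,c] w) T w"
  "hits_if True T w = hits T w"
  "seek nr [] z = True"
  "seek nr ((a,b,c) # T) z = seek_hit (mem a z) (mem b z) (mem c z) nr a b c T z"
  "seek_hit True d h nr a b c T z = seek nr T z"
  "seek_hit False True h nr a b c T z = seek nr T z"
  "seek_hit False False True nr a b c T z = seek nr T z"
  "seek_hit False False False nr a b c T z = seek_or False nr [a,b,c] T z"
  "seek_or True nr xs T z = True"
  "seek_or False nr [] T z = False"
  "seek_or False nr (x # xs) T z = seek_and (fits nr x (reach nr x) z) nr x xs T z"
  "seek_and False nr x xs T z = seek_or False nr xs T z"
  "seek_and True nr x xs T z = seek_or (seek nr T (x # z)) nr xs T z"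
  "run T tr nr X cert.X Ds = seek_case (seek nr T []) Ds"
  "seek_case True Ds = Some Ds"
  "tmaps p [] tr = True"
  "tmaps p ((a,b,c) # T) tr = tmaps_if (haspair (get tr (get p a)) (get p b) (get p c)) p T tr"
  "tmaps_if True p T tr = tmaps p T tr"
  "emaps p [] nr = True"
  "emaps p ((a,b) # X) nr = emaps_if (mem (get p b) (get nr (get p a))) p X nr"
  "emaps_if True p X nr = emaps p X nr"
  "below tr [] m = True"
  "below tr ((a,b,c) # T) m = below_if (key tr a b c \<le> m) tr T m"
  "below_if True tr T m = below tr T m"
  "below_if False tr T m = False"
  "run T tr nr X (cert.R i ps) Ds = ref_case (item Ds i) T tr nr (perm ps) Ds"
  "ref_case (Some X') T tr nr p Ds = ref_if (fresh_list (entries p) (const False)) (tmaps p T tr) (emaps p X' nr) Ds"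
  "ref_if True True True Ds = Some Ds"
  "run T tr nr X (cert.Z z cs) Ds =
    zero_if (hits T (mark z (const False))) (indep nr (mark z (const False)) z) T tr nr X z cs Ds"
  "zero_if True True T tr nr X z cs Ds = zero_case (runs T tr nr X (opens nr z) cs Ds) X"
  "zero_case (Some Ds) X = Some (X # Ds)"
  "runs T tr nr X [] cs Ds = Some Ds"
  "runs T tr nr X ((a,b) # es) (ct # cs) Ds = runs_case (run T tr (add_edge a b nr) ((a,b) # X) ct Ds) T tr nr X es cs"
  "runs_case (Some Ds) T tr nr X es cs = runs T tr nr X es cs Ds"
  "killed T ct = killed_case (run T (triangle_rows T) (neighbour_rows T) [] ct [])"
  "killed_case (Some Ds) = True"
  "kills [] cs = True"
  "kills (T # Ts) (ct # cs) = kills_if (killed T ct) Ts cs"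
  "kills_if True Ts cs = kills Ts cs"
  "extend_by T tr [] as Ts = Some Ts"
  "extend_by T tr ((a,b,c) # ks) as Ts = extend_one T tr (a,b,c) (add_triangle a b c tr) ks as Ts"
  "extend_one T tr (a,b,c) tr' ks as Ts = heaviest_case (heaviest T a b c tr') T tr a b c tr' ks as Ts"
  "heaviest_case False T tr a b c tr' ks as Ts = extend_by T tr ks as Ts"
  "heaviest_case True T tr a b c tr' ks as Ts = act_case as T tr a b c tr' ks Ts"
  "act_case (act.Y # as) T tr a b c tr' ks Ts =
    new_if (fresh_list [a,b,c] (const False)) (haspair (get tr a) b c) T tr a b c ks as Ts"
  "act_case (act.S i ps # as) T tr a b c tr' ks Ts = same_case (item Ts i) (perm ps) T tr tr' ks as Ts"
  "new_if True False T tr a b c ks as Ts = extend_by T tr ks as (((a,b,c) # T) # Ts)"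
  "same_case (Some T') p T tr tr' ks as Ts = same_if (fresh_list (entries p) (const False)) (tmaps p T' tr') T tr ks as Ts"
  "same_if True True T tr ks as Ts = extend_by T tr ks as Ts"
  "extend [] ass Ts = Some Ts"
  "extend (T # Us) (as # ass) Ts = extend_case (extend_system T as Ts) Us ass"
  "extend_case (Some Ts) Us ass = extend Us ass Ts"
  by (simp_all add: seek_or_def seek_and_def seek_hit_def seek_case_def open1_if_def indep_if_def hits_if_def tmaps_if_def emaps_if_def below_if_def ref_if_def
      ref_case_def zero_case_def zero_if_def runs_case_def killed_def killed_case_def kills_if_def new_if_def
      same_if_def same_case_def act_case_def heaviest_case_def extend_case_def split: option.splits list.splits act.splits)

text \<open>Indices remain binary numerals: \<open>Num.BitM\<close> is the predecessor of an even
  numeral, so no index is expanded into successors.\<close>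

lemma item_simps:
  "item (x # xs) 0 = Some x"
  "item (x # xs) 1 = item xs 0"
  "item (x # xs) (numeral num.One) = item xs 0"
  "item (x # xs) (numeral (num.Bit0 n)) = item xs (numeral (Num.BitM n))"
  "item (x # xs) (numeral (num.Bit1 n)) = item xs (numeral (num.Bit0 n))"
proof -
  have "numeral (num.Bit0 n) - 1 = (numeral (Num.BitM n) :: nat)"
    by (metis One_nat_def diff_Suc_1' eval_nat_numeral(2))
  then show "item (x # xs) (numeral (num.Bit0 n)) = item xs (numeral (Num.BitM n))"
    by simp
  have "numeral (num.Bit1 n) - 1 = (numeral (num.Bit0 n) :: nat)"
    by simp
  then show "item (x # xs) (numeral (num.Bit1 n)) = item xs (numeral (num.Bit0 n))"
    by simp
qed simp_all

text \<open>Degrees and priorities are computed in unary, which is also why the value 9 in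
  \<open>priority\<close> is spelled with \<open>Suc\<close>.\<close>

lemma nat_simps:
  "(0 \<le> (n::nat)) = True" "(Suc n \<le> 0) = False" "(Suc n \<le> Suc m) = (n \<le> m)"
  "(Suc n = 0) = False" "(0 = Suc n) = False" "(Suc m = Suc n) = (m = n)"
  "(0 = (0::nat)) = True" "0 + n = (n::nat)" "Suc m + n = Suc (m + n)"
  by auto

lemma vertex_refl: "((x::vertex) = x) = True"
  by simp

lemmas evaluate = lazy item_simps nat_simps vertex_refl vertex.distinct if_True if_False vertices_def
  get.simps put.simps entries.simps assign.simps perm_def const_def push_def triangle_rows.simps add_edge_def neighbour_rows.simps mark.simps
  marks.simps touch.simps reach_def opens.simps fits.simps mem.simps fresh_list.simps haspair.simps cnt.simps used.simps fresh.simps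
  pend.simps tail.simps nonreps.simps diff.simps priority.simps key_def heaviest_def add_triangle_def ext3.simps ext2.simps
  ext1.simps tri1.simps ext0.simps exts_def extend_system2_def extend_system1_def extend_system_def append.simps list.map prod.case
  Num.BitM.simps

section \<open>Soundness of refutations\<close>

lemma set_vertices: "set vertices = UNIV"
proof -
  have "x \<in> set vertices" for x by (cases x) (simp_all add: vertices_def)
  then show ?thesis by blast
qed

lemma distinct_vertices: "distinct vertices"
  by (simp add: vertices_def)

instance vertex :: finite
  by standard (metis set_vertices List.finite_set)

lemma get_const [simp]: "get (const x) l = x"
  by (cases l) (simp_all add: const_def)

lemma get_put [simp]: "get (put v a y) b = (if b = a then y else get v b)"
proof (cases v)
  case (V x1 x2 x3 x4 x5 x6 x7 x8 x9 x10 x11 x12 x13 x14 x15 x16 x17)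
  then show ?thesis by (cases a; cases b; simp)
qed

lemma entries_get: "entries v = map (get v) vertices"
  by (cases v) (simp add: vertices_def)

lemma get_push [simp]: "get (push v a y) b = (if b = a then y # get v b else get v b)"
  by (simp add: push_def)

lemma get_mark [simp]: "get (mark xs v) y \<longleftrightarrow> y \<in> set xs \<or> get v y"
  by (induction xs arbitrary: v) auto

lemma get_marks [simp]: "get (marks nr ys v) z \<longleftrightarrow> (\<exists>y\<in>set ys. z \<in> set (get nr y)) \<or> get v z"
  by (induction ys arbitrary: v) auto

lemma touch_iff [simp]: "touch xs v \<longleftrightarrow> (\<exists>x\<in>set xs. get v x)"
  by (induction xs) auto

lemma mem_iff [simp]: "mem x xs \<longleftrightarrow> x \<in> set xs"
  by (induction xs) auto

lemma fresh_list_iff: "fresh_list xs v \<longleftrightarrow> distinct xs \<and> (\<forall>x\<in>set xs. \<not> get v x)"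
  by (induction xs arbitrary: v) auto

lemma haspair_iff: "haspair es b c \<longleftrightarrow> (b,c) \<in> set es \<or> (c,b) \<in> set es"
  by (induction es b c rule: haspair.induct) auto

lemma bij_get: "fresh_list (entries p) (const False) \<Longrightarrow> bij (get p)"
proof -
  assume "fresh_list (entries p) (const False)"
  then have "inj_on (get p) (set vertices)"
    by (simp add: fresh_list_iff entries_get distinct_map)
  then show ?thesis
    by (simp add: set_vertices bij_def finite_UNIV_inj_surj)
qed

section \<open>Lists of triangles as sets of vertex sets\<close>

definition blk :: "tri \<Rightarrow> vertex set" where
  "blk = (\<lambda>(a,b,c). {a,b,c})"

definition blks :: "tri list \<Rightarrow> vertex set set" where
  "blks T = blk ` set T"

lemma blk_simp [simp]: "blk (a,b,c) = {a,b,c}"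
  by (simp add: blk_def)

lemma blks_Nil [simp]: "blks [] = {}"
  by (simp add: blks_def)

lemma blks_Cons [simp]: "blks (t # T) = insert (blk t) (blks T)"
  by (simp add: blks_def)

lemma finite_blks [simp]: "finite (blks T)"
  by (simp add: blks_def)

lemma triangle_rows_blk: "(b,c) \<in> set (get (triangle_rows T) a) \<Longrightarrow> {a,b,c} \<in> blks T"
  by (induction T rule: triangle_rows.induct) (auto split: if_splits)

text \<open>A row stores the opposite side of each triangle in one order only, hence the symmetric
  test \<open>haspair\<close>.\<close>

lemma blk_triangle_rows: "{a,b,c} \<in> blks T \<Longrightarrow> distinct [a,b,c] \<Longrightarrow> haspair (get (triangle_rows T) a) b c"
  unfolding haspair_iff
proof (induction T rule: triangle_rows.induct)
  case (2 x y z T)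
  then show ?case
  proof (cases "{a,b,c} \<in> blks T")
    case False
    then have "{a,b,c} = {x,y,z}" using 2 by simp
    then have "a \<in> {x,y,z}" "b \<in> {x,y,z}" "c \<in> {x,y,z}" by blast+
    then show ?thesis using 2(3) by fastforce
  qed auto
qed simp

lemma haspair_blks: "haspair (get (triangle_rows T) a) b c \<Longrightarrow> {a,b,c} \<in> blks T"
  unfolding haspair_iff using triangle_rows_blk by (metis insert_commute)

lemma tmaps_blks: "tmaps p T' (triangle_rows T) \<Longrightarrow> (image (get p)) ` blks T' \<subseteq> blks T"
proof (induction T')
  case (Cons t T')
  then show ?case by (cases t) (auto split: if_splits dest: haspair_blks)
qed simp

definition adj :: "vertex set set \<Rightarrow> vertex \<Rightarrow> vertex \<Rightarrow> bool" where
  "adj S x y \<longleftrightarrow> x \<noteq> y \<and> (\<exists>t\<in>S. x \<in> t \<and> y \<in> t)"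

definition threes :: "vertex set set \<Rightarrow> bool" where
  "threes S \<longleftrightarrow> (\<forall>t\<in>S. card t = 3)"

lemma card3: "card {a,b,c} = 3 \<longleftrightarrow> distinct [a,b,c]"
  by (auto simp: card_insert_if)

lemma threes_Cons: "threes (blks ((a,b,c) # T)) \<longleftrightarrow> distinct [a,b,c] \<and> threes (blks T)"
  using card3[of a b c] by (simp add: threes_def)

lemma neighbour_rows_adj: "threes (blks T) \<Longrightarrow> y \<in> set (get (neighbour_rows T) x) \<longleftrightarrow> adj (blks T) x y"
proof (induction T rule: neighbour_rows.induct)
  case (2 a b c T)
  then show ?case
    unfolding threes_Cons by (auto simp: add_edge_def adj_def)
qed (simp add: adj_def)

section \<open>Uncolourable square-free graphs with given triangles\<close>

definition squarefree :: "(vertex \<Rightarrow> vertex \<Rightarrow> bool) \<Rightarrow> bool" where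
  "squarefree E \<longleftrightarrow> (\<forall>a b c d. distinct [a,b,c,d] \<longrightarrow> \<not> (E a b \<and> E b c \<and> E c d \<and> E d a))"

text \<open>\<open>W\<close> plays the part of the zeros of a 101-colouring, so the last clause says
  that there is no such colouring. \<open>S\<close> is exactly the set of triangles of
  \<open>E\<close>; it is a separate argument because the enumeration fixes it, up to a permutation,
  before anything else about \<open>E\<close> is known.\<close>

definition crit :: "(vertex \<Rightarrow> vertex \<Rightarrow> bool) \<Rightarrow> vertex set set \<Rightarrow> bool" where
  "crit E S \<longleftrightarrow> (\<forall>x y. E x y \<longrightarrow> E y x) \<and> (\<forall>x. \<not> E x x) \<and> squarefree E
     \<and> (\<forall>x y z. E x y \<and> E y z \<and> E x z \<longrightarrow> {x,y,z} \<in> S)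
     \<and> (\<forall>t\<in>S. card t = 3 \<and> (\<forall>x\<in>t. \<forall>y\<in>t. x \<noteq> y \<longrightarrow> E x y))
     \<and> (\<forall>W. (\<forall>x\<in>W. \<forall>y\<in>W. \<not> E x y) \<longrightarrow> (\<exists>t\<in>S. W \<inter> t = {}))"

lemma crit_sym: "crit E S \<Longrightarrow> E x y \<Longrightarrow> E y x"
  and crit_irrefl: "crit E S \<Longrightarrow> \<not> E x x"
  and crit_squarefree: "crit E S \<Longrightarrow> squarefree E"
  and crit_triangle: "crit E S \<Longrightarrow> E x y \<Longrightarrow> E y z \<Longrightarrow> E x z \<Longrightarrow> {x,y,z} \<in> S"
  and crit_threes: "crit E S \<Longrightarrow> threes S"
  and crit_adj: "crit E S \<Longrightarrow> adj S x y \<Longrightarrow> E x y"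
  by (auto simp: crit_def threes_def adj_def)

lemma crit_uncolourable:
  assumes "crit E S" "\<And>x y. x \<in> W \<Longrightarrow> y \<in> W \<Longrightarrow> \<not> E x y"
  shows "\<exists>t\<in>S. W \<inter> t = {}"
  using assms by (simp add: crit_def)

text \<open>Relabelling. Injectivity of \<open>g\<close> keeps vertices distinct and lets a triangle
  of the pulled-back graph be recovered from its image; a set \<open>W\<close> independent after
  pulling back is tested through its image under \<open>g\<close>.\<close>

lemma crit_pull:
  assumes "bij g" "crit E ((image g) ` S)"
  shows "crit (\<lambda>x y. E (g x) (g y)) S"
  unfolding crit_def
proof (intro conjI allI impI ballI)
  have inj: "inj g" using assms(1) by (auto simp: bij_def)
  show "squarefree (\<lambda>x y. E (g x) (g y))"
    unfolding squarefree_def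
  proof (intro allI impI notI)
    fix a b c d assume d: "distinct [a,b,c,d]" and e: "E (g a) (g b) \<and> E (g b) (g c) \<and> E (g c) (g d) \<and> E (g d) (g a)"
    have "distinct [g a, g b, g c, g d]" using d inj by (auto simp: inj_eq)
    then show False using crit_squarefree[OF assms(2)] e unfolding squarefree_def by blast
  qed
  show "E (g y) (g x)" if "E (g x) (g y)" for x y using crit_sym[OF assms(2) that] .
  show "\<not> E (g x) (g x)" for x using crit_irrefl[OF assms(2)] .
  show "{x,y,z} \<in> S" if e: "E (g x) (g y) \<and> E (g y) (g z) \<and> E (g x) (g z)" for x y z
  proof -
    have "{g x, g y, g z} \<in> (image g) ` S" using crit_triangle[OF assms(2)] e by blast
    then obtain t where t: "t \<in> S" "g ` t = g ` {x,y,z}" by auto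
    from t(2) have "t = {x,y,z}" by (simp only: inj_image_eq_iff[OF inj])
    then show ?thesis using t(1) by simp
  qed
  show "card t = 3" if "t \<in> S" for t
    using crit_threes[OF assms(2)] that inj unfolding threes_def by (auto simp: card_image inj_on_subset)
  show "E (g x) (g y)" if "t \<in> S" "x \<in> t" "y \<in> t" "x \<noteq> y" for t x y
    using crit_adj[OF assms(2)] that inj unfolding adj_def by (metis imageI inj_eq)
  show "\<exists>t\<in>S. W \<inter> t = {}" if W: "\<forall>x\<in>W. \<forall>y\<in>W. \<not> E (g x) (g y)" for W
  proof -
    have "\<exists>t\<in>(image g) ` S. g ` W \<inter> t = {}"
      using W by (intro crit_uncolourable[OF assms(2)]) auto
    then show ?thesis by blast
  qed
qed

section \<open>Pairs that cannot be joined\<close>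

definition blocked :: "vertex list vec \<Rightarrow> vertex \<Rightarrow> vertex \<Rightarrow> bool" where
  "blocked nr x y \<longleftrightarrow> (\<exists>b\<in>set (get nr y). b \<in> set (get nr x) \<or> (\<exists>a\<in>set (get nr x). b \<in> set (get nr a)))"

lemma touch_reach: "touch (get nr y) (reach nr x) \<longleftrightarrow> blocked nr x y"
  by (auto simp: reach_def blocked_def)

lemma open1_set: "set (open1 nr x (reach nr x) ys)
  = {(x,y) | y. y \<in> set ys \<and> \<not> blocked nr x y}"
  by (induction ys) (auto simp: touch_reach simp del: touch_iff)

lemma opens_pair:
  "a \<in> set us \<Longrightarrow> b \<in> set us \<Longrightarrow> a \<noteq> b \<Longrightarrow> \<not> blocked nr a b \<Longrightarrow> \<not> blocked nr b a
    \<Longrightarrow> (a,b) \<in> set (opens nr us) \<or> (b,a) \<in> set (opens nr us)"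
  by (induction us) (auto simp: open1_set)

definition within :: "vertex list vec \<Rightarrow> (vertex \<Rightarrow> vertex \<Rightarrow> bool) \<Rightarrow> bool" where
  "within nr E \<longleftrightarrow> (\<forall>x. \<forall>y\<in>set (get nr x). E x y)"

definition covers :: "vertex list vec \<Rightarrow> vertex set set \<Rightarrow> bool" where
  "covers nr S \<longleftrightarrow> (\<forall>x y. adj S x y \<longrightarrow> y \<in> set (get nr x))"

text \<open>The rows contain every edge of a triangle, so an edge \<open>x\<close> \<open>y\<close>
  missing from them lies in no triangle and its ends have no common neighbour. A path
  \<open>x\<close> \<open>a\<close> \<open>b\<close> \<open>y\<close> of recorded edges would close
  a square with it.\<close>

lemma not_blocked:
  assumes c: "crit E S" and s: "within nr E" and v: "covers nr S"
    and e: "E x y" and n: "y \<notin> set (get nr x)" "x \<notin> set (get nr y)"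
  shows "\<not> blocked nr x y"
proof
  assume "blocked nr x y"
  then obtain b where b: "b \<in> set (get nr y)"
    and d: "b \<in> set (get nr x) \<or> (\<exists>a\<in>set (get nr x). b \<in> set (get nr a))"
    unfolding blocked_def by blast
  note sym = crit_sym[OF c] and irr = crit_irrefl[OF c]
  have yb: "E y b" using b s unfolding within_def by blast
  from d show False
  proof
    assume "b \<in> set (get nr x)"
    then have "E x b" using s unfolding within_def by blast
    then have "{x,y,b} \<in> S" using e yb crit_triangle[OF c] by blast
    moreover have "x \<noteq> y" using e irr by blast
    ultimately have "adj S x y" unfolding adj_def by blast
    then show False using v n unfolding covers_def by blast
  next
    assume "\<exists>a\<in>set (get nr x). b \<in> set (get nr a)"
    then obtain a where a: "a \<in> set (get nr x)" "b \<in> set (get nr a)" by blast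
    then have E: "E x a" "E a b" using s unfolding within_def by blast+
    \<comment> \<open>The two diagonals are proper because \<open>x\<close> \<open>y\<close> is not
      recorded: \<open>b\<close> is recorded as a neighbour of \<open>y\<close> and \<open>x\<close>
      is not, \<open>a\<close> is recorded as a neighbour of \<open>x\<close> and \<open>y\<close>
      is not.\<close>
    have "distinct [x,a,b,y]" using E e yb irr a b n by auto
    then show False using E sym[OF yb] sym[OF e] crit_squarefree[OF c] unfolding squarefree_def by blast
  qed
qed

definition refuted :: "tri list \<Rightarrow> edge list \<Rightarrow> bool" where
  "refuted T X \<longleftrightarrow> (\<forall>E. crit E (blks T) \<longrightarrow> \<not> (\<forall>(a,b)\<in>set X. E a b))"

lemma hits_iff: "hits T w \<longleftrightarrow> (\<forall>t\<in>blks T. \<exists>x\<in>t. get w x)"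
  by (induction T w rule: hits.induct) auto

lemma indep_iff: "indep nr w z \<longleftrightarrow> (\<forall>x\<in>set z. \<forall>y\<in>set (get nr x). \<not> get w y)"
  by (induction nr w z rule: indep.induct) auto

text \<open>If \<open>z\<close> were the set of zeros, uncolourability would produce an edge inside
  \<open>z\<close>. This edge is not recorded, hence not blocked from either end. As
  \<open>opens\<close> lists a pair in one order only, both orders have to be considered.\<close>

lemma cover_step:
  assumes "crit E (blks T)" "within nr E" "covers nr (blks T)"
    and h: "hits T (mark z (const False))" and i: "indep nr (mark z (const False)) z"
  shows "\<exists>(a,b)\<in>set (opens nr z). E a b"
proof -
  have "\<forall>t\<in>blks T. set z \<inter> t \<noteq> {}" using h unfolding hits_iff by fastforce
  then have "\<not> (\<exists>t\<in>blks T. set z \<inter> t = {})" by simp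
  then obtain x y where xy: "x \<in> set z" "y \<in> set z" "E x y"
    using crit_uncolourable[OF assms(1), of "set z"] by metis
  have n: "y \<notin> set (get nr x)" "x \<notin> set (get nr y)" using i xy by (auto simp: indep_iff)
  have yx: "E y x" using crit_sym[OF assms(1) xy(3)] .
  have "x \<noteq> y" using xy(3) crit_irrefl[OF assms(1)] by metis
  then have "(x,y) \<in> set (opens nr z) \<or> (y,x) \<in> set (opens nr z)"
    using opens_pair[OF xy(1,2)] not_blocked[OF assms(1-3) xy(3) n] not_blocked[OF assms(1-3) yx n(2,1)]
    by simp
  then show ?thesis using xy(3) yx by auto
qed

definition inert :: "vertex list vec \<Rightarrow> vertex list \<Rightarrow> bool" where
  "inert nr z \<longleftrightarrow> pairwise (\<lambda>x y. x \<notin> set (get nr y) \<and> y \<notin> set (get nr x) \<and> (blocked nr x y \<or> blocked nr y x)) (set z)"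

lemma fits_iff: "fits nr x (reach nr x) z \<longleftrightarrow>
    (\<forall>y\<in>set z. x \<notin> set (get nr y) \<and> y \<notin> set (get nr x) \<and> blocked nr x y)"
  by (induction z) (auto simp: touch_reach simp del: touch_iff)

lemma inert_Cons: "fits nr x (reach nr x) z \<Longrightarrow> inert nr z \<Longrightarrow> inert nr (x # z)"
  unfolding inert_def fits_iff by (simp add: pairwise_insert)

text \<open>A successful search ends with a set that meets all triangles and whose pairs are all
  unjoined and blocked, at least from one end.\<close>

lemma seek_sound: "seek nr T z \<Longrightarrow> inert nr z \<Longrightarrow> \<exists>w. inert nr w \<and> set z \<subseteq> set w \<and> (\<forall>t\<in>blks T. set w \<inter> t \<noteq> {})"
proof (induction nr T z rule: seek.induct)
  case (1 nr z)
  then show ?case by auto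
next
  case (2 nr a b c T z)
  \<comment> \<open>\<open>y\<close> is \<open>z\<close> itself when the triangle is already met and
    \<open>z\<close> with one more corner otherwise; this merges the six branches of the
    search.\<close>
  have "\<exists>y. set y \<inter> {a,b,c} \<noteq> {} \<and> set z \<subseteq> set y
      \<and> (\<exists>w. inert nr w \<and> set y \<subseteq> set w \<and> (\<forall>t\<in>blks T. set w \<inter> t \<noteq> {}))"
  proof (cases "a \<in> set z \<or> b \<in> set z \<or> c \<in> set z")
    case True
    then have "\<exists>w. inert nr w \<and> set z \<subseteq> set w \<and> (\<forall>t\<in>blks T. set w \<inter> t \<noteq> {})"
      using 2 by (auto split: if_splits)
    then show ?thesis using True by (intro exI[of _ z]) auto
  next
    case False
    then have "\<exists>x\<in>{a,b,c}. fits nr x (reach nr x) z \<and> seek nr T (x # z)" using 2(7) by auto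
    then obtain x where x: "x \<in> {a,b,c}" "fits nr x (reach nr x) z" "seek nr T (x # z)" by blast
    have "\<exists>w. inert nr w \<and> set (x # z) \<subseteq> set w \<and> (\<forall>t\<in>blks T. set w \<inter> t \<noteq> {})"
      using x 2(4-6) inert_Cons[OF x(2) 2(8)] False by auto
    then show ?thesis using x(1) by (intro exI[of _ "x # z"]) auto
  qed
  then obtain y w where y: "set y \<inter> {a,b,c} \<noteq> {}" "set z \<subseteq> set y" "set y \<subseteq> set w"
    and w: "inert nr w" "\<forall>t\<in>blks T. set w \<inter> t \<noteq> {}" by (elim exE conjE)
  have "set w \<inter> {a,b,c} \<noteq> {}" "set z \<subseteq> set w" using y by blast+
  then show ?case using w by (intro exI[of _ w]) simp
qed

text \<open>The set found by the search would have to contain an edge, yet none of its pairs is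
  recorded and each of them is blocked.\<close>

lemma refuted_seek:
  assumes s: "seek nr T []" and v: "covers nr (blks T)"
    and i: "\<And>E. crit E (blks T) \<Longrightarrow> \<forall>(a,b)\<in>set X. E a b \<Longrightarrow> within nr E"
  shows "refuted T X"
  unfolding refuted_def
proof (intro allI impI notI)
  fix E assume c: "crit E (blks T)" and "\<forall>(a,b)\<in>set X. E a b"
  then have sn: "within nr E" by (rule i)
  obtain w where w: "inert nr w" "\<forall>t\<in>blks T. set w \<inter> t \<noteq> {}"
    using seek_sound[OF s] by (auto simp: inert_def)
  then have "\<not> (\<exists>t\<in>blks T. set w \<inter> t = {})" by simp
  then obtain x y where xy: "x \<in> set w" "y \<in> set w" "E x y"
    using crit_uncolourable[OF c, of "set w"] by metis
  have "x \<noteq> y" using xy(3) crit_irrefl[OF c] by metis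
  then have n: "y \<notin> set (get nr x)" "x \<notin> set (get nr y)" and b: "blocked nr x y \<or> blocked nr y x"
    using w(1) xy(1,2) unfolding inert_def pairwise_def by simp_all
  show False
    using b not_blocked[OF c sn v xy(3) n] not_blocked[OF c sn v crit_sym[OF c xy(3)] n(2,1)] by simp
qed

section \<open>Soundness of whole refutation trees\<close>

lemma covers_add_edge: "covers nr S \<Longrightarrow> covers (add_edge a b nr) S"
  by (auto simp: covers_def add_edge_def)

lemma within_adde: "within nr E \<Longrightarrow> E a b \<Longrightarrow> E b a \<Longrightarrow> within (add_edge a b nr) E"
  by (auto simp: within_def add_edge_def)

lemma item_set: "item xs i = Some x \<Longrightarrow> x \<in> set xs"
  by (induction xs i rule: item.induct) (auto split: if_splits)

lemma emaps_iff: "emaps p X nr \<longleftrightarrow> (\<forall>(a,b)\<in>set X. get p b \<in> set (get nr (get p a)))"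
  by (induction p X nr rule: emaps.induct) auto

text \<open>Pulling \<open>E\<close> back along an automorphism of the triangle system gives another
  graph of the same kind with the same triangles. It contains \<open>X'\<close> because
  \<open>p\<close> sends \<open>X'\<close> into edges of \<open>E\<close>, so the refutation of
  \<open>X'\<close> applies.\<close>

lemma refuted_image:
  assumes r: "refuted T X'" and p: "fresh_list (entries p) (const False)" and t: "tmaps p T (triangle_rows T)"
    and e: "emaps p X' nr" and s: "\<And>E. crit E (blks T) \<Longrightarrow> \<forall>(a,b)\<in>set X. E a b \<Longrightarrow> within nr E"
  shows "refuted T X"
  unfolding refuted_def
proof (intro allI impI notI)
  fix E assume c: "crit E (blks T)" and X: "\<forall>(a,b)\<in>set X. E a b"
  have bij: "bij (get p)" using p by (rule bij_get)
  have "inj_on (image (get p)) (blks T)"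
    using bij by (meson bij_is_inj inj_image_eq_iff inj_onI)
  \<comment> \<open>The permutation acts injectively on the finite set of triangles, so mapping it
    into itself means mapping it onto itself.\<close>
  then have "(image (get p)) ` blks T = blks T"
    using tmaps_blks[OF t] by (metis card_image card_subset_eq finite_blks)
  then have "crit (\<lambda>x y. E (get p x) (get p y)) (blks T)"
    using crit_pull[OF bij, of E "blks T"] c by simp
  moreover have "\<forall>(a,b)\<in>set X'. E (get p a) (get p b)"
    using s[OF c X] e unfolding emaps_iff within_def by blast
  ultimately show False using r unfolding refuted_def by blast
qed

text \<open>The rows depend only on the triangles and \<open>X\<close>, so the invariant speaks
  about all graphs containing \<open>X\<close> at once. The sets in \<open>Ds\<close> enter as
  refuted and leave as refuted, which is what validates references across branches.\<close>

lemma run_sound: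
  "run T tr nr X c Ds = Some Ds' \<Longrightarrow> tr = triangle_rows T \<Longrightarrow> covers nr (blks T)
    \<Longrightarrow> (\<And>E. crit E (blks T) \<Longrightarrow> \<forall>(a,b)\<in>set X. E a b \<Longrightarrow> within nr E)
    \<Longrightarrow> \<forall>X'\<in>set Ds. refuted T X' \<Longrightarrow> refuted T X \<and> (\<forall>X'\<in>set Ds'. refuted T X')"
  "runs T tr nr X es cs Ds = Some Ds' \<Longrightarrow> tr = triangle_rows T \<Longrightarrow> covers nr (blks T)
    \<Longrightarrow> (\<And>E. crit E (blks T) \<Longrightarrow> \<forall>(a,b)\<in>set X. E a b \<Longrightarrow> within nr E)
    \<Longrightarrow> \<forall>X'\<in>set Ds. refuted T X' \<Longrightarrow> (\<forall>e\<in>set es. refuted T (e # X)) \<and> (\<forall>X'\<in>set Ds'. refuted T X')"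
proof (induction T tr nr X c Ds and T tr nr X es cs Ds arbitrary: Ds' and Ds' rule: run_runs.induct)
  case (1 T tr nr X Ds)
  then have "seek nr T []" "Ds' = Ds" by (auto split: if_splits)
  then show ?case using refuted_seek[of nr T X] 1(3-5) by blast
next
  case (2 T tr nr X i p Ds)
  from 2(1) obtain X' where X': "item Ds i = Some X'" and "fresh_list (entries (perm p)) (const False)"
    "tmaps (perm p) T tr" "emaps (perm p) X' nr" "Ds' = Ds"
    by (auto split: option.splits if_splits)
  moreover have "refuted T X'" using 2(5) item_set[OF X'] by blast
  ultimately show ?case using refuted_image[of T X' "perm p" nr X] 2(2,4,5) by blast
next
  case (3 T tr nr X z cs Ds)
  from 3(2) obtain Ds1 where h: "hits T (mark z (const False))" "indep nr (mark z (const False)) z"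
    and r: "runs T tr nr X (opens nr z) cs Ds = Some Ds1" "Ds' = X # Ds1"
    by (auto split: option.splits if_splits)
  have *: "(\<forall>e\<in>set (opens nr z). refuted T (e # X)) \<and> (\<forall>X'\<in>set Ds1. refuted T X')"
    using 3(1)[OF h r(1)] 3(3-6) by blast
  have "refuted T X"
    unfolding refuted_def
  proof (intro allI impI notI)
    fix E assume c: "crit E (blks T)" and X: "\<forall>(a,b)\<in>set X. E a b"
    obtain a b where "(a,b) \<in> set (opens nr z)" "E a b"
      using cover_step[OF c 3(5)[OF c X] 3(4) h] by blast
    then show False using * c X unfolding refuted_def by fastforce
  qed
  then show ?case using * r by simp
next
  case (6 T tr nr X a b es c cs Ds)
  from 6(3) obtain Ds1 where r: "run T tr (add_edge a b nr) ((a,b) # X) c Ds = Some Ds1" "runs T tr nr X es cs Ds1 = Some Ds'"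
    by (auto split: option.splits)
  have "within (add_edge a b nr) E" if "crit E (blks T)" "\<forall>(a,b)\<in>set ((a,b) # X). E a b" for E
    using that within_adde[of nr E a b] 6(6)[of E] crit_sym[OF that(1)] by auto
  then have *: "refuted T ((a,b) # X) \<and> (\<forall>X'\<in>set Ds1. refuted T X')"
    using 6(1)[OF r(1)] 6(4,5,7) covers_add_edge by blast
  then have "(\<forall>e\<in>set es. refuted T (e # X)) \<and> (\<forall>X'\<in>set Ds'. refuted T X')"
    using 6(2)[OF r(1) r(2)] 6(4-6) by blast
  then show ?case using * by simp
qed auto

lemma killed_sound:
  assumes "killed T c" shows "\<not> crit E (blks T)"
proof
  assume c: "crit E (blks T)"
  then have t: "threes (blks T)" by (rule crit_threes)
  obtain Ds where "run T (triangle_rows T) (neighbour_rows T) [] c [] = Some Ds"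
    using assms unfolding killed_def by (auto split: option.splits)
  moreover have "covers (neighbour_rows T) (blks T)" "crit E (blks T) \<Longrightarrow> within (neighbour_rows T) E" for E
    using neighbour_rows_adj[OF t] crit_adj unfolding covers_def within_def by blast+
  ultimately have "refuted T []" using run_sound(1)[of T "triangle_rows T" "neighbour_rows T" "[]" c "[]" Ds] by auto
  then show False using c unfolding refuted_def by auto
qed

section \<open>Triangle systems\<close>

text \<open>Square-freeness of the graph formed by the triangles alone. The condition refers to
  \<open>S\<close> only, holds for the triangles of any square-free graph and passes to subsets,
  which makes it fit for a search that adds triangles.\<close>

definition triangle_system :: "vertex set set \<Rightarrow> bool" where
  "triangle_system S \<longleftrightarrow> threes S \<and> squarefree (adj S)"

lemma squarefree_mono: "squarefree E \<Longrightarrow> (\<And>x y. E' x y \<Longrightarrow> E x y) \<Longrightarrow> squarefree E'"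
  unfolding squarefree_def by (simp (no_asm_use)) blast

lemma crit_triangle_system: "crit E S \<Longrightarrow> triangle_system S"
  unfolding triangle_system_def using crit_threes crit_squarefree[of E S] squarefree_mono[of E "adj S"] crit_adj[of E S] by simp

lemma triangle_system_subset:
  assumes "triangle_system S" "S' \<subseteq> S" shows "triangle_system S'"
proof -
  have "adj S' x y \<Longrightarrow> adj S x y" for x y using assms(2) unfolding adj_def by blast
  then have "squarefree (adj S')" using squarefree_mono[of "adj S" "adj S'"] assms(1) unfolding triangle_system_def by simp
  then show ?thesis using assms by (auto simp: triangle_system_def threes_def)
qed

lemma adj_image:
  assumes "bij g" "adj ((image g) ` S) x y" shows "adj S (inv g x) (inv g y)"
proof -
  have inv: "inv g (g u) = u" for u using assms(1) by (simp add: bij_is_inj)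
  obtain t u v where t: "t \<in> S" "u \<in> t" "v \<in> t" and xy: "x = g u" "y = g v" "x \<noteq> y"
    using assms(2) unfolding adj_def by auto
  then show ?thesis unfolding xy(1,2) inv adj_def by metis
qed

lemma triangle_system_image:
  assumes "bij g" "triangle_system S" shows "triangle_system ((image g) ` S)"
  unfolding triangle_system_def
proof
  have inj: "inj g" using assms(1) by (rule bij_is_inj)
  show "threes ((image g) ` S)"
    using assms(2) inj unfolding triangle_system_def threes_def by (auto simp: card_image inj_on_subset)
  show "squarefree (adj ((image g) ` S))"
    unfolding squarefree_def
  proof (intro allI impI notI)
    fix a b c d
    assume "distinct [a,b,c,d]" and e: "adj ((image g) ` S) a b \<and> adj ((image g) ` S) b c \<and> adj ((image g) ` S) c d \<and> adj ((image g) ` S) d a"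
    moreover have "inj (inv g)" using assms(1) by (simp add: bij_imp_bij_inv bij_is_inj)
    ultimately have "distinct [inv g a, inv g b, inv g c, inv g d]" by (auto simp: inj_eq)
    then show False
      using adj_image[OF assms(1)] e assms(2) unfolding triangle_system_def squarefree_def by metis
  qed
qed

lemma image_inv_image: "bij g \<Longrightarrow> (image (inv g)) ` ((image g) ` S) = S"
  by (simp add: image_image bij_is_inj image_inv_f_f)

lemma third:
  assumes "card t = 3" "a \<in> t" "b \<in> t" "a \<noteq> b"
  obtains p where "t = {a,b,p}" "p \<noteq> a" "p \<noteq> b"
proof -
  have "card (t - {a,b}) = 1" using assms by (simp add: card_Diff_subset)
  then obtain p where p: "t - {a,b} = {p}" by (rule card_1_singletonE)
  then have "t = {a,b,p}" "p \<noteq> a" "p \<noteq> b" using assms(2,3) by blast+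
  then show ?thesis by (rule that)
qed

lemma adjI: "t \<in> S \<Longrightarrow> x \<in> t \<Longrightarrow> y \<in> t \<Longrightarrow> x \<noteq> y \<Longrightarrow> adj S x y"
  unfolding adj_def by blast

lemma triangle_system_square:
  assumes "triangle_system S" "distinct [a,b,c,d]" "adj S a b" "adj S b c" "adj S c d" "adj S d a"
  shows False
proof -
  have "squarefree (adj S)" using assms(1) by (simp add: triangle_system_def)
  then show False using assms(2-) unfolding squarefree_def by metis
qed

text \<open>If two triangles shared \<open>a\<close> and \<open>b\<close>, their third corners
  \<open>p\<close> and \<open>q\<close> would give the square \<open>a\<close> \<open>p\<close>
  \<open>b\<close> \<open>q\<close>.\<close>

lemma triangle_system_linear:
  assumes "triangle_system S" "t \<in> S" "u \<in> S" "t \<noteq> u" "a \<in> t" "b \<in> t" "a \<in> u" "b \<in> u"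
  shows "a = b"
proof (rule ccontr)
  assume ab: "a \<noteq> b"
  have "card t = 3" "card u = 3" using assms(1-3) unfolding triangle_system_def threes_def by auto
  obtain p where p: "t = {a,b,p}" "p \<noteq> a" "p \<noteq> b" using third[OF \<open>card t = 3\<close> assms(5,6) ab] .
  obtain q where q: "u = {a,b,q}" "q \<noteq> a" "q \<noteq> b" using third[OF \<open>card u = 3\<close> assms(7,8) ab] .
  have "p \<noteq> q" using p q assms(4) by metis
  then have "distinct [a,p,b,q]" using p q ab by simp
  moreover have "adj S a p" "adj S p b" using p by (auto intro!: adjI[OF assms(2)])
  moreover have "adj S b q" "adj S q a" using q by (auto intro!: adjI[OF assms(3)])
  ultimately show False by (rule triangle_system_square[OF assms(1)])
qed

lemma adj_sym: "adj S x y \<Longrightarrow> adj S y x"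
  unfolding adj_def by blast

lemma adj_insert: "adj S x y \<Longrightarrow> adj (insert t S) x y"
  unfolding adj_def by blast

text \<open>A common old neighbour \<open>z\<close> of two corners \<open>a\<close>,
  \<open>b\<close> of the new triangle gives the square \<open>a\<close> \<open>z\<close>
  \<open>b\<close> \<open>q\<close> with its third corner \<open>q\<close>; an old path
  \<open>a\<close> \<open>w\<close> \<open>z\<close> \<open>b\<close> closes a square with the new
  side. Hence old corners of a new triangle may be drawn from open pairs.\<close>

lemma not_blocked_new:
  assumes s: "triangle_system (insert t (blks T))" and t: "t \<notin> blks T" and ab: "a \<in> t" "b \<in> t" "a \<noteq> b"
  shows "\<not> blocked (neighbour_rows T) a b"
proof
  let ?A = "adj (blks T)" and ?B = "adj (insert t (blks T))"
  assume bl: "blocked (neighbour_rows T) a b"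
  have th: "threes (blks T)" using s unfolding triangle_system_def threes_def by simp
  have new: "\<not> ?A x y" if xy: "x \<in> t" "y \<in> t" for x y
  proof
    assume "?A x y"
    then obtain u where u: "u \<in> blks T" "x \<in> u" "y \<in> u" "x \<noteq> y" unfolding adj_def by blast
    then have "t \<noteq> u" using t by metis
    then show False using triangle_system_linear[OF s insertI1 insertI2[OF u(1)] _ xy u(2,3)] u(4) by simp
  qed
  have sq: False if "distinct [x,y,z,w]" "?B x y" "?B y z" "?B z w" "?B w x" for x y z w
    using triangle_system_square[OF s that] .
  have Bt: "?B x y" if "x \<in> t" "y \<in> t" "x \<noteq> y" for x y by (rule adjI[OF insertI1 that])
  have B: "?B x y" "?B y x" if "?A x y" for x y
    using adj_insert[OF that] adj_insert[OF adj_sym[OF that]] .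
  have irr: "x \<noteq> y" if "?A x y" for x y using that unfolding adj_def by simp
  obtain z where z: "z \<in> set (get (neighbour_rows T) b)"
    "z \<in> set (get (neighbour_rows T) a) \<or> (\<exists>w\<in>set (get (neighbour_rows T) a). z \<in> set (get (neighbour_rows T) w))"
    using bl unfolding blocked_def by blast
  have bz: "?A b z" using z(1) neighbour_rows_adj[OF th] by simp
  have d: "?A a z \<or> (\<exists>w. ?A a w \<and> ?A w z)" using z(2) neighbour_rows_adj[OF th] by auto
  have zt: "z \<notin> t" using new[OF ab(2)] bz by blast
  have za: "z \<noteq> a" "z \<noteq> b" using zt ab by blast+
  from d show False
  proof
    assume az: "?A a z"
    have "card t = 3" using s unfolding triangle_system_def threes_def by simp
    then obtain q where q: "t = {a,b,q}" "q \<noteq> a" "q \<noteq> b" using third ab by metis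
    have "q \<noteq> z" using q zt by blast
    then show False using sq[of a z b q] B[OF az] B[OF bz] Bt[of b q] Bt[of q a] q za ab by simp
  next
    assume "\<exists>w. ?A a w \<and> ?A w z"
    then obtain w where w: "?A a w" "?A w z" by blast
    have "w \<notin> t" using new[OF ab(1)] w by blast
    then have "w \<noteq> a" "w \<noteq> b" using ab by blast+
    then show False using sq[of a w z b] B[OF w(1)] B[OF w(2)] B[OF bz] Bt[OF ab(2,1)] irr[OF w(2)] za ab by simp
  qed
qed

section \<open>Degrees and weights\<close>

definition deg :: "vertex set set \<Rightarrow> vertex \<Rightarrow> nat" where
  "deg S v = card {t \<in> S. v \<in> t}"

definition weight :: "vertex set set \<Rightarrow> vertex set \<Rightarrow> nat" where
  "weight S t = (\<Sum>v\<in>t. priority (deg S v))"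

lemma deg_image: assumes "bij g" shows "deg ((image g) ` S) (g v) = deg S v"
proof -
  have inj: "inj g" using assms by (rule bij_is_inj)
  have "{t \<in> (image g) ` S. g v \<in> t} = (image g) ` {t \<in> S. v \<in> t}"
    using inj by (auto simp: inj_image_mem_iff inj_eq)
  moreover have "inj_on (image g) {t \<in> S. v \<in> t}" by (meson inj inj_image_eq_iff inj_onI)
  ultimately show ?thesis unfolding deg_def by (simp add: card_image)
qed

text \<open>This invariance is what makes the choice of a heaviest triangle compatible with passing
  to an isomorphic system.\<close>

lemma weight_image: assumes "bij g" shows "weight ((image g) ` S) (g ` t) = weight S t"
proof -
  have "inj_on g t" using assms by (meson bij_is_inj inj_on_subset subset_UNIV)
  then show ?thesis unfolding weight_def by (simp add: sum.reindex deg_image[OF assms])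
qed

text \<open>Equality of the two counts says that no triangle is listed twice, not even with its
  corners in another order. Then the lengths of the rows are the degrees.\<close>

definition sized :: "nat \<Rightarrow> tri list \<Rightarrow> bool" where
  "sized k T \<longleftrightarrow> length T = k \<and> card (blks T) = k"

lemma card_blks_le: "card (blks T) \<le> length T"
  unfolding blks_def using card_image_le[of "set T" blk] card_length[of T] by simp

lemma sized_Cons: "sized (Suc k) (t # T) \<Longrightarrow> sized k T \<and> blk t \<notin> blks T"
  using card_blks_le[of T] unfolding sized_def by (auto simp: card_insert_if split: if_splits)

lemma sized_inj: "sized k T \<Longrightarrow> inj_on blk (set T)"
  unfolding sized_def blks_def
  by (metis card_image_le card_length eq_card_imp_inj_on List.finite_set le_antisym)

lemma cnt_length: "cnt xs = length xs"
  by (induction xs) auto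

lemma cnt_triangle_rows: "sized k T \<Longrightarrow> threes (blks T) \<Longrightarrow> cnt (get (triangle_rows T) v) = deg (blks T) v"
proof (induction T arbitrary: k)
  case Nil
  then show ?case by (simp add: deg_def)
next
  case (Cons t T)
  obtain a b c where t: "t = (a,b,c)" by (cases t)
  obtain k' where k: "k = Suc k'" using Cons(2) unfolding sized_def by auto
  have s: "sized k' T" "blk t \<notin> blks T" using sized_Cons Cons(2) k by blast+
  have d: "distinct [a,b,c]" and th: "threes (blks T)" using Cons(3) unfolding t threes_Cons by blast+
  have IH: "cnt (get (triangle_rows T) v) = deg (blks T) v" using Cons(1)[OF s(1) th] .
  have "{u \<in> blks (t # T). v \<in> u} = (if v \<in> blk t then insert (blk t) {u \<in> blks T. v \<in> u} else {u \<in> blks T. v \<in> u})"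
    by auto
  then have "deg (blks (t # T)) v = (if v \<in> blk t then Suc (deg (blks T) v) else deg (blks T) v)"
    unfolding deg_def using s(2) by simp
  then show ?case using IH d unfolding t cnt_length by auto
qed

lemma key_weight: "sized k T \<Longrightarrow> threes (blks T) \<Longrightarrow> distinct [a,b,c] \<Longrightarrow> key (triangle_rows T) a b c = weight (blks T) {a,b,c}"
  unfolding key_def weight_def by (simp add: cnt_triangle_rows)

lemma below_iff: "below tr T m \<longleftrightarrow> (\<forall>(a,b,c)\<in>set T. key tr a b c \<le> m)"
  by (induction tr T m rule: below.induct) auto

lemma heaviest_if:
  assumes "sized k T" "threes (blks ((a,b,c) # T))" "{a,b,c} \<notin> blks T"
    and w: "\<forall>t\<in>blks T. weight (insert {a,b,c} (blks T)) t \<le> weight (insert {a,b,c} (blks T)) {a,b,c}"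
  shows "heaviest T a b c (add_triangle a b c (triangle_rows T))"
proof -
  have s: "sized (Suc k) ((a,b,c) # T)" using assms(1,3) unfolding sized_def by simp
  have k: "key (triangle_rows ((a,b,c) # T)) x y z = weight (insert {a,b,c} (blks T)) {x,y,z}" if "distinct [x,y,z]" for x y z
    using key_weight[OF s assms(2) that] by simp
  have d: "distinct [a,b,c]" and th: "threes (blks T)" using assms(2) unfolding threes_Cons by blast+
  have "key (triangle_rows ((a,b,c) # T)) x y z \<le> key (triangle_rows ((a,b,c) # T)) a b c" if "(x,y,z) \<in> set T" for x y z
  proof -
    have m: "{x,y,z} \<in> blks T" using imageI[OF that, of blk] by (simp add: blks_def)
    then have "card {x,y,z} = 3" using th by (simp only: threes_def)
    then have "distinct [x,y,z]" by (simp only: card3)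
    then show ?thesis using k[OF \<open>distinct [x,y,z]\<close>] k[OF d] w m by metis
  qed
  moreover have "add_triangle a b c (triangle_rows T) = triangle_rows ((a,b,c) # T)" by (simp add: add_triangle_def)
  ultimately show ?thesis unfolding heaviest_def below_iff by (metis (no_types, lifting) case_prodI2)
qed

section \<open>Completeness of the extensions\<close>

lemma pend_filter: "pend tr vs = filter (\<lambda>v. cnt (get tr v) = 1) vs"
  by (induction vs) auto

lemma set_pend: "set (pend tr vs) = {v \<in> set vs. cnt (get tr v) = 1}"
  by (simp add: pend_filter)

lemma used_filter: "used tr vs = filter (\<lambda>v. cnt (get tr v) \<noteq> 0) vs"
  by (induction vs) auto

lemma fresh_filter: "fresh tr vs = filter (\<lambda>v. cnt (get tr v) = 0) vs"
  by (induction vs) auto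

lemma diff_filter: "diff xs ys = filter (\<lambda>x. x \<notin> set ys) xs"
  by (induction xs) auto

lemma tail_tl: "tail xs = tl xs"
  by (cases xs) auto

lemma set_tl: "x \<in> set (tl xs) \<Longrightarrow> x \<in> set xs"
  by (cases xs) auto

lemma set_nonreps: "v \<in> set (nonreps tr T) \<longleftrightarrow> (\<exists>(a,b,c)\<in>set T. v \<in> set (tl (pend tr [a,b,c])))"
  by (induction tr T rule: nonreps.induct) (auto simp: tail_tl simp del: pend.simps)

section \<open>A normal form for the added triangle\<close>

definition free :: "tri list \<Rightarrow> vertex list" where
  "free T = fresh (triangle_rows T) vertices"

definition bad :: "tri list \<Rightarrow> nat \<Rightarrow> vertex set" where
  "bad T n = set (nonreps (triangle_rows T) T) \<union> (set (free T) - set (take n (free T)))"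

lemma deg_eq_0: "deg S v = 0 \<longleftrightarrow> (\<forall>t\<in>S. v \<notin> t)"
  unfolding deg_def by auto

lemma deg_eq_1: "deg S v = 1 \<Longrightarrow> t \<in> S \<Longrightarrow> v \<in> t \<Longrightarrow> u \<in> S \<Longrightarrow> v \<in> u \<Longrightarrow> u = t"
proof -
  assume d: "deg S v = 1" and m: "t \<in> S" "v \<in> t" "u \<in> S" "v \<in> u"
  from d obtain w where w: "{t \<in> S. v \<in> t} = {w}" unfolding deg_def by (rule card_1_singletonE)
  have "t \<in> {t \<in> S. v \<in> t}" "u \<in> {t \<in> S. v \<in> t}" using m by simp_all
  then show "u = t" unfolding w by simp
qed

lemma set_free:
  assumes "sized k T" "threes (blks T)"
  shows "v \<in> set (free T) \<longleftrightarrow> (\<forall>t\<in>blks T. v \<notin> t)"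
  using cnt_triangle_rows[OF assms] by (simp add: free_def fresh_filter set_vertices deg_eq_0)

lemma distinct_free: "distinct (free T)"
  by (simp add: free_def fresh_filter distinct_vertices)

lemma mem_blks: "(a,b,c) \<in> set T \<Longrightarrow> {a,b,c} \<in> blks T"
  unfolding blks_def by (metis blk_simp imageI)

text \<open>A vertex excluded from the normal form has an admissible twin, that is, a vertex in the same triangles.\<close>

lemma swap_partner:
  assumes s: "sized k T" and ts: "triangle_system (insert t (blks T))" and t: "t \<notin> blks T"
    and n: "card (t \<inter> set (free T)) = n" and v: "v \<in> t" "v \<in> bad T n"
  shows "\<exists>u. u \<notin> bad T n \<and> u \<notin> t \<and> (\<forall>w\<in>blks T. u \<in> w \<longleftrightarrow> v \<in> w)"
proof -
  have th: "threes (blks T)" using ts unfolding triangle_system_def threes_def by simp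
  note cnt = cnt_triangle_rows[OF s th]
  show ?thesis
  proof (cases "v \<in> set (nonreps (triangle_rows T) T)")
    case True
    then obtain a b c where abc: "(a,b,c) \<in> set T" and vt: "v \<in> set (tl (pend (triangle_rows T) [a,b,c]))"
      unfolding set_nonreps by blast
    let ?P = "pend (triangle_rows T) [a,b,c]"
    have m: "{a,b,c} \<in> blks T" using abc by (rule mem_blks)
    then have "card {a,b,c} = 3" using th by (simp only: threes_def)
    then have d: "distinct [a,b,c]" by (simp only: card3)
    then have dP: "distinct ?P" unfolding pend_filter by (rule distinct_filter)
    \<comment> \<open>The first vertex of degree one in the triangle serves as the twin: both lie in
      this triangle and in no other.\<close>
    obtain u q where uq: "?P = u # q" using vt by (cases ?P) auto
    have vq: "v \<in> set q" using vt uq by simp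
    have "u \<in> set ?P" "v \<in> set ?P" using uq vq by simp_all
    then have u: "u \<in> {a,b,c}" "deg (blks T) u = 1" and v1: "v \<in> {a,b,c}" "deg (blks T) v = 1"
      unfolding set_pend cnt by simp_all
    have "u \<noteq> v" using dP uq vq by auto
    have tw: "\<forall>w\<in>blks T. u \<in> w \<longleftrightarrow> v \<in> w"
      using deg_eq_1[OF u(2) m u(1)] deg_eq_1[OF v1(2) m v1(1)] u(1) v1(1) by blast
    have "t \<noteq> {a,b,c}" using m t by metis
    \<comment> \<open>A new triangle through both twins would share two vertices with the old
      one.\<close>
    then have "u = v" if "u \<in> t"
      using triangle_system_linear[OF ts insertI1 insertI2[OF m] _ that v(1) u(1) v1(1)] by simp
    then have ut: "u \<notin> t" using \<open>u \<noteq> v\<close> by blast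
    have "u \<notin> set (free T)" using set_free[OF s th, of u] m u(1) by metis
    moreover have "u \<notin> set (nonreps (triangle_rows T) T)"
    proof
      assume "u \<in> set (nonreps (triangle_rows T) T)"
      then obtain x y z where xyz: "(x,y,z) \<in> set T" and ux: "u \<in> set (tl (pend (triangle_rows T) [x,y,z]))"
        unfolding set_nonreps by blast
      have "u \<in> set (pend (triangle_rows T) [x,y,z])" using ux by (rule set_tl)
      then have "u \<in> {x,y,z}" unfolding set_pend by simp
      then have "{x,y,z} = {a,b,c}" using deg_eq_1[OF u(2) m u(1) mem_blks[OF xyz]] by simp
      then have "blk (x,y,z) = blk (a,b,c)" by simp
      \<comment> \<open>Different list entries are different as sets, so the triangle found is the
        same entry, and the head of its list of degree-one vertices cannot recur in the
        tail.\<close>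
      then have "(x,y,z) = (a,b,c)" using sized_inj[OF s] xyz abc by (meson inj_onD)
      then show False using ux uq dP by simp
    qed
    ultimately show ?thesis using tw ut unfolding bad_def by blast
  next
    case False
    let ?F = "set (free T)" and ?N = "set (take n (free T))"
    have vF: "v \<in> ?F" "v \<notin> ?N" using v(2) False unfolding bad_def by auto
    have "card (t \<inter> ?F) \<le> card ?F" by (rule card_mono) auto
    then have "n \<le> length (free T)" using n card_length[of "free T"] by simp
    then have cN: "card ?N = n" using distinct_card[OF distinct_take[OF distinct_free]] by simp
    \<comment> \<open>Otherwise \<open>t\<close> would contain the first \<open>n\<close> free
      vertices and also \<open>v\<close>, which makes \<open>n + 1\<close> free corners.\<close>
    have "\<not> ?N \<subseteq> t"
    proof
      assume "?N \<subseteq> t"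
      then have "insert v ?N \<subseteq> t \<inter> ?F" using v(1) vF(1) set_take_subset[of n "free T"] by blast
      then have "card (insert v ?N) \<le> n" using n card_mono[of "t \<inter> ?F" "insert v ?N"] by simp
      then show False using vF(2) cN by simp
    qed
    then obtain u where u: "u \<in> ?N" "u \<notin> t" by blast
    have uF: "u \<in> ?F" using u(1) set_take_subset[of n "free T"] by blast
    have tw: "\<forall>w\<in>blks T. u \<in> w \<longleftrightarrow> v \<in> w" using set_free[OF s th] uF vF(1) by blast
    have "u \<notin> set (nonreps (triangle_rows T) T)"
    proof
      assume "u \<in> set (nonreps (triangle_rows T) T)"
      then obtain x y z where xyz: "(x,y,z) \<in> set T" and ux: "u \<in> set (tl (pend (triangle_rows T) [x,y,z]))"
        unfolding set_nonreps by blast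
      have "u \<in> set (pend (triangle_rows T) [x,y,z])" using ux by (rule set_tl)
      then have "u \<in> {x,y,z}" unfolding set_pend by simp
      then show False using mem_blks[OF xyz] set_free[OF s th] uF by metis
    qed
    then show ?thesis using u tw unfolding bad_def by blast
  qed
qed

lemma normalise:
  assumes s: "sized k T"
  shows "triangle_system (insert t (blks T)) \<Longrightarrow> t \<notin> blks T \<Longrightarrow> card (t \<inter> set (free T)) = n
    \<Longrightarrow> \<exists>g. bij g \<and> (image g) ` blks T = blks T \<and> g ` t \<inter> bad T n = {}"
proof (induction "card (t \<inter> bad T n)" arbitrary: t rule: less_induct)
  case less
  show ?case
  proof (cases "t \<inter> bad T n = {}")
    case True
    then have "bij id \<and> (image id) ` blks T = blks T \<and> id ` t \<inter> bad T n = {}" by simp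
    then show ?thesis by blast
  next
    case False
    then obtain v where v: "v \<in> t" "v \<in> bad T n" by blast
    obtain u where u: "u \<notin> bad T n" "u \<notin> t" "\<forall>w\<in>blks T. u \<in> w \<longleftrightarrow> v \<in> w"
      using swap_partner[OF s less(2-4) v] by blast
    define g where "g = transpose u v"
    have bij: "bij g" unfolding g_def by simp
    have inj: "inj g" using bij by (rule bij_is_inj)
    have fixed: "g ` w = w" if "w \<in> blks T" for w unfolding g_def using u(3) that by simp
    then have K: "(image g) ` blks T = blks T" by simp
    have th: "threes (blks T)" using less(2) unfolding triangle_system_def threes_def by simp
    have "u \<in> set (free T) \<longleftrightarrow> v \<in> set (free T)" using set_free[OF s th] u(3) by blast
    then have F: "g ` set (free T) = set (free T)" unfolding g_def by simp
    have gt: "g ` t = insert u (t - {v})"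
    proof -
      have "g ` (t - {v}) = t - {v}" unfolding g_def using u(2) by simp
      moreover have "g v = u" by (simp add: g_def)
      ultimately show ?thesis using v(1) by (metis image_insert insert_Diff)
    qed
    have "g ` t \<inter> bad T n = (t \<inter> bad T n) - {v}" unfolding gt using u(1) by blast
    then have lt: "card (g ` t \<inter> bad T n) < card (t \<inter> bad T n)"
      using v card_Diff1_less[of "t \<inter> bad T n" v] by simp
    have 1: "triangle_system (insert (g ` t) (blks T))" using triangle_system_image[OF bij less(2)] K by simp
    have 2: "g ` t \<notin> blks T"
    proof
      assume "g ` t \<in> blks T"
      then have "g ` (g ` t) = g ` t" by (rule fixed)
      then have "g ` t = t" by (simp only: inj_image_eq_iff[OF inj])
      then show False using \<open>g ` t \<in> blks T\<close> less(3) by simp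
    qed
    have "g ` (t \<inter> set (free T)) = g ` t \<inter> set (free T)"
      unfolding image_Int[OF inj] F ..
    moreover have "card (g ` (t \<inter> set (free T))) = card (t \<inter> set (free T))"
      by (rule card_image[OF inj_on_subset[OF inj subset_UNIV]])
    ultimately have 3: "card (g ` t \<inter> set (free T)) = n" using less(4) by simp
    have "\<exists>h. bij h \<and> (image h) ` blks T = blks T \<and> h ` (g ` t) \<inter> bad T n = {}"
      by (rule less(1)[OF lt 1 2 3])
    then obtain h where h: "bij h" "(image h) ` blks T = blks T" "h ` (g ` t) \<inter> bad T n = {}"
      by (elim exE conjE)
    have "(image (h \<circ> g)) ` blks T = (image h) ` ((image g) ` blks T)"
      unfolding image_image image_comp[symmetric] by (rule refl)
    then have "(image (h \<circ> g)) ` blks T = blks T" unfolding K h(2) .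
    moreover have "(h \<circ> g) ` t \<inter> bad T n = {}" using h(3) unfolding image_comp .
    ultimately show ?thesis using bij_comp[OF bij h(1)] by (intro exI[of _ "h \<circ> g"] conjI)
  qed
qed

section \<open>The candidates are exhaustive\<close>

definition reps :: "tri list \<Rightarrow> vertex list" where
  "reps T = diff (used (triangle_rows T) vertices) (nonreps (triangle_rows T) T)"

definition pairs :: "tri list \<Rightarrow> edge list" where
  "pairs T = opens (neighbour_rows T) (reps T)"

lemma set_tri1: "set (tri1 u v r es) = {(u,v,y) | y. (v,y) \<in> set r \<and> haspair es u y}"
  by (induction u v r es rule: tri1.induct) auto

lemma set_ext0: "set (ext0 r es) = {(u,v,y). (u,v) \<in> set r \<and> (v,y) \<in> set es \<and> haspair es u y}"
  by (induction r es rule: ext0.induct) (auto simp: set_tri1)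

lemma extension_listed:
  assumes s: "sized k T" and ts: "triangle_system (insert t (blks T))" and t: "t \<notin> blks T"
    and n: "card (t \<inter> set (free T)) = n" and b: "t \<inter> bad T n = {}"
  shows "\<exists>(a,b,c)\<in>set (exts (free T) (reps T) (pairs T)). t = {a,b,c}"
proof -
  have th: "threes (blks T)" using ts unfolding triangle_system_def threes_def by simp
  have t3: "card t = 3" using ts unfolding triangle_system_def threes_def by simp
  let ?F = "set (free T)" and ?N = "set (take n (free T))"
  have "t \<inter> ?F \<subseteq> ?N" using b unfolding bad_def by blast
  moreover have "card ?N \<le> n" using card_length[of "take n (free T)"] by simp
  ultimately have tF: "t \<inter> ?F = ?N" using n by (intro card_seteq) auto
  then have "card ?N = n" using n by simp
  then have len: "n \<le> length (free T)" using card_length[of "take n (free T)"] by simp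
  have "card (t - ?F) = 3 - n" using card_Diff_subset_Int[of t ?F] n t3 by simp
  moreover have "n \<le> 3" using n t3 card_mono[of t "t \<inter> ?F"] by simp
  ultimately have c: "card (t - ?F) = 3 - n" "n \<le> 3" by simp_all
  have tR: "t - ?F \<subseteq> set (reps T)"
    using b unfolding bad_def reps_def free_def diff_filter used_filter fresh_filter by (auto simp: set_vertices)
  have tu: "t = (t - ?F) \<union> ?N" using tF by blast
  have pr: "(x,y) \<in> set (pairs T) \<or> (y,x) \<in> set (pairs T)" if "x \<in> t - ?F" "y \<in> t - ?F" "x \<noteq> y" for x y
    using opens_pair[of x "reps T" y "neighbour_rows T"] that tR not_blocked_new[OF ts t] unfolding pairs_def by blast
  let ?G = "\<lambda>xs. \<exists>(a,b,c)\<in>set xs. t = {a,b,c}"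
  have "?G (ext3 (free T)) \<or> ?G (ext2 (free T) (reps T)) \<or> ?G (ext1 (free T) (pairs T)) \<or> ?G (ext0 (pairs T) (pairs T))"
  proof -
    consider "n = 0" | "n = 1" | "n = 2" | "n = 3" using c(2) by linarith
    then show ?thesis
    proof cases
      case 1
      then obtain x y z where d: "distinct [x,y,z]" and xyz: "t - ?F = {x,y,z}"
        using c(1) card_3_iff[of "t - ?F"] by auto
      have tx: "t = {x,y,z}" using tu xyz 1 by simp
      let ?p = "\<lambda>a b. (a,b) \<in> set (pairs T)"
      have p: "?p x y \<or> ?p y x" "?p y z \<or> ?p z y" "?p x z \<or> ?p z x" using pr d unfolding xyz by auto
      have e: "?G (ext0 (pairs T) (pairs T))"
        if "?p u v" "?p v w" "?p u w \<or> ?p w u" "{x,y,z} = {u,v,w}" for u v w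
      proof -
        have "(u,v,w) \<in> set (ext0 (pairs T) (pairs T))" unfolding set_ext0 haspair_iff using that by simp
        then show ?thesis using that(4) tx by blast
      qed
      \<comment> \<open>Each pair is listed in some direction, and every tournament on three
        vertices has a path through all of them; \<open>ext0\<close> follows such a path and accepts
        the closing pair in either direction.\<close>
      have "{x,y,z} = {x,z,y}" "{x,y,z} = {y,x,z}" "{x,y,z} = {y,z,x}" "{x,y,z} = {z,x,y}" "{x,y,z} = {z,y,x}" by blast+
      then have "?G (ext0 (pairs T) (pairs T))" using p e by metis
      then show ?thesis by blast
    next
      case 2
      then obtain f fs where f: "free T = f # fs" using len by (cases "free T") auto
      obtain x y where d: "x \<noteq> y" and xy: "t - ?F = {x,y}" using 2 c(1) card_2_iff[of "t - ?F"] by auto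
      have tx: "t = {x,y,f}" "t = {y,x,f}" using tu xy 2 f by auto
      have "(x,y) \<in> set (pairs T) \<or> (y,x) \<in> set (pairs T)" using pr d unfolding xy by simp
      then have "(x,y,f) \<in> set (ext1 (free T) (pairs T)) \<or> (y,x,f) \<in> set (ext1 (free T) (pairs T))"
        unfolding f by force
      then show ?thesis using tx by blast
    next
      case 3
      then obtain f g fs where f: "free T = f # g # fs" using len
        by (cases "free T"; cases "tl (free T)") auto
      obtain x where x: "t - ?F = {x}" using 3 c(1) card_1_singletonE[of "t - ?F"] by auto
      have tx: "t = {x,f,g}" using tu x 3 f by auto
      have "(x,f,g) \<in> set (ext2 (free T) (reps T))" using tR x unfolding f by simp
      then show ?thesis using tx by blast
    next
      case 4
      then obtain f g h fs where f: "free T = f # g # h # fs" using len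
        by (cases "free T"; cases "tl (free T)"; cases "tl (tl (free T))") auto
      have "t - ?F = {}" using 4 c(1) by simp
      then have "t = {f,g,h}" using tu 4 f by (auto simp: numeral_3_eq_3)
      moreover have "(f,g,h) \<in> set (ext3 (free T))" unfolding f by simp
      ultimately show ?thesis by blast
    qed
  qed
  then show ?thesis unfolding exts_def by (auto simp: Bex_def)
qed

text \<open>A new system represents its candidate by the identity, a discarded candidate is
  represented by an earlier system through the certified permutation. Keeping track of
  \<open>sized\<close> allows the inclusion stated here to be sharpened to an equality
  later.\<close>

lemma extend_by_sound:
  "extend_by T (triangle_rows T) cs as Ts = Some Ts' \<Longrightarrow> sized k T \<Longrightarrow> \<forall>U\<in>set Ts. sized (Suc k) U
    \<Longrightarrow> set Ts \<subseteq> set Ts' \<and> (\<forall>U\<in>set Ts'. sized (Suc k) U)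
      \<and> (\<forall>(a,b,c)\<in>set cs. heaviest T a b c (add_triangle a b c (triangle_rows T))
          \<longrightarrow> (\<exists>U\<in>set Ts'. \<exists>g. bij g \<and> (image g) ` blks U \<subseteq> blks ((a,b,c) # T)))"
proof (induction cs arbitrary: as Ts)
  case Nil
  then show ?case by simp
next
  case (Cons t cs)
  obtain a b c where t: "t = (a,b,c)" by (cases t)
  let ?tr = "add_triangle a b c (triangle_rows T)"
  let ?P = "\<lambda>Us a b c. \<exists>U\<in>set Us. \<exists>g. bij g \<and> (image g) ` blks U \<subseteq> blks ((a,b,c) # T)"
  \<comment> \<open>Skipping a candidate, recording it and identifying it are brought to a common
    form, with \<open>Ts1\<close> the list after this one candidate.\<close>
  have "\<exists>as' Ts1. extend_by T (triangle_rows T) cs as' Ts1 = Some Ts' \<and> set Ts \<subseteq> set Ts1 \<and> (\<forall>U\<in>set Ts1. sized (Suc k) U)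
     \<and> (heaviest T a b c ?tr \<longrightarrow> ?P Ts1 a b c)"
  proof (cases "heaviest T a b c ?tr")
    case False
    then have "extend_by T (triangle_rows T) cs as Ts = Some Ts'" using Cons(2) unfolding t by simp
    then show ?thesis using Cons(4) False by blast
  next
    case True
    then obtain act as' where as: "as = act # as'" using Cons(2) unfolding t by (cases as) auto
    show ?thesis
    proof (cases act)
      case Y
      then have d: "fresh_list [a,b,c] (const False)" and h: "\<not> haspair (get (triangle_rows T) a) b c"
        and g: "extend_by T (triangle_rows T) cs as' (((a,b,c) # T) # Ts) = Some Ts'"
        using Cons(2) True unfolding t as by (auto split: if_splits simp del: fresh_list.simps)
      have "distinct [a,b,c]" using d unfolding fresh_list_iff by blast
      then have "{a,b,c} \<notin> blks T" using h blk_triangle_rows by blast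
      then have "sized (Suc k) ((a,b,c) # T)" using Cons(3) unfolding sized_def by simp
      moreover have "?P (((a,b,c) # T) # Ts) a b c"
      proof -
        have "bij id \<and> (image id) ` blks ((a,b,c) # T) \<subseteq> blks ((a,b,c) # T)" by simp
        then show ?thesis by (meson list.set_intros(1))
      qed
      ultimately show ?thesis using g Cons(4) by (intro exI[of _ as'] exI[of _ "((a,b,c) # T) # Ts"]) auto
    next
      case (S i p)
      then obtain U where U: "item Ts i = Some U" and d: "fresh_list (entries (perm p)) (const False)" and m: "tmaps (perm p) U ?tr"
        and g: "extend_by T (triangle_rows T) cs as' Ts = Some Ts'"
        using Cons(2) True unfolding t as by (auto split: if_splits option.splits)
      have "?tr = triangle_rows ((a,b,c) # T)" by (simp add: add_triangle_def)
      then have "(image (get (perm p))) ` blks U \<subseteq> blks ((a,b,c) # T)" using tmaps_blks m by metis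
      then have "?P Ts a b c" using bij_get[OF d] item_set[OF U] by blast
      then show ?thesis using g Cons(4) by (intro exI[of _ as'] exI[of _ Ts]) simp
    qed
  qed
  then obtain as' Ts1 where *: "extend_by T (triangle_rows T) cs as' Ts1 = Some Ts'" "set Ts \<subseteq> set Ts1"
    "\<forall>U\<in>set Ts1. sized (Suc k) U" "heaviest T a b c ?tr \<longrightarrow> ?P Ts1 a b c" by (elim exE conjE)
  have IH: "set Ts1 \<subseteq> set Ts' \<and> (\<forall>U\<in>set Ts'. sized (Suc k) U)
      \<and> (\<forall>(a,b,c)\<in>set cs. heaviest T a b c (add_triangle a b c (triangle_rows T)) \<longrightarrow> ?P Ts' a b c)"
    by (rule Cons(1)[OF *(1) Cons(3) *(3)])
  then have "heaviest T a b c ?tr \<longrightarrow> ?P Ts' a b c" using *(4) by (meson subsetD)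
  then show ?case using IH *(2) unfolding t by (simp add: subset_trans)
qed

lemma extend_system_sound:
  assumes "extend_system T as Ts = Some Ts'" "sized k T" "\<forall>U\<in>set Ts. sized (Suc k) U"
  shows "set Ts \<subseteq> set Ts'" "\<forall>U\<in>set Ts'. sized (Suc k) U"
    "\<And>a b c. (a,b,c) \<in> set (exts (free T) (reps T) (pairs T)) \<Longrightarrow> heaviest T a b c (add_triangle a b c (triangle_rows T))
          \<Longrightarrow> \<exists>U\<in>set Ts'. \<exists>g. bij g \<and> (image g) ` blks U \<subseteq> blks ((a,b,c) # T)"
proof -
  have "extend_by T (triangle_rows T) (exts (free T) (reps T) (pairs T)) as Ts = Some Ts'"
    using assms(1) by (simp add: extend_system_def extend_system1_def extend_system2_def free_def reps_def pairs_def)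
  note * = extend_by_sound[OF this assms(2,3)]
  show "set Ts \<subseteq> set Ts'" "\<forall>U\<in>set Ts'. sized (Suc k) U" using * by simp_all
  fix a b c assume "(a,b,c) \<in> set (exts (free T) (reps T) (pairs T))" "heaviest T a b c (add_triangle a b c (triangle_rows T))"
  then show "\<exists>U\<in>set Ts'. \<exists>g. bij g \<and> (image g) ` blks U \<subseteq> blks ((a,b,c) # T)" using * by fast
qed

lemma extend_sound:
  "extend Us ass Ts = Some Ts' \<Longrightarrow> \<forall>U\<in>set Us. sized k U \<Longrightarrow> \<forall>U\<in>set Ts. sized (Suc k) U
    \<Longrightarrow> set Ts \<subseteq> set Ts' \<and> (\<forall>U\<in>set Ts'. sized (Suc k) U)
      \<and> (\<forall>T\<in>set Us. \<forall>a b c. (a,b,c) \<in> set (exts (free T) (reps T) (pairs T)) \<longrightarrow> heaviest T a b c (add_triangle a b c (triangle_rows T))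
          \<longrightarrow> (\<exists>U\<in>set Ts'. \<exists>g. bij g \<and> (image g) ` blks U \<subseteq> blks ((a,b,c) # T)))"
proof (induction Us ass Ts rule: extend.induct)
  case (3 T Us as ass Ts)
  obtain Ts1 where g: "extend_system T as Ts = Some Ts1" "extend Us ass Ts1 = Some Ts'"
    using 3(2) by (auto split: option.splits)
  have s: "sized k T" using 3(3) by simp
  note a = extend_system_sound[OF g(1) s 3(4)]
  have IH: "set Ts1 \<subseteq> set Ts' \<and> (\<forall>U\<in>set Ts'. sized (Suc k) U)
      \<and> (\<forall>T\<in>set Us. \<forall>a b c. (a,b,c) \<in> set (exts (free T) (reps T) (pairs T)) \<longrightarrow> heaviest T a b c (add_triangle a b c (triangle_rows T))
          \<longrightarrow> (\<exists>U\<in>set Ts'. \<exists>g. bij g \<and> (image g) ` blks U \<subseteq> blks ((a,b,c) # T)))"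
    using 3(1)[OF g(1) g(2) _ a(2)] 3(3) by simp
  have "\<exists>U\<in>set Ts'. \<exists>g. bij g \<and> (image g) ` blks U \<subseteq> blks ((x,y,z) # T)"
    if "(x,y,z) \<in> set (exts (free T) (reps T) (pairs T))" "heaviest T x y z (add_triangle x y z (triangle_rows T))" for x y z
    using a(3)[OF that] IH by (meson subsetD)
  then show ?case using IH a(1) by (simp add: subset_trans)
qed simp_all

section \<open>Completeness of each level\<close>

definition complete :: "nat \<Rightarrow> tri list list \<Rightarrow> bool" where
  "complete k Us \<longleftrightarrow> (\<forall>U\<in>set Us. sized k U)
     \<and> (\<forall>S. triangle_system S \<longrightarrow> card S = k \<longrightarrow> (\<exists>U\<in>set Us. \<exists>g. bij g \<and> S = (image g) ` blks U))"

lemma complete_0: "complete 0 [[]]"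
  using bij_id by (auto simp: complete_def sized_def)

text \<open>The normalising permutation maps the old system onto itself, so it changes neither
  degrees in it nor the comparison of weights in the enlarged system.\<close>

lemma heaviest_added:
  assumes s: "sized k T" and ts: "triangle_system (insert t (blks T))" and t: "t \<notin> blks T"
    and w: "\<forall>u\<in>blks T. weight (insert t (blks T)) u \<le> weight (insert t (blks T)) t"
  shows "\<exists>g a b c. bij g \<and> (image g) ` insert t (blks T) = blks ((a,b,c) # T)
    \<and> (a,b,c) \<in> set (exts (free T) (reps T) (pairs T)) \<and> heaviest T a b c (add_triangle a b c (triangle_rows T))"
proof -
  obtain g where g: "bij g" "(image g) ` blks T = blks T" "g ` t \<inter> bad T (card (t \<inter> set (free T))) = {}"
    using normalise[OF s ts t refl] by (elim exE conjE)
  have inj: "inj g" using g(1) by (rule bij_is_inj)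
  have th: "threes (blks T)" using ts unfolding triangle_system_def threes_def by simp
  have im: "(image g) ` insert t (blks T) = insert (g ` t) (blks T)" using g(2) by simp
  have 1: "triangle_system (insert (g ` t) (blks T))" using triangle_system_image[OF g(1) ts] im by simp
  have 2: "g ` t \<notin> blks T"
  proof
    assume "g ` t \<in> blks T"
    then have "g ` t \<in> (image g) ` blks T" using g(2) by simp
    then obtain u where u: "u \<in> blks T" "g ` t = g ` u" by blast
    then have "t = u" by (simp only: inj_image_eq_iff[OF inj])
    then show False using u(1) t by simp
  qed
  have fr: "g v \<in> set (free T) \<longleftrightarrow> v \<in> set (free T)" for v
  proof -
    have "deg (blks T) (g v) = deg (blks T) v" using deg_image[OF g(1), of "blks T" v] g(2) by simp
    then show ?thesis unfolding set_free[OF s th] deg_eq_0[symmetric] by simp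
  qed
  have "g ` t \<inter> set (free T) = g ` (t \<inter> set (free T))" using fr by auto
  then have 3: "card (g ` t \<inter> set (free T)) = card (t \<inter> set (free T))"
    using card_image[OF inj_on_subset[OF inj subset_UNIV]] by metis
  obtain a b c where abc: "(a,b,c) \<in> set (exts (free T) (reps T) (pairs T))" "g ` t = {a,b,c}"
    using extension_listed[OF s 1 2 3 g(3)] by blast
  have W: "weight (insert (g ` t) (blks T)) (g ` u) = weight (insert t (blks T)) u" for u
    using weight_image[OF g(1), of "insert t (blks T)" u] im by simp
  have "\<forall>u\<in>(image g) ` blks T. weight (insert (g ` t) (blks T)) u \<le> weight (insert (g ` t) (blks T)) (g ` t)"
    using w W by simp
  then have "\<forall>u\<in>blks T. weight (insert {a,b,c} (blks T)) u \<le> weight (insert {a,b,c} (blks T)) {a,b,c}"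
    unfolding g(2) abc(2) .
  moreover have "threes (blks ((a,b,c) # T))" using 1 unfolding abc(2) triangle_system_def by simp
  ultimately have "heaviest T a b c (add_triangle a b c (triangle_rows T))"
    using heaviest_if[OF s] 2 unfolding abc(2) by simp
  moreover have "(image g) ` insert t (blks T) = blks ((a,b,c) # T)" using im abc(2) by simp
  ultimately show ?thesis using g(1) abc(1) by blast
qed

text \<open>Removing a heaviest triangle from \<open>S\<close> leaves a system isomorphic to a
  recorded \<open>T\<close>. Transported to \<open>T\<close>, the removed triangle becomes, after
  normalisation, a listed candidate that passes the maximality test, so it has a representative in
  \<open>Ts\<close>. The permutations are then composed back to \<open>S\<close>.\<close>

lemma complete_Suc:
  assumes c: "complete k Us" and g: "extend Us ass [] = Some Ts"
  shows "complete (Suc k) Ts"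
proof -
  have sz: "\<forall>U\<in>set Us. sized k U" using c unfolding complete_def by blast
  note G = extend_sound[OF g sz]
  have "\<exists>U\<in>set Ts. \<exists>g. bij g \<and> S = (image g) ` blks U" if S: "triangle_system S" "card S = Suc k" for S
  proof -
    have "S \<noteq> {}" using S(2) by auto
    then obtain t where t: "t \<in> S" "\<forall>u\<in>S. weight S u \<le> weight S t"
    proof -
      have "Max (weight S ` S) \<in> weight S ` S" using \<open>S \<noteq> {}\<close> by (intro Max_in) simp_all
      then obtain t where t: "t \<in> S" "Max (weight S ` S) = weight S t" by blast
      have "weight S u \<le> weight S t" if "u \<in> S" for u
        unfolding t(2)[symmetric] using that by (intro Max_ge) simp_all
      then show thesis using t(1) that by blast
    qed
    have "card (S - {t}) = k" using S(2) t(1) by simp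
    moreover have "triangle_system (S - {t})" using triangle_system_subset[OF S(1)] by blast
    ultimately obtain T f where T: "T \<in> set Us" "bij f" "S - {t} = (image f) ` blks T"
      using c unfolding complete_def by metis
    have s: "sized k T" using sz T(1) by blast
    let ?f = "inv f" let ?t = "inv f ` t"
    have bf: "bij ?f" using T(2) by (rule bij_imp_bij_inv)
    have S': "(image ?f) ` S = insert ?t (blks T)"
    proof -
      have "S = insert t ((image f) ` blks T)" using T(3) t(1) by blast
      then show ?thesis using image_inv_image[OF T(2), of "blks T"] by simp
    qed
    have ff: "f ` (?f ` x) = x" for x by (rule image_f_inv_f[OF bij_is_surj[OF T(2)]])
    have 2: "?t \<notin> blks T"
    proof
      assume "?t \<in> blks T"
      then have "f ` ?t \<in> S - {t}" unfolding T(3) by (rule imageI)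
      then show False unfolding ff by simp
    qed
    have 1: "triangle_system (insert ?t (blks T))" using triangle_system_image[OF bf S(1)] S' by simp
    have W: "weight (insert ?t (blks T)) (?f ` u) = weight S u" for u
      using weight_image[OF bf, of S u] S' by simp
    have "weight (insert ?t (blks T)) u \<le> weight (insert ?t (blks T)) ?t" if "u \<in> blks T" for u
    proof -
      have "u \<in> (image ?f) ` S" using that S' by simp
      then obtain x where "x \<in> S" "u = ?f ` x" by blast
      then show ?thesis using W t(2) by simp
    qed
    then obtain h a b c where h: "bij h" "(image h) ` insert ?t (blks T) = blks ((a,b,c) # T)"
      and e: "(a,b,c) \<in> set (exts (free T) (reps T) (pairs T))" "heaviest T a b c (add_triangle a b c (triangle_rows T))"
      using heaviest_added[OF s 1 2] by blast
    obtain U g where U: "U \<in> set Ts" "bij g" "(image g) ` blks U \<subseteq> blks ((a,b,c) # T)"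
      using G T(1) e by (simp add: Bex_def) blast
    have "card (blks U) = Suc k" using G U(1) unfolding sized_def by simp
    moreover have "card ((image g) ` blks U) = card (blks U)"
      using U(2) by (intro card_image inj_onI) (simp add: inj_image_eq_iff bij_is_inj)
    moreover have "card (blks ((a,b,c) # T)) \<le> Suc k"
      using s card_insert_le_m1[of "Suc k" "blks T"] unfolding sized_def by simp
    \<comment> \<open>The representative has \<open>Suc k\<close> triangles and the enlarged system
      has at most that many, so the inclusion is an equality.\<close>
    ultimately have eq: "(image g) ` blks U = blks ((a,b,c) # T)" using U(3) by (simp add: card_seteq)
    let ?q = "inv (h \<circ> ?f) \<circ> g"
    have bh: "bij (h \<circ> ?f)" by (rule bij_comp[OF bf h(1)])
    have "(image (h \<circ> ?f)) ` S = (image h) ` ((image ?f) ` S)"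
      unfolding image_image image_comp[symmetric] by (rule refl)
    then have "(image (h \<circ> ?f)) ` S = (image g) ` blks U" unfolding S' h(2) eq .
    then have "S = (image (inv (h \<circ> ?f))) ` ((image g) ` blks U)" using image_inv_image[OF bh, of S] by simp
    also have "\<dots> = (image ?q) ` blks U" unfolding image_image image_comp[symmetric] by (rule refl)
    finally have "S = (image ?q) ` blks U" .
    moreover have "bij ?q" by (rule bij_comp[OF U(2) bij_imp_bij_inv[OF bh]])
    ultimately show ?thesis using U(1) by blast
  qed
  then show ?thesis using G unfolding complete_def by simp
qed

lemma kills_sound: "kills Us cs \<Longrightarrow> U \<in> set Us \<Longrightarrow> \<not> crit E (blks U)"
  by (induction Us cs rule: kills.induct) (auto split: if_splits dest: killed_sound)

text \<open>Every graph with \<open>k\<close> triangles can be relabelled so that its triangles form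
  a recorded system; the refuted ones among these are ruled out.\<close>

lemma survivor:
  assumes "complete k (Us @ Vs)" "kills Vs cs" "crit E S" "card S = k"
  shows "\<exists>U\<in>set Us. \<exists>g. bij g \<and> crit (\<lambda>x y. E (g x) (g y)) (blks U)"
proof -
  obtain U g where U: "U \<in> set (Us @ Vs)" "bij g" "S = (image g) ` blks U"
    using assms(1,4) crit_triangle_system[OF assms(3)] unfolding complete_def by metis
  then have "crit (\<lambda>x y. E (g x) (g y)) (blks U)" using crit_pull[of g E "blks U"] assms(3) by simp
  then show ?thesis using U(1,2) kills_sound[OF assms(2), of U] by auto
qed

section \<open>The enumeration\<close>

text \<open>The variables \<open>r\<close> and \<open>l\<close> separate the computation from the
  matching: the extension is rewritten to a value, which is then compared with
  \<open>Some Ts\<close>, and the level may be written as a numeral.\<close>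

lemma complete_step:
  "complete k Us \<Longrightarrow> extend Us ass [] = r \<Longrightarrow> r = Some Ts \<Longrightarrow> Suc k = l \<Longrightarrow> complete l Ts"
  using complete_Suc by metis

lemma no_system:
  assumes "complete k Us" "kills Us cs" "crit E S"
  shows "card S \<noteq> k"
  using survivor[of k "[]" Us cs E S] assms by auto

lemma only_first:
  assumes "complete k (U # Us)" "kills Us cs" "crit E S" "card S = k"
  shows "\<exists>g. bij g \<and> crit (\<lambda>x y. E (g x) (g y)) (blks U)"
  using survivor[of k "[U]" Us cs E S] assms by auto

\<comment> \<open>The systems of a level are written nowhere; they arise as the result of the
  rewriting and instantiate \<open>?Us\<close>.\<close>
schematic_goal complete_1: "complete 1 ?Us"
  by (rule complete_step[OF complete_0, of ext_cert0], simp only: ext_cert0_def evaluate cong: if_weak_cong, rule refl, simp)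

schematic_goal complete_2: "complete 2 ?Us"
  by (rule complete_step[OF complete_1, of ext_cert1], simp only: ext_cert1_def evaluate cong: if_weak_cong, rule refl, simp)

schematic_goal complete_3: "complete 3 ?Us"
  by (rule complete_step[OF complete_2, of ext_cert2], simp only: ext_cert2_def evaluate cong: if_weak_cong, rule refl, simp)

schematic_goal complete_4: "complete 4 ?Us"
  by (rule complete_step[OF complete_3, of ext_cert3], simp only: ext_cert3_def evaluate cong: if_weak_cong, rule refl, simp)

schematic_goal complete_5: "complete 5 ?Us"
  by (rule complete_step[OF complete_4, of ext_cert4], simp only: ext_cert4_def evaluate cong: if_weak_cong, rule refl, simp)

schematic_goal complete_6: "complete 6 ?Us"
  by (rule complete_step[OF complete_5, of ext_cert5], simp only: ext_cert5_def evaluate cong: if_weak_cong, rule refl, simp)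

schematic_goal complete_7: "complete 7 ?Us"
  by (rule complete_step[OF complete_6, of ext_cert6], simp only: ext_cert6_def evaluate cong: if_weak_cong, rule refl, simp)

schematic_goal complete_8: "complete 8 ?Us"
  by (rule complete_step[OF complete_7, of ext_cert7], simp only: ext_cert7_def evaluate cong: if_weak_cong, rule refl, simp)

schematic_goal complete_9: "complete 9 ?Us"
  by (rule complete_step[OF complete_8, of ext_cert8], simp only: ext_cert8_def evaluate cong: if_weak_cong, rule refl, simp)

schematic_goal complete_10: "complete 10 ?Us"
  by (rule complete_step[OF complete_9, of ext_cert9], simp only: ext_cert9_def evaluate cong: if_weak_cong, rule refl, simp)

schematic_goal complete_11: "complete 11 ?Us"
  by (rule complete_step[OF complete_10, of ext_cert10], simp only: ext_cert10_def evaluate cong: if_weak_cong, rule refl, simp)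

\<comment> \<open>The certificate for level 11 contains no action, because none of the three systems
  has a candidate passing the maximality test. The resulting list is empty.\<close>
schematic_goal complete_12: "complete 12 ?Us"
  by (rule complete_step[OF complete_11, of ext_cert11], simp only: ext_cert11_def evaluate cong: if_weak_cong, rule refl, simp)

lemma no_system_0: "crit E S \<Longrightarrow> card S \<noteq> 0"
  by (rule no_system[OF complete_0, of kill_cert0]) (simp only: kill_cert0_def evaluate cong: if_weak_cong)

lemma no_system_1: "crit E S \<Longrightarrow> card S \<noteq> 1"
  by (rule no_system[OF complete_1, of kill_cert1]) (simp only: kill_cert1_def evaluate cong: if_weak_cong)

lemma no_system_2: "crit E S \<Longrightarrow> card S \<noteq> 2"
  by (rule no_system[OF complete_2, of kill_cert2]) (simp only: kill_cert2_def evaluate cong: if_weak_cong)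

lemma no_system_3: "crit E S \<Longrightarrow> card S \<noteq> 3"
  by (rule no_system[OF complete_3, of kill_cert3]) (simp only: kill_cert3_def evaluate cong: if_weak_cong)

lemma no_system_4: "crit E S \<Longrightarrow> card S \<noteq> 4"
  by (rule no_system[OF complete_4, of kill_cert4]) (simp only: kill_cert4_def evaluate cong: if_weak_cong)

lemma no_system_5: "crit E S \<Longrightarrow> card S \<noteq> 5"
  by (rule no_system[OF complete_5, of kill_cert5]) (simp only: kill_cert5_def evaluate cong: if_weak_cong)

lemma no_system_6: "crit E S \<Longrightarrow> card S \<noteq> 6"
  by (rule no_system[OF complete_6, of kill_cert6]) (simp only: kill_cert6_def evaluate cong: if_weak_cong)

lemma no_system_7: "crit E S \<Longrightarrow> card S \<noteq> 7"
  by (rule no_system[OF complete_7, of kill_cert7]) (simp only: kill_cert7_def evaluate cong: if_weak_cong)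

lemma no_system_8: "crit E S \<Longrightarrow> card S \<noteq> 8"
  by (rule no_system[OF complete_8, of kill_cert8]) (simp only: kill_cert8_def evaluate cong: if_weak_cong)

lemma no_system_9: "crit E S \<Longrightarrow> card S \<noteq> 9"
  by (rule no_system[OF complete_9, of kill_cert9]) (simp only: kill_cert9_def evaluate cong: if_weak_cong)

lemma no_system_10: "crit E S \<Longrightarrow> card S \<noteq> 10"
  by (rule no_system[OF complete_10, of kill_cert10]) (simp only: kill_cert10_def evaluate cong: if_weak_cong)

lemma only_11: "crit E S \<Longrightarrow> card S = 11 \<Longrightarrow> \<exists>g. bij g \<and> crit (\<lambda>x y. E (g x) (g y)) (blks triangles17)"
  unfolding triangles17_def
  by (rule only_first[OF complete_11, of kill_cert11]) (simp only: kill_cert11_def evaluate cong: if_weak_cong)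

section \<open>The exceptional graph\<close>

lemma card_crit:
  assumes "crit E S"
  shows "card S = 11"
proof -
  have "card S < 12"
  proof (rule ccontr)
    assume "\<not> card S < 12"
    \<comment> \<open>Subsets of triangle systems are triangle systems, so the absence of systems
      with exactly 12 triangles excludes all larger ones.\<close>
    then obtain S' where S': "S' \<subseteq> S" "card S' = 12"
      using obtain_subset_with_card_n[of 12 S] by auto
    then have "triangle_system S'" using triangle_system_subset[OF crit_triangle_system[OF assms]] by simp
    then show False using complete_12 S'(2) unfolding complete_def by auto
  qed
  then show ?thesis
    using no_system_0[OF assms] no_system_1[OF assms] no_system_2[OF assms] no_system_3[OF assms] no_system_4[OF assms] no_system_5[OF assms]
      no_system_6[OF assms] no_system_7[OF assms] no_system_8[OF assms] no_system_9[OF assms] no_system_10[OF assms] by presburger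
qed

section \<open>Two forced edges determine the graph\<close>

definition E17 :: "vertex \<Rightarrow> vertex \<Rightarrow> bool" where
  "E17 x y \<longleftrightarrow> mem y (get row17 x)"

lemma row17_eq: "add_edge vertex.J vertex.Q (add_edge vertex.A vertex.Q (neighbour_rows triangles17)) = row17"
  by (simp only: row17_def triangles17_def evaluate cong: if_weak_cong)

text \<open>Some open pair inside \<open>z\<close> must be an edge, and there is only one.\<close>

lemma forced_edge:
  assumes c: "crit E (blks triangles17)" and s: "within nr E" "covers nr (blks triangles17)"
    and h: "hits triangles17 (mark z (const False))" "indep nr (mark z (const False)) z" "opens nr z = [(a,b)]"
  shows "within (add_edge a b nr) E" "covers (add_edge a b nr) (blks triangles17)"
proof -
  have "E a b" using cover_step[OF c s h(1,2)] h(3) by simp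
  then show "within (add_edge a b nr) E" using within_adde[OF s(1)] crit_sym[OF c] by blast
  show "covers (add_edge a b nr) (blks triangles17)" by (rule covers_add_edge[OF s(2)])
qed

lemma zeros_1:
  "hits triangles17 (mark zeros1 (const False))" "indep (neighbour_rows triangles17) (mark zeros1 (const False)) zeros1"
  "opens (neighbour_rows triangles17) zeros1 = [(vertex.A,vertex.Q)]"
  by (simp_all only: triangles17_def zeros1_def evaluate cong: if_weak_cong)

lemma zeros_2:
  "hits triangles17 (mark zeros2 (const False))"
  "indep (add_edge vertex.A vertex.Q (neighbour_rows triangles17)) (mark zeros2 (const False)) zeros2"
  "opens (add_edge vertex.A vertex.Q (neighbour_rows triangles17)) zeros2 = [(vertex.J,vertex.Q)]"
  by (simp_all only: triangles17_def zeros2_def evaluate cong: if_weak_cong)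

text \<open>Joined pairs do not show up either, as both ends reach themselves in two steps. So the
  list being empty says that every missing edge would close a triangle or a square.\<close>

lemma opens_row17: "opens row17 vertices = []"
  by (simp only: row17_def evaluate cong: if_weak_cong)

lemma E17_sym: "E17 x y \<Longrightarrow> E17 y x"
  by (cases x; cases y; simp add: E17_def row17_def)

lemma E17_irrefl: "\<not> E17 x x"
  by (cases x; simp add: E17_def row17_def)

text \<open>The triangle edges and the two forced edges are all of \<open>row17\<close>; any further
  edge of \<open>E\<close> would be an open pair.\<close>

lemma E17_unique:
  assumes c: "crit E (blks triangles17)"
  shows "E x y \<longleftrightarrow> E17 x y"
proof -
  have "threes (blks triangles17)" by (rule crit_threes[OF c])
  then have "within (neighbour_rows triangles17) E" "covers (neighbour_rows triangles17) (blks triangles17)"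
    using neighbour_rows_adj crit_adj[OF c] unfolding within_def covers_def by simp_all
  from forced_edge[OF c this zeros_1] have *: "within (add_edge vertex.A vertex.Q (neighbour_rows triangles17)) E" "covers (add_edge vertex.A vertex.Q (neighbour_rows triangles17)) (blks triangles17)" .
  from forced_edge[OF c * zeros_2] have s: "within row17 E" "covers row17 (blks triangles17)" unfolding row17_eq .
  have E17: "E17 x y \<longleftrightarrow> y \<in> set (get row17 x)" for x y unfolding E17_def by simp
  show ?thesis
  proof
    assume e: "E x y"
    show "E17 x y"
    proof (rule ccontr)
      assume n: "\<not> E17 x y"
      then have n': "y \<notin> set (get row17 x)" "x \<notin> set (get row17 y)" using E17_sym E17 by blast+
      have "x \<noteq> y" using e crit_irrefl[OF c] by metis
      then have "blocked row17 x y \<or> blocked row17 y x"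
        using opens_pair[of x vertices y row17] opens_row17 by (auto simp: set_vertices)
      then show False
        using not_blocked[OF c s e n'] not_blocked[OF c s crit_sym[OF c e] n'(2,1)] by blast
    qed
  next
    assume "E17 x y"
    then show "E x y" using s(1) unfolding E17 within_def by blast
  qed
qed

text \<open>With \<open>f\<close> listing neighbours, the concatenation lists the ends of all walks
  of two steps from \<open>x\<close> that do not return to \<open>x\<close>. In a square through
  \<open>x\<close> the opposite vertex would be listed twice, once for each of two neighbours of
  \<open>x\<close>.\<close>

lemma no_square_if:
  assumes "distinct (concat (map (\<lambda>a. filter (\<lambda>w. w \<noteq> x) (f a)) (f x)))" "distinct (f x)"
    and "a \<in> set (f x)" "b \<in> set (f x)" "a \<noteq> b" "c \<in> set (f a)" "c \<in> set (f b)" "c \<noteq> x"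
  shows False
proof -
  obtain us vs where u: "f x = us @ a # vs" using assms(3) by (meson split_list)
  then have "b \<in> set us \<or> b \<in> set vs" using assms(4,5) by auto
  then show False using assms(1,6-8) unfolding u by auto
qed

lemma row17_distinct:
  "distinct (get row17 x)"
  "distinct (concat (map (\<lambda>a. filter (\<lambda>w. w \<noteq> x) (get row17 a)) (get row17 x)))"
  by (cases x; simp add: row17_def)+

lemma E17_squarefree: "squarefree E17"
  unfolding squarefree_def
proof (intro allI impI notI)
  fix a b c d assume d: "distinct [a,b,c,d]" and e: "E17 a b \<and> E17 b c \<and> E17 c d \<and> E17 d a"
  then have "b \<in> set (get row17 a)" "d \<in> set (get row17 a)" "c \<in> set (get row17 b)" "c \<in> set (get row17 d)"
    using E17_sym[of c d] E17_sym[of d a] unfolding E17_def by simp_all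
  then show False using no_square_if[of a "get row17" b d c] row17_distinct[of a] d by auto
qed

lemma E17_uncolourable:
  assumes i: "\<And>x y. x \<in> W \<Longrightarrow> y \<in> W \<Longrightarrow> \<not> E17 x y" and h: "\<And>t. t \<in> blks triangles17 \<Longrightarrow> W \<inter> t \<noteq> {}"
  shows False
proof -
  have t: "\<forall>(a,b,c)\<in>set triangles17. a \<in> W \<or> b \<in> W \<or> c \<in> W" using h mem_blks by fastforce
  have "\<forall>x\<in>set vertices. \<forall>y\<in>set (get row17 x). \<not> (x \<in> W \<and> y \<in> W)" using i unfolding E17_def by auto
  then have e: "\<forall>x\<in>set vertices. list_all (\<lambda>y. \<not> (x \<in> W \<and> y \<in> W)) (get row17 x)" by (simp add: list_all_iff)
  \<comment> \<open>What remains is a propositional problem in the 17 memberships in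
    \<open>W\<close>: a clause with three positive literals per triangle and one with two negative
    literals per edge.\<close>
  show False using e[unfolded vertices_def row17_def, simplified] t[unfolded triangles17_def, simplified] by sat
qed

lemma triangles17_adjacent: "t \<in> blks triangles17 \<Longrightarrow> \<exists>a b c. t = {a,b,c} \<and> E17 a b \<and> E17 b c \<and> E17 a c"
proof -
  have "\<forall>(a,b,c)\<in>set triangles17. E17 a b \<and> E17 b c \<and> E17 a c"
    by (simp add: triangles17_def E17_def row17_def)
  then show "t \<in> blks triangles17 \<Longrightarrow> \<exists>a b c. t = {a,b,c} \<and> E17 a b \<and> E17 b c \<and> E17 a c"
    unfolding blks_def by fastforce
qed

section \<open>From arbitrary graphs to the seventeen labels\<close>

lemma transfer_crit:
  fixes E :: "'a \<Rightarrow> 'a \<Rightarrow> bool" and h :: "'a \<Rightarrow> vertex"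
  assumes g: "simple_graph V E" "square_free V E" "\<not> colourable_101 V E" and h: "inj_on h V"
  defines "E' \<equiv> \<lambda>a b. \<exists>x\<in>V. \<exists>y\<in>V. a = h x \<and> b = h y \<and> E x y"
  shows "crit E' {{a,b,c} | a b c. E' a b \<and> E' b c \<and> E' a c}" (is "crit E' ?S")
proof -
  have sym: "E x y \<Longrightarrow> E y x" and irr: "\<not> E x x" for x y using g(1) unfolding simple_graph_def by blast+
  have E': "E' (h x) (h y) \<longleftrightarrow> E x y" if "x \<in> V" "y \<in> V" for x y
    using that h unfolding E'_def by (auto dest: inj_onD)
  have mem: "\<exists>x\<in>V. a = h x" "\<exists>x\<in>V. b = h x" if "E' a b" for a b using that unfolding E'_def by blast+
  have sym': "E' b a" if "E' a b" for a b using that sym unfolding E'_def by blast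
  have irr': "\<not> E' a a" for a
  proof
    assume "E' a a"
    moreover from this obtain x where "x \<in> V" "a = h x" using mem by blast
    ultimately show False using E' irr by blast
  qed
  have sq: "squarefree E'"
    unfolding squarefree_def
  proof (intro allI impI notI)
    fix a b c d assume ds: "distinct [a,b,c,d]" and e: "E' a b \<and> E' b c \<and> E' c d \<and> E' d a"
    obtain w x y z where V: "w \<in> V" "x \<in> V" "y \<in> V" "z \<in> V" and eq: "a = h w" "b = h x" "c = h y" "d = h z"
      using e mem by metis
    have "distinct [w,x,y,z]" using ds unfolding eq by auto
    moreover have "E w x \<and> E x y \<and> E y z \<and> E z w" using e E' V unfolding eq by simp
    ultimately show False using g(2) V unfolding square_free_def by blast
  qed
  have un: "\<exists>t\<in>?S. W \<inter> t = {}" if W: "\<forall>a\<in>W. \<forall>b\<in>W. \<not> E' a b" for W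
  proof (rule ccontr)
    assume n: "\<not> (\<exists>t\<in>?S. W \<inter> t = {})"
    \<comment> \<open>An independent set meeting all triangles of the copy yields a colouring of the
      original graph, with the preimage of \<open>W\<close> as its zeros. Labels outside the image
      of \<open>h\<close> are isolated in the copy and lie in no triangle.\<close>
    let ?f = "\<lambda>x. if h x \<in> W then 0 else (1::nat)"
    have 1: "\<not> (?f x = 0 \<and> ?f y = 0)" if "x \<in> V" "y \<in> V" "E x y" for x y
      using W E'[OF that(1,2)] that(3) by auto
    have 2: "\<not> (?f x = 1 \<and> ?f y = 1 \<and> ?f z = 1)" if V: "x \<in> V" "y \<in> V" "z \<in> V" and e: "E x y" "E y z" "E x z" for x y z
    proof
      assume f: "?f x = 1 \<and> ?f y = 1 \<and> ?f z = 1"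
      have "{h x, h y, h z} \<in> ?S" using E' V e by blast
      moreover have "W \<inter> {h x, h y, h z} = {}" using f by (auto split: if_splits)
      ultimately show False using n by blast
    qed
    have "colourable_101 V E"
      unfolding colourable_101_def by (rule exI[of _ ?f]) (use 1 2 in auto)
    then show False using g(3) by simp
  qed
  show ?thesis
    unfolding crit_def
  proof (intro conjI allI impI ballI)
    show "squarefree E'" by (rule sq)
    show "E' y x" if "E' x y" for x y by (rule sym'[OF that])
    show "\<not> E' x x" for x by (rule irr')
    show "{x,y,z} \<in> ?S" if "E' x y \<and> E' y z \<and> E' x z" for x y z using that by blast
    show "card t = 3" if m: "t \<in> ?S" for t
    proof -
      obtain a b c where t: "t = {a,b,c}" "E' a b" "E' b c" "E' a c" using m by blast
      then have "distinct [a,b,c]" using irr' by auto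
      then show ?thesis unfolding t(1) card3 .
    qed
    show "E' x y" if m: "t \<in> ?S" "x \<in> t" "y \<in> t" "x \<noteq> y" for t x y
    proof -
      obtain a b c where t: "t = {a,b,c}" "E' a b" "E' b c" "E' a c" using m(1) by blast
      then show ?thesis using m(2-4) sym' by auto
    qed
    show "\<exists>t\<in>?S. W \<inter> t = {}" if "\<forall>x\<in>W. \<forall>y\<in>W. \<not> E' x y" for W by (rule un[OF that])
  qed
qed

text \<open>This excludes fewer than 17 vertices: a padded graph has an isolated label, the
  exceptional graph has none.\<close>

lemma E17_neighbour: "\<exists>y. E17 x y"
  by (cases x) (auto simp: E17_def row17_def)

lemma card_vertices: "card (UNIV :: vertex set) = 17"
  using distinct_card[OF distinct_vertices] by (simp add: set_vertices) (simp add: vertices_def)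

lemma uncolourable_iso:
  fixes E :: "'a \<Rightarrow> 'a \<Rightarrow> bool"
  assumes g: "simple_graph V E" "square_free V E" "\<not> colourable_101 V E" and "card V \<le> 17"
  shows "\<exists>f. bij_betw f V (UNIV :: vertex set) \<and> (\<forall>x\<in>V. \<forall>y\<in>V. E x y \<longleftrightarrow> E17 (f x) (f y))"
proof -
  have "finite V" using g(1) unfolding simple_graph_def by blast
  then obtain h :: "'a \<Rightarrow> vertex" where h: "inj_on h V"
    using card_le_inj[of V "UNIV :: vertex set"] assms(4) card_vertices by auto
  define E' where "E' = (\<lambda>a b. \<exists>x\<in>V. \<exists>y\<in>V. a = h x \<and> b = h y \<and> E x y)"
  have c: "crit E' {{a,b,c} | a b c. E' a b \<and> E' b c \<and> E' a c}"
    using transfer_crit[OF g h] unfolding E'_def .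
  obtain k where k: "bij k" "crit (\<lambda>x y. E' (k x) (k y)) (blks triangles17)"
    using only_11[OF c card_crit[OF c]] by blast
  have E17: "E' (k x) (k y) \<longleftrightarrow> E17 x y" for x y by (rule E17_unique[OF k(2)])
  \<comment> \<open>Every label is an end of an edge of the exceptional graph, and edges of the copy
    have both ends in the image of \<open>h\<close>; hence no label was added by padding.\<close>
  have "h ` V = UNIV"
  proof -
    have "k x \<in> h ` V" for x using E17_neighbour[of x] unfolding E17[symmetric] E'_def by blast
    then have "range k \<subseteq> h ` V" by blast
    then show ?thesis using k(1) by (simp add: bij_is_surj top.extremum_unique)
  qed
  then have "bij_betw h V UNIV" using h unfolding bij_betw_def by simp
  then have "bij_betw (inv k \<circ> h) V UNIV" using bij_betw_trans bij_imp_bij_inv[OF k(1)] by blast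
  moreover have "E x y \<longleftrightarrow> E17 ((inv k \<circ> h) x) ((inv k \<circ> h) y)" if "x \<in> V" "y \<in> V" for x y
  proof -
    have ki: "k (inv k a) = a" for a using k(1) by (simp add: bij_is_surj surj_f_inv_f)
    have "E17 ((inv k \<circ> h) x) ((inv k \<circ> h) y) \<longleftrightarrow> E' (h x) (h y)" unfolding E17[symmetric] comp_apply ki ..
    also have "\<dots> \<longleftrightarrow> E x y" using that h unfolding E'_def by (auto dest: inj_onD)
    finally show ?thesis by simp
  qed
  ultimately show ?thesis by blast
qed

text \<open>The exceptional graph is restated on numbers, each the position of a label in
  \<open>vertices\<close>. The bounds belong to the relation because edges of a
  \<open>simple_graph\<close> must stay inside the vertex set.\<close>

definition G17 :: "nat \<Rightarrow> nat \<Rightarrow> bool" where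
  "G17 i j \<longleftrightarrow> i < 17 \<and> j < 17 \<and> E17 (vertices ! i) (vertices ! j)"

lemma nth_vertices: "bij_betw ((!) vertices) {..<17} UNIV"
  using bij_betw_nth[OF distinct_vertices, of "{..<17}" UNIV] set_vertices by (simp add: vertices_def)

lemma G17_simple: "simple_graph {..<17} G17"
  using E17_sym E17_irrefl unfolding simple_graph_def G17_def by auto

lemma G17_square_free: "square_free {..<17} G17"
  unfolding square_free_def
proof (intro notI, elim exE conjE)
  fix a b c d :: nat
  assume "a \<in> {..<17}" "b \<in> {..<17}" "c \<in> {..<17}" "d \<in> {..<17}" and ds: "distinct [a,b,c,d]"
    and e: "G17 a b" "G17 b c" "G17 c d" "G17 d a"
  then have "distinct [vertices ! a, vertices ! b, vertices ! c, vertices ! d]"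
    using bij_betw_imp_inj_on[OF nth_vertices] by (simp add: inj_on_eq_iff)
  from E17_squarefree[unfolded squarefree_def, rule_format, OF this] show False
    using e unfolding G17_def by simp
qed

lemma G17_uncolourable: "\<not> colourable_101 {..<17} G17"
proof
  assume "colourable_101 {..<17} G17"
  then obtain f :: "nat \<Rightarrow> nat" where f: "\<forall>x\<in>{..<17}. f x \<in> {0, 1}"
    and 1: "\<forall>x\<in>{..<17}. \<forall>y\<in>{..<17}. G17 x y \<longrightarrow> \<not> (f x = 0 \<and> f y = 0)"
    and 2: "\<forall>x\<in>{..<17}. \<forall>y\<in>{..<17}. \<forall>z\<in>{..<17}. G17 x y \<and> G17 y z \<and> G17 x z \<longrightarrow> \<not> (f x = 1 \<and> f y = 1 \<and> f z = 1)"
    unfolding colourable_101_def by blast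
  have surj: "\<exists>i<17. a = vertices ! i" for a using nth_vertices unfolding bij_betw_def by auto
  let ?W = "{vertices ! i | i. i < 17 \<and> f i = 0}"
  show False
  proof (rule E17_uncolourable[of ?W])
    fix x y assume "x \<in> ?W" "y \<in> ?W"
    then show "\<not> E17 x y" using 1 unfolding G17_def by fastforce
  next
    fix t assume "t \<in> blks triangles17"
    then obtain a b c where "t = {a,b,c}" "E17 a b" "E17 b c" "E17 a c"
      using triangles17_adjacent by blast
    moreover from this obtain i j k where ijk: "i < 17" "a = vertices ! i" "j < 17" "b = vertices ! j" "k < 17" "c = vertices ! k"
      using surj by metis
    ultimately have "G17 i j \<and> G17 j k \<and> G17 i k" unfolding G17_def by simp
    then have "\<not> (f i = 1 \<and> f j = 1 \<and> f k = 1)" using 2 ijk by simp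
    then have "f i = 0 \<or> f j = 0 \<or> f k = 0" using f ijk by (metis lessThan_iff insertE singletonD)
    then have "a \<in> ?W \<or> b \<in> ?W \<or> c \<in> ?W" using ijk by blast
    then show "?W \<inter> t \<noteq> {}" using \<open>t = {a,b,c}\<close> by blast
  qed
qed

theorem mainTheorem12:
  shows "(\<forall>(V :: 'a set) E. simple_graph V E \<and> square_free V E \<and> card V \<le> 16
            \<longrightarrow> colourable_101 V E)
       \<and> (\<exists>(V0 :: nat set) E0. simple_graph V0 E0 \<and> square_free V0 E0 \<and> card V0 = 17
            \<and> \<not> colourable_101 V0 E0
            \<and> (\<forall>(V :: 'b set) E. simple_graph V E \<and> square_free V E \<and> card V = 17
                  \<and> \<not> colourable_101 V E \<longrightarrow> graph_iso V E V0 E0))"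
proof (intro conjI)
  show "\<forall>(V :: 'a set) E. simple_graph V E \<and> square_free V E \<and> card V \<le> 16 \<longrightarrow> colourable_101 V E"
  proof (intro allI impI, rule ccontr)
    fix V :: "'a set" and E assume a: "simple_graph V E \<and> square_free V E \<and> card V \<le> 16" "\<not> colourable_101 V E"
    then obtain f where "bij_betw f V (UNIV :: vertex set)" using uncolourable_iso[of V E] by auto
    then show False using bij_betw_same_card card_vertices a(1) by fastforce
  qed
  have "graph_iso V E {..<17} G17"
    if g: "simple_graph V E \<and> square_free V E \<and> card V = 17 \<and> \<not> colourable_101 V E" for V :: "'b set" and E
  proof -
    obtain f where f: "bij_betw f V (UNIV :: vertex set)" "\<forall>x\<in>V. \<forall>y\<in>V. E x y \<longleftrightarrow> E17 (f x) (f y)"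
      using uncolourable_iso[of V E] g by auto
    let ?k = "inv_into {..<17} ((!) vertices)"
    have k: "bij_betw ?k UNIV {..<17}" by (rule bij_betw_inv_into[OF nth_vertices])
    have kl: "vertices ! ?k a = a" "?k a < 17" for a
      using bij_betw_inv_into_right[OF nth_vertices, of a] bij_betw_apply[OF k, of a] by auto
    have "bij_betw (?k \<circ> f) V {..<17}" by (rule bij_betw_trans[OF f(1) k])
    moreover have "\<forall>x\<in>V. \<forall>y\<in>V. E x y \<longleftrightarrow> G17 ((?k \<circ> f) x) ((?k \<circ> f) y)"
      using f(2) kl unfolding G17_def by simp
    ultimately show ?thesis unfolding graph_iso_def by blast
  qed
  then show "\<exists>(V0 :: nat set) E0. simple_graph V0 E0 \<and> square_free V0 E0 \<and> card V0 = 17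
            \<and> \<not> colourable_101 V0 E0
            \<and> (\<forall>(V :: 'b set) E. simple_graph V E \<and> square_free V E \<and> card V = 17
                  \<and> \<not> colourable_101 V E \<longrightarrow> graph_iso V E V0 E0)"
    using G17_simple G17_square_free G17_uncolourable
    by (intro exI[of _ "{..<17}"] exI[of _ G17]) simp
qed

end
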